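(* For the investor with asymptotic preferences, any $\mathbf{D}$-policy is dominated by some linear $\mathbf{D}$-policy.
   Context: The mispricing $x_t$ of an asset follows the Ornstein-Uhlenbeck process $dx_t=-\alpha x_t\,dt+\sigma\,dz_t$, where $z_t$ is a standard Wiener process, $\alpha>0$ and $\sigma>0$. An investment policy is a leverage function $f(x)$ of the mispricing; under the policy $f$ the logarithm of the investor's wealth $u_t$ evolves according to $du_t=f(x_t)\,dx_t$ (in the Itô sense). A $\mathbf{D}$-policy is a policy $f\in C^1(-\infty,+\infty)$ with $|f'(x)|\le K$ for all $x$, where $K$ is a fixed constant; a linear policy is one that is linear as a function of $x$. The investor has asymptotic preferences, i.e. his utility is $$U=\liminf_{t\to\infty}\frac1t\left[E(u_t)-\gamma\,\mathrm{Var}(u_t)\right],$$ where the parameter $\gamma$ measures risk aversion. Domination is understood asymptotically: a non-linear policy is dominated by a linear policy if, in the long run, the linear policy has higher expected growth of the logarithm of wealth $u_t$ and lower growth of the variance of $u_t$. *)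

theory Defs
  imports "HOL-Probability.Probability"
begin

section \<open>Filtered probability space and Wiener process\<close>

text \<open>Time is indexed by \<^typ>\<open>real\<close>, but only nonnegative times are ever used; the values of
  a filtration or of a process at negative times play no role.\<close>

definition filtered_prob_space :: "'a measure \<Rightarrow> (real \<Rightarrow> 'a measure) \<Rightarrow> bool" where
  "filtered_prob_space M F \<longleftrightarrow>
     prob_space M \<and> filtration (space M) F \<and> (\<forall>t. subalgebra M (F t))"

text \<open>The increment \<open>z t - z s\<close> is required to be independent of the whole past \<open>F s\<close>, and not
  only of the past of \<open>z\<close>, so that \<open>F\<close> may also carry the initial mispricing.\<close>

definition wiener_process ::
  "'a measure \<Rightarrow> (real \<Rightarrow> 'a measure) \<Rightarrow> (real \<Rightarrow> 'a \<Rightarrow> real) \<Rightarrow> bool" where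
  "wiener_process M F z \<longleftrightarrow>
     (\<forall>\<omega>\<in>space M. z 0 \<omega> = 0) \<and>
     (\<forall>\<omega>\<in>space M. continuous_on {0..} (\<lambda>t. z t \<omega>)) \<and>
     (\<forall>t\<ge>0. z t \<in> borel_measurable (F t)) \<and>
     (\<forall>s t. 0 \<le> s \<longrightarrow> s < t \<longrightarrow>
        distributed M lborel (\<lambda>\<omega>. z t \<omega> - z s \<omega>) (normal_density 0 (sqrt (t - s))) \<and>
        prob_space.indep_set M (sets (F s))
          (sets (vimage_algebra (space M) (\<lambda>\<omega>. z t \<omega> - z s \<omega>) borel)))"


section \<open>The Ito integral\<close>

text \<open>The integral of a square integrable adapted integrand over \<open>{0..T}\<close> is the mean square limit
  of the integrals of elementary processes that approximate the integrand in mean square.  An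
  elementary process is given by times \<open>0 = \<tau> 0 \<le> \<dots> \<le> \<tau> N = T\<close> and, for \<open>i < N\<close>, by its value
  \<open>\<xi> i\<close> on \<open>{\<tau> i..<\<tau> (Suc i)}\<close>, which has to be known at time \<open>\<tau> i\<close>.\<close>

definition elementary_data ::
  "'a measure \<Rightarrow> (real \<Rightarrow> 'a measure) \<Rightarrow> real \<Rightarrow> nat \<Rightarrow> (nat \<Rightarrow> real) \<Rightarrow> (nat \<Rightarrow> 'a \<Rightarrow> real) \<Rightarrow> bool"
where
  "elementary_data M F T N \<tau> \<xi> \<longleftrightarrow>
     \<tau> 0 = 0 \<and> \<tau> N = T \<and>
     (\<forall>i<N. \<tau> i \<le> \<tau> (Suc i) \<and> \<xi> i \<in> borel_measurable (F (\<tau> i)) \<and>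
            integrable M (\<lambda>\<omega>. (\<xi> i \<omega>)\<^sup>2))"

definition elementary_process ::
  "nat \<Rightarrow> (nat \<Rightarrow> real) \<Rightarrow> (nat \<Rightarrow> 'a \<Rightarrow> real) \<Rightarrow> real \<Rightarrow> 'a \<Rightarrow> real" where
  "elementary_process N \<tau> \<xi> s \<omega> = (\<Sum>i<N. \<xi> i \<omega> * indicator {\<tau> i..<\<tau> (Suc i)} s)"

definition elementary_integral ::
  "(real \<Rightarrow> 'a \<Rightarrow> real) \<Rightarrow> nat \<Rightarrow> (nat \<Rightarrow> real) \<Rightarrow> (nat \<Rightarrow> 'a \<Rightarrow> real) \<Rightarrow> 'a \<Rightarrow> real" where
  "elementary_integral z N \<tau> \<xi> \<omega> = (\<Sum>i<N. \<xi> i \<omega> * (z (\<tau> (Suc i)) \<omega> - z (\<tau> i) \<omega>))"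

definition ito_integrand ::
  "'a measure \<Rightarrow> (real \<Rightarrow> 'a measure) \<Rightarrow> real \<Rightarrow> (real \<Rightarrow> 'a \<Rightarrow> real) \<Rightarrow> bool" where
  "ito_integrand M F T H \<longleftrightarrow>
     (\<lambda>(s, \<omega>). H s \<omega>) \<in> borel_measurable (restrict_space borel {0..T} \<Otimes>\<^sub>M M) \<and>
     (\<forall>s\<in>{0..T}. H s \<in> borel_measurable (F s)) \<and>
     (\<integral>\<^sup>+\<omega>. (\<integral>\<^sup>+s\<in>{0..T}. ennreal ((H s \<omega>)\<^sup>2) \<partial>lborel) \<partial>M) < \<infinity>"

definition has_ito_integral ::
  "'a measure \<Rightarrow> (real \<Rightarrow> 'a measure) \<Rightarrow> (real \<Rightarrow> 'a \<Rightarrow> real) \<Rightarrow> real \<Rightarrow>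
   (real \<Rightarrow> 'a \<Rightarrow> real) \<Rightarrow> ('a \<Rightarrow> real) \<Rightarrow> bool" where
  "has_ito_integral M F z T H I \<longleftrightarrow>
     ito_integrand M F T H \<and> I \<in> borel_measurable M \<and>
     (\<exists>N \<tau> \<xi>.
        (\<forall>n. elementary_data M F T (N n) (\<tau> n) (\<xi> n)) \<and>
        (\<lambda>n. \<integral>\<^sup>+\<omega>. (\<integral>\<^sup>+s\<in>{0..T}.
           ennreal ((elementary_process (N n) (\<tau> n) (\<xi> n) s \<omega> - H s \<omega>)\<^sup>2) \<partial>lborel) \<partial>M)
          \<longlonglongrightarrow> 0 \<and>
        (\<lambda>n. \<integral>\<^sup>+\<omega>. ennreal ((elementary_integral z (N n) (\<tau> n) (\<xi> n) \<omega> - I \<omega>)\<^sup>2) \<partial>M)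
          \<longlonglongrightarrow> 0)"

text \<open>\<open>X\<close> is an adapted continuous process with \<open>dX = a dt + b dz\<close>.\<close>

definition has_ito_differential ::
  "'a measure \<Rightarrow> (real \<Rightarrow> 'a measure) \<Rightarrow> (real \<Rightarrow> 'a \<Rightarrow> real) \<Rightarrow> (real \<Rightarrow> 'a \<Rightarrow> real) \<Rightarrow>
   (real \<Rightarrow> 'a \<Rightarrow> real) \<Rightarrow> (real \<Rightarrow> 'a \<Rightarrow> real) \<Rightarrow> bool" where
  "has_ito_differential M F z X a b \<longleftrightarrow>
     (\<forall>t\<ge>0. X t \<in> borel_measurable (F t)) \<and>
     (\<forall>\<omega>\<in>space M. continuous_on {0..} (\<lambda>t. X t \<omega>)) \<and>
     (\<forall>t\<ge>0. \<exists>I. has_ito_integral M F z t b I \<and>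
        (AE \<omega> in M. set_integrable lborel {0..t} (\<lambda>s. a s \<omega>) \<and>
           X t \<omega> = X 0 \<omega> + (LBINT s:{0..t}. a s \<omega>) + I \<omega>))"


section \<open>Mispricing, policies and wealth\<close>

definition ornstein_uhlenbeck ::
  "'a measure \<Rightarrow> (real \<Rightarrow> 'a measure) \<Rightarrow> (real \<Rightarrow> 'a \<Rightarrow> real) \<Rightarrow> real \<Rightarrow> real \<Rightarrow>
   (real \<Rightarrow> 'a \<Rightarrow> real) \<Rightarrow> bool" where
  "ornstein_uhlenbeck M F z \<alpha> \<sigma> x \<longleftrightarrow>
     has_ito_differential M F z x (\<lambda>s \<omega>. - \<alpha> * x s \<omega>) (\<lambda>s \<omega>. \<sigma>)"

definition D_policy :: "real \<Rightarrow> (real \<Rightarrow> real) \<Rightarrow> bool" where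
  "D_policy K f \<longleftrightarrow> f C1_differentiable_on UNIV \<and> (\<forall>y. \<bar>deriv f y\<bar> \<le> K)"

text \<open>Linear as a function of the mispricing, that is, with a possible constant term.  A constant
  term \<open>b\<close> contributes \<open>b * (x t - x 0)\<close> to the log wealth, whose variance stays bounded, hence it affects no growth rate.\<close>

definition linear_policy :: "(real \<Rightarrow> real) \<Rightarrow> bool" where
  "linear_policy f \<longleftrightarrow> (\<exists>a b. \<forall>y. f y = a * y + b)"

text \<open>The log wealth \<open>u\<close>, with initial value \<open>w\<close>, satisfies \<open>du = f(x) dx\<close>, where \<open>dx\<close> stands for
  \<open>-\<alpha> x dt + \<sigma> dz\<close>.\<close>

definition log_wealth ::
  "'a measure \<Rightarrow> (real \<Rightarrow> 'a measure) \<Rightarrow> (real \<Rightarrow> 'a \<Rightarrow> real) \<Rightarrow> real \<Rightarrow> real \<Rightarrow>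
   (real \<Rightarrow> 'a \<Rightarrow> real) \<Rightarrow> real \<Rightarrow> (real \<Rightarrow> real) \<Rightarrow> (real \<Rightarrow> 'a \<Rightarrow> real) \<Rightarrow> bool" where
  "log_wealth M F z \<alpha> \<sigma> x w f u \<longleftrightarrow>
     (\<forall>\<omega>\<in>space M. u 0 \<omega> = w) \<and>
     has_ito_differential M F z u
       (\<lambda>s \<omega>. f (x s \<omega>) * (- \<alpha> * x s \<omega>)) (\<lambda>s \<omega>. f (x s \<omega>) * \<sigma>)"


section \<open>Asymptotic preferences and domination\<close>

text \<open>Square integrability is part of the definition, as the Bochner integral of a function that is
  not integrable is 0.\<close>

definition growth_rates ::
  "'a measure \<Rightarrow> (real \<Rightarrow> 'a \<Rightarrow> real) \<Rightarrow> real \<Rightarrow> real \<Rightarrow> bool" where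
  "growth_rates M u m v \<longleftrightarrow>
     (\<forall>t\<ge>0. integrable M (u t) \<and> integrable M (\<lambda>\<omega>. (u t \<omega>)\<^sup>2)) \<and>
     ((\<lambda>t. prob_space.expectation M (u t) / t) \<longlongrightarrow> m) at_top \<and>
     ((\<lambda>t. prob_space.variance M (u t) / t) \<longlongrightarrow> v) at_top"

definition asymptotic_utility :: "'a measure \<Rightarrow> real \<Rightarrow> (real \<Rightarrow> 'a \<Rightarrow> real) \<Rightarrow> ereal" where
  "asymptotic_utility M \<gamma> u =
     Liminf at_top (\<lambda>t. ereal (1 / t *
       (prob_space.expectation M (u t) - \<gamma> * prob_space.variance M (u t))))"

definition dominated ::
  "'a measure \<Rightarrow> (real \<Rightarrow> 'a \<Rightarrow> real) \<Rightarrow> (real \<Rightarrow> 'a \<Rightarrow> real) \<Rightarrow> bool" where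
  "dominated M u u' \<longleftrightarrow>
     (\<exists>m v m' v'. growth_rates M u m v \<and> growth_rates M u' m' v' \<and> m < m' \<and> v' < v)"

text \<open>The weak form is needed for a policy that is itself linear: its variance has growth rate 0,
  so that it cannot be strictly dominated.\<close>

definition weakly_dominated ::
  "'a measure \<Rightarrow> (real \<Rightarrow> 'a \<Rightarrow> real) \<Rightarrow> (real \<Rightarrow> 'a \<Rightarrow> real) \<Rightarrow> bool" where
  "weakly_dominated M u u' \<longleftrightarrow>
     (\<exists>m v m' v'. growth_rates M u m v \<and> growth_rates M u' m' v' \<and> m \<le> m' \<and> v' \<le> v)"

end

theory Submission
  imports Defs
begin

text \<open>For \<open>G' = f\<close>, Ito's formula turns the log wealth into
  \<open>w + G (x t) - G (x 0) - \<sigma>\<^sup>2 / 2 * (INT s=0..t. f' (x s))\<close>, where only the last term grows in mean or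
  variance, the fourth moment of \<open>x t\<close> being bounded.  Let \<open>c\<close> be the mean of \<open>f'\<close> under the stationary
  law.  Since \<open>f'\<close> is bounded, Stein's equation \<open>\<sigma>\<^sup>2 / (2 \<alpha>) * \<psi>' y - y * \<psi> y = f' y - c\<close> has a bounded
  solution \<open>\<psi>\<close> with bounded derivative, so that \<open>\<psi>\<close> is itself a \<open>D\<close>-policy.  Ito's formula for
  \<open>\<Psi>' = \<psi>\<close> then expresses \<open>\<alpha> * ((INT s=0..t. f' (x s)) - c * t)\<close> as \<open>\<Psi> (x t) - \<Psi> (x 0)\<close> minus the
  martingale \<open>\<sigma> * (INT s=0..t. \<psi> (x s) dz s)\<close>.  Hence the growth rates of mean and variance are
  \<open>- \<sigma>\<^sup>2 / 2 * c\<close> and a positive multiple of the stationary mean of \<open>\<psi>\<^sup>2\<close>; that the latter is the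
  limit of time averages follows from Stein's equation again.  The policy \<open>y \<mapsto> - K * y\<close> has the rates
  \<open>\<sigma>\<^sup>2 / 2 * K\<close> and \<open>0\<close>, whereas \<open>c > - K\<close> and \<open>\<psi> \<noteq> 0\<close> unless \<open>f'\<close> is constant.\<close>

section \<open>Mean square convergence\<close>

text \<open>The Ito integral is known only through some approximating sequence. Ito's formula is
  therefore proved by showing that its right-hand side is the mean square limit along equidistant
  partitions; uniqueness of that limit then determines every log wealth process at each time, up to
  null sets. Two obstacles shape the estimates. First, \<open>f\<close> is merely C1, so the Taylor
  remainder has no rate; it is controlled by a bounded factor that vanishes pathwise, times the
  quadratic variation. Second, \<open>G\<close> grows quadratically, so the mean square of
  \<open>G (x t)\<close> involves the fourth moment of \<open>x t\<close>, which is why one is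
  assumed of \<open>x 0\<close>. Stein's equation is the Poisson equation of the process in
  disguise: for \<open>\<Psi>' = \<psi>\<close> the generator maps \<open>\<Psi>\<close> to
  \<open>\<alpha> * (f' - c)\<close>. The slope \<open>- K\<close> is the extreme case of the
  formula for the mean rate, which decreases in the stationary mean of \<open>f'\<close>; a constant
  \<open>f'\<close> leaves no fluctuating time integral, hence no growth of the variance.\<close>

definition msq :: "'a measure \<Rightarrow> ('a \<Rightarrow> real) \<Rightarrow> ennreal" where
  "msq M X = (\<integral>\<^sup>+\<omega>. ennreal ((X \<omega>)\<^sup>2) \<partial>M)"

text \<open>Measurability is part of the notion, so that sums and multiples of null sequences can be
  formed without side conditions.\<close>

definition msq_null :: "'a measure \<Rightarrow> (nat \<Rightarrow> 'a \<Rightarrow> real) \<Rightarrow> bool" where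
  "msq_null M X \<longleftrightarrow> (\<forall>n. X n \<in> borel_measurable M) \<and> (\<lambda>n. msq M (X n)) \<longlonglongrightarrow> 0"

text \<open>The free weight \<open>e\<close> keeps the coefficient of the first square close to 1.
  Letting it tend to 0 yields sharp inequalities between limits, whereas \<open>e = 1\<close> gives
  the crude factor 2.\<close>

lemma power2_add_le:
  fixes x y e :: real
  assumes "0 < e"
  shows "(x + y)\<^sup>2 \<le> (1 + e) * x\<^sup>2 + (1 + 1 / e) * y\<^sup>2"
proof -
  have "0 \<le> (e * x - y)\<^sup>2 / e" using assms by simp
  also have "\<dots> = (1 + e) * x\<^sup>2 + (1 + 1 / e) * y\<^sup>2 - (x + y)\<^sup>2"
    using assms by (simp add: power2_eq_square field_simps)
  finally show ?thesis by simp
qed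

lemma msq_add_le:
  assumes [measurable]: "X \<in> borel_measurable M" "Y \<in> borel_measurable M" and "0 < e"
  shows "msq M (\<lambda>\<omega>. X \<omega> + Y \<omega>) \<le> ennreal (1 + e) * msq M X + ennreal (1 + 1 / e) * msq M Y"
proof -
  have "msq M (\<lambda>\<omega>. X \<omega> + Y \<omega>)
      \<le> (\<integral>\<^sup>+\<omega>. ennreal (1 + e) * ennreal ((X \<omega>)\<^sup>2) + ennreal (1 + 1 / e) * ennreal ((Y \<omega>)\<^sup>2) \<partial>M)"
    unfolding msq_def
  proof (rule nn_integral_mono)
    fix \<omega>
    have "ennreal ((X \<omega> + Y \<omega>)\<^sup>2) \<le> ennreal ((1 + e) * (X \<omega>)\<^sup>2 + (1 + 1 / e) * (Y \<omega>)\<^sup>2)"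
      by (intro ennreal_leI power2_add_le assms)
    also have "\<dots> = ennreal (1 + e) * ennreal ((X \<omega>)\<^sup>2) + ennreal (1 + 1 / e) * ennreal ((Y \<omega>)\<^sup>2)"
      using assms by (simp add: ennreal_plus ennreal_mult del: ennreal_1)
    finally show "ennreal ((X \<omega> + Y \<omega>)\<^sup>2)
      \<le> ennreal (1 + e) * ennreal ((X \<omega>)\<^sup>2) + ennreal (1 + 1 / e) * ennreal ((Y \<omega>)\<^sup>2)" .
  qed
  also have "\<dots> = ennreal (1 + e) * msq M X + ennreal (1 + 1 / e) * msq M Y"
    by (simp add: nn_integral_add nn_integral_cmult msq_def)
  finally show ?thesis .
qed

lemma msq_diff_commute: "msq M (\<lambda>\<omega>. X \<omega> - Y \<omega>) = msq M (\<lambda>\<omega>. Y \<omega> - X \<omega>)"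
  by (simp add: msq_def power2_commute)

lemma msq_mono_AE: "AE \<omega> in M. \<bar>X \<omega>\<bar> \<le> \<bar>Y \<omega>\<bar> \<Longrightarrow> msq M X \<le> msq M Y"
  unfolding msq_def by (intro nn_integral_mono_AE) (auto elim!: eventually_mono intro!: ennreal_leI simp: abs_le_square_iff)

lemma msq_cong_AE: "AE \<omega> in M. X \<omega> = Y \<omega> \<Longrightarrow> msq M X = msq M Y"
  unfolding msq_def by (intro nn_integral_cong_AE) auto

lemma msq_eq_0_imp_AE:
  assumes "X \<in> borel_measurable M" "msq M X = 0"
  shows "AE \<omega> in M. X \<omega> = 0"
  using assms by (auto simp: msq_def nn_integral_0_iff_AE)

lemma msq_cmult:
  assumes [measurable]: "X \<in> borel_measurable M"
  shows "msq M (\<lambda>\<omega>. c * X \<omega>) = ennreal (c\<^sup>2) * msq M X"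
  by (simp add: msq_def power_mult_distrib ennreal_mult nn_integral_cmult)

lemma msq_finite_iff:
  assumes "X \<in> borel_measurable M"
  shows "msq M X < \<infinity> \<longleftrightarrow> integrable M (\<lambda>\<omega>. (X \<omega>)\<^sup>2)"
  using assms by (simp add: msq_def integrable_iff_bounded)

lemma msq_eq_integral:
  assumes "integrable M (\<lambda>\<omega>. (X \<omega>)\<^sup>2)"
  shows "msq M X = ennreal (\<integral>\<omega>. (X \<omega>)\<^sup>2 \<partial>M)"
  using assms by (simp add: msq_def nn_integral_eq_integral)

text \<open>Cauchy-Schwarz against the constant sequence 1. The factor \<open>n\<close> squared is
  the price for saying nothing about the correlation of the summands.\<close>

lemma msq_sum_le:
  assumes [measurable]: "\<And>i. i < n \<Longrightarrow> X i \<in> borel_measurable M" and "0 \<le> c"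
    and le: "\<And>i. i < n \<Longrightarrow> msq M (X i) \<le> ennreal c"
  shows "msq M (\<lambda>\<omega>. \<Sum>i<n. X i \<omega>) \<le> ennreal ((real n)\<^sup>2 * c)"
proof -
  have "(\<Sum>i<n. y i)\<^sup>2 \<le> real n * (\<Sum>i<n. (y i)\<^sup>2)" for y :: "nat \<Rightarrow> real"
    using Cauchy_Schwarz_ineq_sum[of "\<lambda>_. 1" y "{..<n}"] by simp
  then have "msq M (\<lambda>\<omega>. \<Sum>i<n. X i \<omega>) \<le> (\<integral>\<^sup>+\<omega>. ennreal (real n * (\<Sum>i<n. (X i \<omega>)\<^sup>2)) \<partial>M)"
    unfolding msq_def by (intro nn_integral_mono ennreal_leI) auto
  also have "\<dots> = (\<integral>\<^sup>+\<omega>. ennreal (real n) * (\<Sum>i<n. ennreal ((X i \<omega>)\<^sup>2)) \<partial>M)"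
    by (intro nn_integral_cong) (simp add: ennreal_mult sum_nonneg)
  also have "\<dots> = ennreal (real n) * (\<integral>\<^sup>+\<omega>. (\<Sum>i<n. ennreal ((X i \<omega>)\<^sup>2)) \<partial>M)"
    by (rule nn_integral_cmult) measurable
  also have "(\<integral>\<^sup>+\<omega>. (\<Sum>i<n. ennreal ((X i \<omega>)\<^sup>2)) \<partial>M) = (\<Sum>i<n. msq M (X i))"
    unfolding msq_def by (rule nn_integral_sum) measurable
  also have "ennreal (real n) * (\<Sum>i<n. msq M (X i)) \<le> ennreal (real n) * (\<Sum>i<n. ennreal c)"
    by (intro mult_left_mono sum_mono le) auto
  also have "\<dots> = ennreal ((real n)\<^sup>2 * c)"
    using \<open>0 \<le> c\<close> by (simp add: sum_ennreal ennreal_mult[symmetric] ennreal_of_nat_eq_real_of_nat power2_eq_square mult.assoc)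
  finally show ?thesis .
qed

lemma msq_null_measurable: "msq_null M X \<Longrightarrow> X n \<in> borel_measurable M"
  by (simp add: msq_null_def)

lemma msq_null_bound:
  assumes "\<And>n. X n \<in> borel_measurable M" "\<And>n. msq M (X n) \<le> ennreal (c n)" "c \<longlonglongrightarrow> 0"
  shows "msq_null M X"
proof -
  have "(\<lambda>n. ennreal (c n)) \<longlonglongrightarrow> 0"
    using tendsto_ennrealI[OF assms(3)] by simp
  then have "(\<lambda>n. msq M (X n)) \<longlonglongrightarrow> 0"
    by (rule tendsto_sandwich[OF _ _ tendsto_const, rotated 2]) (auto simp: assms)
  then show ?thesis
    by (simp add: msq_null_def assms(1))
qed

text \<open>The domination is only almost sure because identities derived from the
  Ornstein-Uhlenbeck equation hold off a null set.\<close>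

lemma msq_null_dominated:
  assumes "\<And>n. X n \<in> borel_measurable M" "msq_null M Y" "\<And>n. AE \<omega> in M. \<bar>X n \<omega>\<bar> \<le> \<bar>Y n \<omega>\<bar>"
  shows "msq_null M X"
proof -
  have "(\<lambda>n. msq M (Y n)) \<longlonglongrightarrow> 0"
    using assms(2) by (simp add: msq_null_def)
  then have "(\<lambda>n. msq M (X n)) \<longlonglongrightarrow> 0"
    by (rule tendsto_sandwich[OF _ _ tendsto_const, rotated 2]) (auto simp: msq_mono_AE assms)
  then show ?thesis
    by (simp add: msq_null_def assms(1))
qed

lemma msq_null_add:
  assumes X: "msq_null M X" and Y: "msq_null M Y"
  shows "msq_null M (\<lambda>n \<omega>. X n \<omega> + Y n \<omega>)"
proof -
  note [measurable] = msq_null_measurable[OF X] msq_null_measurable[OF Y]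
  have "(\<lambda>n. ennreal 2 * msq M (X n) + ennreal 2 * msq M (Y n)) \<longlonglongrightarrow> ennreal 2 * 0 + ennreal 2 * 0"
    using X Y by (intro tendsto_add ennreal_tendsto_cmult) (auto simp: msq_null_def)
  then have lim: "(\<lambda>n. ennreal 2 * msq M (X n) + ennreal 2 * msq M (Y n)) \<longlonglongrightarrow> 0"
    by simp
  have "msq M (\<lambda>\<omega>. X n \<omega> + Y n \<omega>) \<le> ennreal 2 * msq M (X n) + ennreal 2 * msq M (Y n)" for n
    using msq_add_le[of "X n" M "Y n" 1] by simp
  then have "(\<lambda>n. msq M (\<lambda>\<omega>. X n \<omega> + Y n \<omega>)) \<longlonglongrightarrow> 0"
    by (intro tendsto_sandwich[OF _ _ tendsto_const lim]) auto
  then show ?thesis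
    by (simp add: msq_null_def)
qed

lemma msq_null_cmult:
  assumes X: "msq_null M X"
  shows "msq_null M (\<lambda>n \<omega>. c * X n \<omega>)"
proof -
  note [measurable] = msq_null_measurable[OF X]
  have "(\<lambda>n. ennreal (c\<^sup>2) * msq M (X n)) \<longlonglongrightarrow> ennreal (c\<^sup>2) * 0"
    using X by (intro ennreal_tendsto_cmult) (auto simp: msq_null_def)
  then show ?thesis
    by (simp add: msq_null_def msq_cmult)
qed

lemma msq_null_diff:
  assumes X: "msq_null M X" and Y: "msq_null M Y"
  shows "msq_null M (\<lambda>n \<omega>. X n \<omega> - Y n \<omega>)"
  using msq_null_add[OF X msq_null_cmult[OF Y, of "-1"]] by simp

lemma msq_null_bounded_mult:
  assumes "msq_null M X" "\<And>n. Y n \<in> borel_measurable M"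
    and "\<And>n \<omega>. \<omega> \<in> space M \<Longrightarrow> \<bar>Y n \<omega>\<bar> \<le> C"
  shows "msq_null M (\<lambda>n \<omega>. Y n \<omega> * X n \<omega>)"
proof (rule msq_null_dominated[OF _ msq_null_cmult[OF assms(1), of C]])
  note [measurable] = msq_null_measurable[OF assms(1)] assms(2)
  show "(\<lambda>\<omega>. Y n \<omega> * X n \<omega>) \<in> borel_measurable M" for n by simp
  show "AE \<omega> in M. \<bar>Y n \<omega> * X n \<omega>\<bar> \<le> \<bar>C * X n \<omega>\<bar>" for n
  proof (rule AE_I2)
    fix \<omega> assume "\<omega> \<in> space M"
    then have "\<bar>Y n \<omega>\<bar> \<le> \<bar>C\<bar>" using assms(3)[of \<omega> n] by simp
    then show "\<bar>Y n \<omega> * X n \<omega>\<bar> \<le> \<bar>C * X n \<omega>\<bar>" by (simp add: abs_mult mult_right_mono)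
  qed
qed

text \<open>Meant for the errors that have no rate: they vanish along each path and are uniformly
  bounded.\<close>

lemma msq_null_bounded_convergence:
  assumes "finite_measure M" and X[measurable]: "\<And>n. X n \<in> borel_measurable M"
    and bd: "\<And>n. AE \<omega> in M. \<bar>X n \<omega>\<bar> \<le> C"
    and lim: "AE \<omega> in M. (\<lambda>n. X n \<omega>) \<longlonglongrightarrow> 0"
  shows "msq_null M X"
proof -
  interpret finite_measure M by fact
  have "(\<lambda>n. \<integral>\<^sup>+\<omega>. ennreal ((X n \<omega>)\<^sup>2) \<partial>M) \<longlonglongrightarrow> (\<integral>\<^sup>+\<omega>. 0 \<partial>M)"
  proof (rule nn_integral_dominated_convergence[where w = "\<lambda>_. ennreal (C\<^sup>2)"])
    show "(\<integral>\<^sup>+\<omega>. ennreal (C\<^sup>2) \<partial>M) < \<infinity>"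
      by (simp add: ennreal_mult_less_top emeasure_eq_measure)
    show "AE \<omega> in M. ennreal ((X n \<omega>)\<^sup>2) \<le> ennreal (C\<^sup>2)" for n
      using bd[of n]
    proof eventually_elim
      case (elim \<omega>)
      then have "\<bar>X n \<omega>\<bar> \<le> \<bar>C\<bar>" by simp
      then show ?case by (intro ennreal_leI) (simp add: abs_le_square_iff)
    qed
    show "AE \<omega> in M. (\<lambda>n. ennreal ((X n \<omega>)\<^sup>2)) \<longlonglongrightarrow> 0"
      using lim
    proof eventually_elim
      case (elim \<omega>)
      then have "(\<lambda>n. (X n \<omega>)\<^sup>2) \<longlonglongrightarrow> 0\<^sup>2" by (rule tendsto_power)
      then show ?case using tendsto_ennrealI by fastforce
    qed
  qed auto
  then show ?thesis by (simp add: msq_null_def msq_def)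
qed

text \<open>Two measure spaces occur because the isometry compares the probability space with its
  product with time. Used in both directions the lemma carries the isometry to the limit; with limit
  0 on the right it gives uniqueness of the integral.\<close>

lemma msq_limit_le:
  assumes X: "msq_null M (\<lambda>n \<omega>. X' n \<omega> - X \<omega>)" and [measurable]: "X \<in> borel_measurable M"
    and Y: "msq_null N (\<lambda>n \<omega>. Y' n \<omega> - Y \<omega>)" and [measurable]: "Y \<in> borel_measurable N"
    and le: "\<And>n. msq M (X' n) \<le> msq N (Y' n)"
  shows "msq M X \<le> msq N Y"
proof -
  note [measurable] = msq_null_measurable[OF X] msq_null_measurable[OF Y]
  have meas[measurable]: "X' n \<in> borel_measurable M" "Y' n \<in> borel_measurable N" for n
  proof -
    have "(\<lambda>\<omega>. (X' n \<omega> - X \<omega>) + X \<omega>) \<in> borel_measurable M" by measurable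
    then show "X' n \<in> borel_measurable M" by simp
    have "(\<lambda>\<omega>. (Y' n \<omega> - Y \<omega>) + Y \<omega>) \<in> borel_measurable N" by measurable
    then show "Y' n \<in> borel_measurable N" by simp
  qed
  \<comment> \<open>The weighted inequality is applied once to pass from \<open>X\<close> to
    \<open>X' n\<close> and once to return from \<open>Y' n\<close> to \<open>Y\<close>, hence the
    square of \<open>1 + e\<close>.\<close>
  have step: "msq M X \<le> ennreal ((1 + e)\<^sup>2) * msq N Y" if "0 < e" for e :: real
  proof -
    let ?a = "ennreal (1 + e)" and ?b = "ennreal (1 + 1 / e)"
    let ?r = "\<lambda>n. ?a * (?a * msq N Y + ?b * msq N (\<lambda>\<omega>. Y' n \<omega> - Y \<omega>))
      + ?b * msq M (\<lambda>\<omega>. X' n \<omega> - X \<omega>)"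
    have "msq M X \<le> ?r n" for n
    proof -
      have "msq M X = msq M (\<lambda>\<omega>. X' n \<omega> + (X \<omega> - X' n \<omega>))" by simp
      also have "\<dots> \<le> ?a * msq M (X' n) + ?b * msq M (\<lambda>\<omega>. X' n \<omega> - X \<omega>)"
        using msq_add_le[of "X' n" M "\<lambda>\<omega>. X \<omega> - X' n \<omega>" e] that
        by (simp add: msq_diff_commute[of M X])
      also have "msq M (X' n) \<le> msq N (\<lambda>\<omega>. Y \<omega> + (Y' n \<omega> - Y \<omega>))" using le by simp
      also have "\<dots> \<le> ?a * msq N Y + ?b * msq N (\<lambda>\<omega>. Y' n \<omega> - Y \<omega>)"
        using msq_add_le[of Y N "\<lambda>\<omega>. Y' n \<omega> - Y \<omega>" e] that by simp
      finally show ?thesis by (simp add: add_right_mono mult_left_mono)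
    qed
    moreover have "?r \<longlonglongrightarrow> ?a * (?a * msq N Y + ?b * 0) + ?b * 0"
      using X Y by (intro tendsto_add ennreal_tendsto_cmult tendsto_const) (auto simp: msq_null_def)
    ultimately have "msq M X \<le> ?a * (?a * msq N Y + ?b * 0) + ?b * 0"
      by (intro LIMSEQ_le_const) auto
    also have "\<dots> = ennreal ((1 + e)\<^sup>2) * msq N Y"
      using that by (simp add: power2_eq_square ennreal_mult mult.assoc)
    finally show ?thesis .
  qed
  show ?thesis
  proof (cases "msq N Y = \<infinity>")
    case False
    have "(\<lambda>n. msq N Y * ennreal ((1 + inverse (real (Suc n)))\<^sup>2)) \<longlonglongrightarrow> msq N Y * ennreal ((1 + 0)\<^sup>2)"
      using False by (intro ennreal_tendsto_cmult tendsto_ennrealI tendsto_intros LIMSEQ_inverse_real_of_nat)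
        (auto simp: less_top)
    then have "msq M X \<le> msq N Y * ennreal ((1 + 0)\<^sup>2)"
      by (rule LIMSEQ_le_const)
        (use step[of "inverse (real (Suc n))" for n] in \<open>auto simp: mult.commute\<close>)
    then show ?thesis by simp
  qed simp
qed

section \<open>Stein's equation for the stationary law\<close>

definition stat_mean :: "real \<Rightarrow> (real \<Rightarrow> real) \<Rightarrow> real" where
  "stat_mean s h = (\<integral>y. h y * normal_density 0 s y \<partial>lborel)"

lemma DERIV_imp_continuous_on:
  "(\<And>y. (f has_real_derivative f' y) (at y)) \<Longrightarrow> continuous_on A f"
  by (meson DERIV_continuous_on DERIV_subset subset_UNIV)

lemma DERIV_normal_density:
  assumes "0 < s"
  shows "(normal_density 0 s has_real_derivative - (y / s\<^sup>2) * normal_density 0 s y) (at y)"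
proof -
  have "((\<lambda>y. 1 / sqrt (2 * pi * s\<^sup>2) * exp (- (y - 0)\<^sup>2 / (2 * s\<^sup>2))) has_real_derivative
      - (y / s\<^sup>2) * (1 / sqrt (2 * pi * s\<^sup>2) * exp (- (y - 0)\<^sup>2 / (2 * s\<^sup>2)))) (at y)"
    using assms by (auto intro!: derivative_eq_intros simp: field_simps power2_eq_square)
  then show ?thesis
    unfolding normal_density_def[abs_def] .
qed

lemma continuous_on_normal_density: "0 < s \<Longrightarrow> continuous_on A (normal_density 0 s)"
  by (rule DERIV_imp_continuous_on[OF DERIV_normal_density])

lemma integrable_bounded_normal_density:
  assumes "0 < s" "h \<in> borel_measurable borel" "\<And>y. \<bar>h y\<bar> \<le> B"
  shows "integrable lborel (\<lambda>y. h y * normal_density 0 s y)"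
proof (rule Bochner_Integration.integrable_bound)
  show "integrable lborel (\<lambda>y. B * normal_density 0 s y)"
    using assms(1) by simp
  show "(\<lambda>y. h y * normal_density 0 s y) \<in> borel_measurable lborel"
    using assms(2) by simp
  show "AE y in lborel. norm (h y * normal_density 0 s y) \<le> norm (B * normal_density 0 s y)"
  proof (rule AE_I2)
    fix y
    have "0 \<le> B" using assms(3)[of y] by simp
    then show "norm (h y * normal_density 0 s y) \<le> norm (B * normal_density 0 s y)"
      using assms(3)[of y] by (simp add: abs_mult mult_right_mono)
  qed
qed

lemma stat_mean_const: "0 < s \<Longrightarrow> stat_mean s (\<lambda>_. c) = c"
  by (simp add: stat_mean_def)

lemma stat_mean_diff_const:
  assumes "0 < s" "h \<in> borel_measurable borel" "\<And>y. \<bar>h y\<bar> \<le> B"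
  shows "stat_mean s (\<lambda>y. h y - c) = stat_mean s h - c"
proof -
  have "stat_mean s (\<lambda>y. h y - c) = (\<integral>y. h y * normal_density 0 s y - c * normal_density 0 s y \<partial>lborel)"
    by (simp add: stat_mean_def left_diff_distrib)
  also have "\<dots> = stat_mean s h - c"
    using integrable_bounded_normal_density[OF assms] assms(1)
    by (subst Bochner_Integration.integral_diff) (auto simp: stat_mean_def)
  finally show ?thesis .
qed

lemma stat_mean_nonneg: "0 < s \<Longrightarrow> (\<And>y. 0 \<le> h y) \<Longrightarrow> 0 \<le> stat_mean s h"
  by (simp add: stat_mean_def)

text \<open>If the mean were 0, then \<open>h\<close> would vanish almost everywhere, but by
  continuity the set where \<open>h\<close> is not 0 is open, and a nonempty open set is not null.
  This is the source of both strict inequalities of the theorem, with \<open>h\<close> equal to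
  \<open>f' + K\<close> and to the square of \<open>\<psi>\<close>.\<close>

lemma stat_mean_pos:
  assumes "0 < s" and cont: "continuous_on UNIV h" and bd: "\<And>y. \<bar>h y\<bar> \<le> B"
    and nonneg: "\<And>y. 0 \<le> h y" and "h y0 \<noteq> 0"
  shows "0 < stat_mean s h"
proof -
  have meas[measurable]: "h \<in> borel_measurable borel"
    using cont by (rule borel_measurable_continuous_onI)
  have "stat_mean s h \<noteq> 0"
  proof
    assume "stat_mean s h = 0"
    then have "AE y in lborel. h y * normal_density 0 s y = 0"
      using integrable_bounded_normal_density[OF assms(1) meas bd] nonneg
      by (simp add: stat_mean_def integral_nonneg_eq_0_iff_AE)
    then have "AE y in lborel. \<not> (h y \<noteq> 0)"
      by (rule eventually_mono) (use normal_density_pos[OF assms(1), of 0] in \<open>simp add: less_le\<close>)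
    then have "{y. h y \<noteq> 0} \<in> null_sets lborel"
      by (subst (asm) AE_iff_null) auto
    then have "negligible {y. h y \<noteq> 0}"
      by (simp add: negligible_iff_null_sets null_sets_completionI)
    moreover have "open {y. h y \<noteq> 0}"
      by (intro open_Collect_neq cont continuous_on_const)
    ultimately show False
      using \<open>h y0 \<noteq> 0\<close> open_not_negligible by blast
  qed
  moreover have "0 \<le> stat_mean s h"
    by (intro stat_mean_nonneg assms)
  ultimately show ?thesis by simp
qed

lemma stat_mean_abs_le:
  assumes "0 < s" "h \<in> borel_measurable borel" "\<And>y. \<bar>h y\<bar> \<le> B"
  shows "\<bar>stat_mean s h\<bar> \<le> B"
proof -
  have int: "integrable lborel (\<lambda>y. h y * normal_density 0 s y)"
    by (rule integrable_bounded_normal_density[OF assms])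
  have "norm (stat_mean s h) \<le> (\<integral>y. norm (h y * normal_density 0 s y) \<partial>lborel)"
    unfolding stat_mean_def by (rule integral_norm_bound)
  also have "\<dots> \<le> (\<integral>y. B * normal_density 0 s y \<partial>lborel)"
    using int assms(1,3) by (intro Bochner_Integration.integral_mono integrable_norm) (simp_all add: abs_mult mult_right_mono)
  finally have "norm (stat_mean s h) \<le> (\<integral>y. B * normal_density 0 s y \<partial>lborel)" .
  then show ?thesis using assms(1) by simp
qed

text \<open>Mills' ratio: on the tail \<open>y \<ge> x\<close> the weight \<open>x\<close> is at most \<open>y\<close>, and \<open>y * q y\<close> is the
  derivative of \<open>- s\<^sup>2 * q y\<close> for the normal density \<open>q\<close>.\<close>

lemma normal_tail_bound:
  assumes s: "0 < s" and x: "0 < x" and int: "integrable lborel k"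
    and k: "\<And>y. \<bar>k y\<bar> \<le> D * normal_density 0 s y"
  shows "x * \<bar>LBINT y:{x..}. k y\<bar> \<le> D * s\<^sup>2 * normal_density 0 s x"
proof -
  let ?q = "normal_density 0 s"
  have [measurable]: "k \<in> borel_measurable borel" using int by auto
  have D: "0 \<le> D"
    using k[of 0] normal_density_pos[OF s, of 0 0] by (smt (verit) mult_neg_pos)
  have lim: "(?q \<longlongrightarrow> 0) at_top"
    unfolding normal_density_def[abs_def] using s by real_asymp
  have tail: "(\<integral>\<^sup>+y. ennreal (y * ?q y) * indicator {x..} y \<partial>lborel) = ennreal (s\<^sup>2 * ?q x)"
  proof -
    have "(\<integral>\<^sup>+y. ennreal (y * ?q y) * indicator {x..} y \<partial>lborel) = ennreal (0 - (- s\<^sup>2 * ?q x))"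
    proof (rule nn_integral_FTC_atLeast)
      show "DERIV (\<lambda>y. - s\<^sup>2 * ?q y) y :> y * ?q y" for y
        by (rule derivative_eq_intros DERIV_normal_density s refl)+ (use s in simp)
      show "((\<lambda>y. - s\<^sup>2 * ?q y) \<longlongrightarrow> 0) at_top"
        using tendsto_mult[OF tendsto_const lim, of "- s\<^sup>2"] by simp
    qed (use x in auto)
    then show ?thesis by simp
  qed
  have "ennreal (x * \<bar>LBINT y:{x..}. k y\<bar>) = ennreal x * ennreal (norm (LBINT y:{x..}. k y))"
    using x by (simp add: ennreal_mult)
  also have "\<dots> \<le> ennreal x * (\<integral>\<^sup>+y. ennreal (norm (indicator {x..} y *\<^sub>R k y)) \<partial>lborel)"
    unfolding set_lebesgue_integral_def by (intro mult_left_mono integral_norm_bound_ennreal integrable_mult_indicator int) auto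
  also have "\<dots> = (\<integral>\<^sup>+y. ennreal x * ennreal (norm (indicator {x..} y *\<^sub>R k y)) \<partial>lborel)"
    by (simp add: nn_integral_cmult)
  also have "\<dots> \<le> (\<integral>\<^sup>+y. ennreal D * (ennreal (y * ?q y) * indicator {x..} y) \<partial>lborel)"
  proof (rule nn_integral_mono)
    fix y
    show "ennreal x * ennreal (norm (indicator {x..} y *\<^sub>R k y))
      \<le> ennreal D * (ennreal (y * ?q y) * indicator {x..} y)"
    proof (cases "x \<le> y")
      case True
      have "x * \<bar>k y\<bar> \<le> y * (D * ?q y)"
        using True x k[of y] by (intro mult_mono) auto
      then have "ennreal (x * \<bar>k y\<bar>) \<le> ennreal (D * (y * ?q y))"
        by (intro ennreal_leI) (simp add: ac_simps)
      then show ?thesis using True x D by (simp add: ennreal_mult)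
    qed simp
  qed
  also have "\<dots> = ennreal D * ennreal (s\<^sup>2 * ?q x)"
    by (simp add: nn_integral_cmult tail)
  also have "\<dots> = ennreal (D * s\<^sup>2 * ?q x)"
    using D by (simp add: ennreal_mult mult.assoc)
  finally show ?thesis using D by (simp add: ennreal_le_iff)
qed

text \<open>For the normal density \<open>q\<close>, \<open>y * q y\<close> equals
  \<open>- s\<^sup>2 * q' y\<close>, so the equation says that \<open>s\<^sup>2 * q * \<psi>\<close>
  has the derivative \<open>(h - stat_mean s h) * q\<close>. Hence \<open>\<psi>\<close> is the
  integral of the latter from minus infinity, divided by \<open>s\<^sup>2 * q\<close>. Centring
  makes that integral vanish at both ends, and the tail estimate turns this decay into a bound for
  \<open>y * \<psi> y\<close>, which in turn bounds the derivative of \<open>\<psi>\<close>.\<close>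

theorem stein_equation:
  assumes s: "0 < s" and cont: "continuous_on UNIV h" and bd: "\<And>y. \<bar>h y\<bar> \<le> B"
  obtains \<psi> L where
    "\<And>y. (\<psi> has_real_derivative (h y - stat_mean s h + y * \<psi> y) / s\<^sup>2) (at y)"
    "\<And>y. \<bar>\<psi> y\<bar> \<le> L" "\<And>y. \<bar>y * \<psi> y\<bar> \<le> L"
proof -
  let ?q = "normal_density 0 s" and ?c = "stat_mean s h"
  have meas[measurable]: "h \<in> borel_measurable borel"
    using cont by (rule borel_measurable_continuous_onI)
  define k where "k y = (h y - ?c) * ?q y" for y
  have c: "\<bar>?c\<bar> \<le> B" by (rule stat_mean_abs_le[OF s meas bd])
  have kbd: "\<bar>k y\<bar> \<le> (2 * B) * ?q y" for y
  proof -
    have "\<bar>h y - ?c\<bar> \<le> 2 * B" using c bd[of y] by linarith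
    then show ?thesis by (simp add: k_def abs_mult mult_right_mono)
  qed
  have kcont: "continuous_on A k" for A
    unfolding k_def
    by (intro continuous_intros continuous_on_normal_density s continuous_on_subset[OF cont]) auto
  have [measurable]: "k \<in> borel_measurable borel"
    by (rule borel_measurable_continuous_onI[OF kcont])
  have kint: "integrable lborel k"
    unfolding k_def
  proof (rule integrable_bounded_normal_density[OF s])
    show "\<bar>h y - ?c\<bar> \<le> 2 * B" for y using c bd[of y] by linarith
  qed simp
  have kset: "set_integrable lborel A k" if "A \<in> sets borel" for A
    using kint that unfolding set_integrable_def by (intro integrable_mult_indicator) auto
  have ktot: "(LBINT y:UNIV. k y) = 0"
    using stat_mean_diff_const[OF s meas bd, of ?c]
    by (simp add: set_lebesgue_integral_def stat_mean_def k_def[abs_def])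
  define N where "N x = (LBINT y:{..x}. k y)" for x
  have N_deriv: "(N has_real_derivative k x) (at x)" for x
  proof -
    \<comment> \<open>Near \<open>x\<close> the improper integral is a constant plus an integral
      over a compact interval, to which the fundamental theorem of calculus applies.\<close>
    have eq: "N u = N (x - 1) + integral {x - 1..u} k" if "u \<in> {x - 1..x + 1}" for u
    proof -
      have "{..u} = {..x - 1} \<union> {x - 1<..u}" using that by auto
      then have "N u = N (x - 1) + (LBINT y:{x - 1<..u}. k y)"
        unfolding N_def by (simp add: set_integral_Un[OF _ kset kset] disjoint_iff)
      also have "(LBINT y:{x - 1<..u}. k y) = (LBINT y:{x - 1..u}. k y)"
      proof -
        have "AE y in lborel. y \<noteq> x - 1" by (rule AE_lborel_singleton)
        then show ?thesis
          unfolding set_lebesgue_integral_def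
          by (intro integral_cong_AE) (auto split: split_indicator)
      qed
      also have "\<dots> = integral {x - 1..u} k"
        by (intro set_borel_integral_eq_integral kset) auto
      finally show ?thesis .
    qed
    have "((\<lambda>u. N (x - 1) + integral {x - 1..u} k) has_real_derivative k x) (at x within {x - 1..x + 1})"
      using DERIV_add[OF DERIV_const integral_has_real_derivative[OF kcont, of x "x - 1" "x + 1"]] by simp
    then have "((\<lambda>u. N (x - 1) + integral {x - 1..u} k) has_real_derivative k x) (at x)"
      using at_within_Icc_at[of "x - 1" x "x + 1"] by simp
    then show ?thesis
    proof (rule has_field_derivative_transform_within_open)
      show "N (x - 1) + integral {x - 1..u} k = N u" if "u \<in> {x - 1<..<x + 1}" for u
        by (rule eq[symmetric]) (use that in auto)
    qed auto
  qed
  \<comment> \<open>For \<open>x > 0\<close> the vanishing total integral turns the lower tail into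
    minus the upper one, where the tail estimate applies. The case \<open>x < 0\<close> is its
    reflection.\<close>
  have N_bound: "\<bar>x\<bar> * \<bar>N x\<bar> \<le> (2 * B) * s\<^sup>2 * ?q x" for x
  proof (cases x "0 :: real" rule: linorder_cases)
    case greater
    have "(LBINT y:UNIV. k y) = N x + (LBINT y:{x<..}. k y)"
    proof -
      have "UNIV = {..x} \<union> {x<..}" by auto
      then show ?thesis
        unfolding N_def
        by (subst set_integral_Un[OF _ kset kset, symmetric]) auto
    qed
    moreover have "(LBINT y:{x<..}. k y) = (LBINT y:{x..}. k y)"
    proof -
      have "AE y in lborel. y \<noteq> x" by (rule AE_lborel_singleton)
      then show ?thesis
        unfolding set_lebesgue_integral_def
        by (intro integral_cong_AE) (auto split: split_indicator)
    qed
    ultimately have "\<bar>N x\<bar> = \<bar>LBINT y:{x..}. k y\<bar>" using ktot by simp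
    then show ?thesis
      using normal_tail_bound[OF s greater kint kbd] greater by simp
  next
    case less
    have "N x = (LBINT y:{- x..}. k (- y))"
    proof -
      have "{y. - y \<in> {..x}} = {- x..}" by auto
      then show ?thesis
        unfolding N_def by (subst set_integral_reflect) simp
    qed
    moreover have "integrable lborel (\<lambda>y. k (- y))"
      using lborel_integrable_real_affine[OF kint, of "-1" 0] by simp
    moreover have "\<bar>k (- y)\<bar> \<le> (2 * B) * ?q y" for y
      using kbd[of "- y"] by (simp add: normal_density_def)
    moreover have "?q (- x) = ?q x" by (simp add: normal_density_def)
    ultimately show ?thesis
      using normal_tail_bound[OF s, of "- x" "\<lambda>y. k (- y)" "2 * B"] less by simp
  qed (use c in simp)
  define \<psi> where "\<psi> y = N y / (s\<^sup>2 * ?q y)" for y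
  have q_pos: "0 < ?q y" for y by (rule normal_density_pos[OF s])
  have deriv: "(\<psi> has_real_derivative (h y - ?c + y * \<psi> y) / s\<^sup>2) (at y)" for y
  proof -
    have "(\<psi> has_real_derivative
        (k y * (s\<^sup>2 * ?q y) - N y * (s\<^sup>2 * (- (y / s\<^sup>2) * ?q y))) / ((s\<^sup>2 * ?q y) * (s\<^sup>2 * ?q y))) (at y)"
      unfolding \<psi>_def[abs_def]
      by (rule derivative_eq_intros N_deriv DERIV_normal_density s refl)+
        (use s q_pos[of y] in \<open>auto\<close>)
    also have "(k y * (s\<^sup>2 * ?q y) - N y * (s\<^sup>2 * (- (y / s\<^sup>2) * ?q y))) / ((s\<^sup>2 * ?q y) * (s\<^sup>2 * ?q y))
        = (h y - ?c + y * \<psi> y) / s\<^sup>2"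
      using s q_pos[of y] by (simp add: k_def \<psi>_def divide_simps) (simp add: algebra_simps power2_eq_square)
    finally show ?thesis .
  qed
  have bound: "\<bar>y * \<psi> y\<bar> \<le> 2 * B" for y
    using N_bound[of y] s q_pos[of y] by (simp add: \<psi>_def abs_mult divide_simps mult_ac)
  \<comment> \<open>The bound on \<open>y * \<psi> y\<close> controls \<open>\<psi>\<close> only
    away from 0; on \<open>{-1..1}\<close> compactness takes over.\<close>
  have "continuous_on {-1..1} \<psi>"
    by (rule DERIV_imp_continuous_on[OF deriv])
  then have "bounded (\<psi> ` {-1..1})"
    by (intro compact_imp_bounded compact_continuous_image) auto
  then obtain L where L: "\<forall>y\<in>{-1..1}. \<bar>\<psi> y\<bar> \<le> L"
    by (auto simp: bounded_iff)
  show thesis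
  proof
    show "(\<psi> has_real_derivative (h y - ?c + y * \<psi> y) / s\<^sup>2) (at y)" for y by (rule deriv)
    show "\<bar>y * \<psi> y\<bar> \<le> max L (2 * B)" for y using bound[of y] by simp
    show "\<bar>\<psi> y\<bar> \<le> max L (2 * B)" for y
    proof (cases "y \<in> {-1..1}")
      case False
      then have "1 * \<bar>\<psi> y\<bar> \<le> \<bar>y\<bar> * \<bar>\<psi> y\<bar>" by (intro mult_right_mono) auto
      then show ?thesis using bound[of y] by (simp add: abs_mult)
    qed (use L in force)
  qed
qed

section \<open>The Ito isometry\<close>

lemma integrable_mult_of_squares:
  fixes X Y :: "'a \<Rightarrow> real"
  assumes [measurable]: "X \<in> borel_measurable M" "Y \<in> borel_measurable M"
    and "integrable M (\<lambda>\<omega>. (X \<omega>)\<^sup>2)" "integrable M (\<lambda>\<omega>. (Y \<omega>)\<^sup>2)"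
  shows "integrable M (\<lambda>\<omega>. X \<omega> * Y \<omega>)"
proof (rule Bochner_Integration.integrable_bound)
  show "integrable M (\<lambda>\<omega>. (X \<omega>)\<^sup>2 + (Y \<omega>)\<^sup>2)" using assms by simp
  have "\<bar>x * y\<bar> \<le> x\<^sup>2 + y\<^sup>2" for x y :: real
  proof -
    have "2 * (\<bar>x\<bar> * \<bar>y\<bar>) \<le> x\<^sup>2 + y\<^sup>2" using sum_squares_bound[of "\<bar>x\<bar>" "\<bar>y\<bar>"] by simp
    moreover have "0 \<le> \<bar>x\<bar> * \<bar>y\<bar>" by simp
    ultimately show ?thesis unfolding abs_mult by linarith
  qed
  then show "AE \<omega> in M. norm (X \<omega> * Y \<omega>) \<le> norm ((X \<omega>)\<^sup>2 + (Y \<omega>)\<^sup>2)" by simp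
qed simp

lemma elementary_times:
  assumes "elementary_data M F T N \<tau> \<xi>" "i < N"
  shows "0 \<le> \<tau> i" "\<tau> i \<le> \<tau> (Suc i)" "\<tau> (Suc i) \<le> T"
proof -
  have step: "\<And>i. i < N \<Longrightarrow> \<tau> i \<le> \<tau> (Suc i)" and ends: "\<tau> 0 = 0" "\<tau> N = T"
    using assms(1) by (auto simp: elementary_data_def)
  have "j \<le> N \<longrightarrow> 0 \<le> \<tau> j" for j
  proof (induction j)
    case (Suc j)
    then show ?case using step[of j] by auto
  qed (simp add: ends)
  then show "0 \<le> \<tau> i" using assms(2) by simp
  have "\<tau> j \<le> T" if "j \<le> N" for j
    using that
  proof (induction j rule: inc_induct)
    case (step j)
    then show ?case using assms(1) by (force simp: elementary_data_def)
  qed (simp add: ends)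
  then show "\<tau> (Suc i) \<le> T" using assms(2) by simp
  show "\<tau> i \<le> \<tau> (Suc i)" using step assms(2) by simp
qed

section \<open>Increments of the Wiener process\<close>

locale wiener =
  fixes M :: "'a measure" and F :: "real \<Rightarrow> 'a measure" and z :: "real \<Rightarrow> 'a \<Rightarrow> real"
  assumes filtered: "filtered_prob_space M F" and wiener: "wiener_process M F z"
begin

sublocale prob_space M
  using filtered by (simp add: filtered_prob_space_def)

lemma subalgebra_F: "subalgebra M (F t)"
  using filtered by (simp add: filtered_prob_space_def)

lemma space_F [simp]: "space (F t) = space M"
  using subalgebra_F by (simp add: subalgebra_def)

lemma F_measurable: "X \<in> measurable (F t) N \<Longrightarrow> X \<in> measurable M N"
  using measurable_from_subalg[OF subalgebra_F] by blast

lemma F_measurable_mono: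
  assumes "s \<le> t" "X \<in> measurable (F s) N"
  shows "X \<in> measurable (F t) N"
proof -
  have "sets (F s) \<subseteq> sets (F t)"
    using filtered assms(1) by (auto simp: filtered_prob_space_def filtration_def)
  then show ?thesis
    using assms(2) by (intro measurable_from_subalg[of "F t" "F s"]) (auto simp: subalgebra_def)
qed

lemma z_F: "0 \<le> t \<Longrightarrow> z t \<in> borel_measurable (F t)"
  using wiener by (simp add: wiener_process_def)

lemma z_measurable [measurable]: "0 \<le> t \<Longrightarrow> z t \<in> borel_measurable M"
  by (rule F_measurable[OF z_F])

lemma z_0: "\<omega> \<in> space M \<Longrightarrow> z 0 \<omega> = 0"
  using wiener by (simp add: wiener_process_def)

lemma z_continuous: "\<omega> \<in> space M \<Longrightarrow> continuous_on {0..} (\<lambda>t. z t \<omega>)"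
  using wiener by (simp add: wiener_process_def)

lemma increment_F:
  assumes "0 \<le> s" "s \<le> t"
  shows "(\<lambda>\<omega>. z t \<omega> - z s \<omega>) \<in> borel_measurable (F t)"
  using assms F_measurable_mono[OF assms(2) z_F[OF assms(1)]] z_F[of t]
  by (intro borel_measurable_diff) auto

text \<open>\<open>g\<close> is general so as to cover the increment, its square, and the
  compensated square together with the square of the latter.\<close>

lemma increment_indep:
  assumes "0 \<le> s" "s < t" and X: "X \<in> borel_measurable (F s)" and g: "g \<in> borel_measurable borel"
  shows "indep_var borel X borel (\<lambda>\<omega>. g (z t \<omega> - z s \<omega>) :: real)"
proof -
  let ?V = "vimage_algebra (space M) (\<lambda>\<omega>. z t \<omega> - z s \<omega>) (borel :: real measure)"
  have ind: "indep_set (sets (F s)) (sets ?V)"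
    using wiener assms(1,2) by (simp add: wiener_process_def)
  have [measurable]: "z s \<in> borel_measurable M" "z t \<in> borel_measurable M" "X \<in> borel_measurable M"
    using assms by (auto intro: F_measurable)
  note [measurable] = g
  have V: "(\<lambda>\<omega>. z t \<omega> - z s \<omega>) \<in> borel_measurable ?V"
    by (rule measurable_vimage_algebra1) auto
  have gV: "(\<lambda>\<omega>. g (z t \<omega> - z s \<omega>)) \<in> borel_measurable ?V"
    by (rule measurable_compose[OF V g])
  have 1: "sigma_sets (space M) {X -` A \<inter> space M | A. A \<in> sets borel} \<subseteq> sets (F s)"
    using sets.sigma_sets_subset[of "{X -` A \<inter> space M | A. A \<in> sets borel}" "F s"] measurable_sets[OF X]
    by auto
  have 2: "sigma_sets (space M) {(\<lambda>\<omega>. g (z t \<omega> - z s \<omega>)) -` A \<inter> space M | A. A \<in> sets borel} \<subseteq> sets ?V"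
    using sets.sigma_sets_subset[of "{(\<lambda>\<omega>. g (z t \<omega> - z s \<omega>)) -` A \<inter> space M | A. A \<in> sets borel}" ?V]
      measurable_sets[OF gV] by (auto simp: space_vimage_algebra)
  show ?thesis
    unfolding indep_var_eq
  proof (intro conjI)
    show "indep_set (sigma_sets (space M) {X -` A \<inter> space M | A. A \<in> sets borel})
      (sigma_sets (space M) {(\<lambda>\<omega>. g (z t \<omega> - z s \<omega>)) -` A \<inter> space M | A. A \<in> sets borel})"
      using ind unfolding indep_set_def
      by (rule indep_sets_mono_sets) (use 1 2 in \<open>auto split: bool.split\<close>)
  qed measurable
qed

text \<open>The law of an increment is prescribed only for \<open>s < t\<close>. The degenerate case
  is included because an elementary partition may repeat a time.\<close>

lemma increment_moments:
  assumes "0 \<le> s" "s \<le> t"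
  shows "integrable M (\<lambda>\<omega>. (z t \<omega> - z s \<omega>) ^ k)"
    and "(\<integral>\<omega>. (z t \<omega> - z s \<omega>) \<partial>M) = 0"
    and "(\<integral>\<omega>. (z t \<omega> - z s \<omega>)\<^sup>2 \<partial>M) = t - s"
    and "(\<integral>\<omega>. (z t \<omega> - z s \<omega>) ^ 4 \<partial>M) = 3 * (t - s)\<^sup>2"
proof -
  have "integrable M (\<lambda>\<omega>. (z t \<omega> - z s \<omega>) ^ k) \<and>
    (\<integral>\<omega>. (z t \<omega> - z s \<omega>) \<partial>M) = 0 \<and> (\<integral>\<omega>. (z t \<omega> - z s \<omega>)\<^sup>2 \<partial>M) = t - s \<and>
    (\<integral>\<omega>. (z t \<omega> - z s \<omega>) ^ 4 \<partial>M) = 3 * (t - s)\<^sup>2"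
  proof (cases "s < t")
    case True
    let ?q = "normal_density 0 (sqrt (t - s))"
    have D: "distributed M lborel (\<lambda>\<omega>. z t \<omega> - z s \<omega>) ?q"
      using wiener assms(1) True by (simp add: wiener_process_def)
    have pos: "0 < sqrt (t - s)" using True by simp
    have int: "integrable M (\<lambda>\<omega>. (z t \<omega> - z s \<omega>) ^ k)" for k
      using distributed_integrable[OF D, of "\<lambda>y. y ^ k"] integrable_normal_moment[OF pos, of 0 k]
      by simp
    have eq: "(\<integral>\<omega>. (z t \<omega> - z s \<omega>) ^ k \<partial>M) = (\<integral>y. ?q y * y ^ k \<partial>lborel)" for k
      using distributed_integral[OF D, of "\<lambda>y. y ^ k"] by simp
    have "(\<integral>\<omega>. (z t \<omega> - z s \<omega>) ^ 1 \<partial>M) = 0"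
      unfolding eq using integral_normal_moment_odd[OF pos, of 0 0] by simp
    moreover have "(\<integral>\<omega>. (z t \<omega> - z s \<omega>) ^ 2 \<partial>M) = t - s"
      unfolding eq using integral_normal_moment_even[OF pos, of 0 1] pos by simp
    moreover have "(\<integral>\<omega>. (z t \<omega> - z s \<omega>) ^ 4 \<partial>M) = 3 * (t - s)\<^sup>2"
    proof -
      have "sqrt (t - s) ^ 4 = (t - s)\<^sup>2"
        using power_mult[of "sqrt (t - s)" 2 2] True by simp
      then show ?thesis
        unfolding eq using integral_normal_moment_even[OF pos, of 0 2] pos
        by (simp add: fact_numeral power_divide)
    qed
    ultimately show ?thesis using int by simp
  next
    case False
    then have "t = s" using assms by simp
    then show ?thesis by (cases k) auto
  qed
  then show "integrable M (\<lambda>\<omega>. (z t \<omega> - z s \<omega>) ^ k)" "(\<integral>\<omega>. (z t \<omega> - z s \<omega>) \<partial>M) = 0"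
    "(\<integral>\<omega>. (z t \<omega> - z s \<omega>)\<^sup>2 \<partial>M) = t - s" "(\<integral>\<omega>. (z t \<omega> - z s \<omega>) ^ 4 \<partial>M) = 3 * (t - s)\<^sup>2"
    by auto
qed

lemma integral_mult_increment:
  assumes "0 \<le> s" "s \<le> t" and X: "X \<in> borel_measurable (F s)" "integrable M X"
    and g: "g \<in> borel_measurable borel" "integrable M (\<lambda>\<omega>. g (z t \<omega> - z s \<omega>))"
  shows "integrable M (\<lambda>\<omega>. X \<omega> * g (z t \<omega> - z s \<omega>) :: real)"
    and "(\<integral>\<omega>. X \<omega> * g (z t \<omega> - z s \<omega>) \<partial>M) = (\<integral>\<omega>. X \<omega> \<partial>M) * (\<integral>\<omega>. g (z t \<omega> - z s \<omega>) \<partial>M)"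
proof -
  have "integrable M (\<lambda>\<omega>. X \<omega> * g (z t \<omega> - z s \<omega>)) \<and>
    (\<integral>\<omega>. X \<omega> * g (z t \<omega> - z s \<omega>) \<partial>M) = (\<integral>\<omega>. X \<omega> \<partial>M) * (\<integral>\<omega>. g (z t \<omega> - z s \<omega>) \<partial>M)"
  proof (cases "s < t")
    case True
    have "indep_var borel X borel (\<lambda>\<omega>. g (z t \<omega> - z s \<omega>))"
      by (rule increment_indep[OF assms(1) True X(1) g(1)])
    then show ?thesis
      using X(2) g(2) by (auto intro: indep_var_integrable indep_var_lebesgue_integral)
  next
    \<comment> \<open>Now \<open>t = s\<close>, so \<open>g\<close> is evaluated at the constant 0
      and the claim reduces to total mass 1.\<close>
    case False
    then show ?thesis using assms by (simp add: prob_space)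
  qed
  then show "integrable M (\<lambda>\<omega>. X \<omega> * g (z t \<omega> - z s \<omega>) :: real)"
    "(\<integral>\<omega>. X \<omega> * g (z t \<omega> - z s \<omega>) \<partial>M) = (\<integral>\<omega>. X \<omega> \<partial>M) * (\<integral>\<omega>. g (z t \<omega> - z s \<omega>) \<partial>M)"
    by auto
qed

lemma mult_increment:
  assumes "0 \<le> s" "s \<le> t" "X \<in> borel_measurable (F s)" "integrable M X"
  shows "integrable M (\<lambda>\<omega>. X \<omega> * (z t \<omega> - z s \<omega>))" "(\<integral>\<omega>. X \<omega> * (z t \<omega> - z s \<omega>) \<partial>M) = 0"
    and "integrable M (\<lambda>\<omega>. X \<omega> * (z t \<omega> - z s \<omega>)\<^sup>2)"
    "(\<integral>\<omega>. X \<omega> * (z t \<omega> - z s \<omega>)\<^sup>2 \<partial>M) = (\<integral>\<omega>. X \<omega> \<partial>M) * (t - s)"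
  using integral_mult_increment[OF assms, of "\<lambda>y. y"] integral_mult_increment[OF assms, of "\<lambda>y. y\<^sup>2"]
    increment_moments(2,3)[OF assms(1,2)]
    increment_moments(1)[OF assms(1,2), of 1] increment_moments(1)[OF assms(1,2), of 2]
  by auto

lemma integrable_mult_increment_square:
  assumes "0 \<le> s" "s \<le> t" "X \<in> borel_measurable (F s)" "integrable M (\<lambda>\<omega>. (X \<omega>)\<^sup>2)"
  shows "integrable M (\<lambda>\<omega>. (X \<omega> * (z t \<omega> - z s \<omega>))\<^sup>2)"
  using mult_increment(3)[OF assms(1,2) borel_measurable_power[OF assms(3)] assms(4)]
  by (simp add: power_mult_distrib)

text \<open>Ito's isometry for a pair of cells: the last factor is the length of the overlap, that
  is, the time integral of the product of the two indicators. The cells may lie in any position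
  because they will come from unrelated partitions.\<close>

lemma increment_product:
  assumes ab: "0 \<le> a" "a \<le> b" and cd: "0 \<le> c" "c \<le> d"
    and \<xi>: "\<xi> \<in> borel_measurable (F a)" "integrable M (\<lambda>\<omega>. (\<xi> \<omega>)\<^sup>2)"
    and \<eta>: "\<eta> \<in> borel_measurable (F c)" "integrable M (\<lambda>\<omega>. (\<eta> \<omega>)\<^sup>2)"
  shows "integrable M (\<lambda>\<omega>. (\<xi> \<omega> * (z b \<omega> - z a \<omega>)) * (\<eta> \<omega> * (z d \<omega> - z c \<omega>)))" (is "integrable M ?f")
    and "(\<integral>\<omega>. (\<xi> \<omega> * (z b \<omega> - z a \<omega>)) * (\<eta> \<omega> * (z d \<omega> - z c \<omega>)) \<partial>M)
      = (\<integral>\<omega>. \<xi> \<omega> * \<eta> \<omega> \<partial>M) * max 0 (min b d - max a c)"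
proof -
  \<comment> \<open>By symmetry the first interval may be taken to start first.\<close>
  have 0: "integrable M (\<lambda>\<omega>. (\<xi> \<omega> * (z b \<omega> - z a \<omega>)) * (\<eta> \<omega> * (z d \<omega> - z c \<omega>))) \<and>
      (\<integral>\<omega>. (\<xi> \<omega> * (z b \<omega> - z a \<omega>)) * (\<eta> \<omega> * (z d \<omega> - z c \<omega>)) \<partial>M)
      = (\<integral>\<omega>. \<xi> \<omega> * \<eta> \<omega> \<partial>M) * max 0 (min b d - max a c)"
    if ac: "a \<le> c" and ab: "0 \<le> a" "a \<le> b" and cd: "0 \<le> c" "c \<le> d"
      and \<xi>: "\<xi> \<in> borel_measurable (F a)" "integrable M (\<lambda>\<omega>. (\<xi> \<omega>)\<^sup>2)"
      and \<eta>: "\<eta> \<in> borel_measurable (F c)" "integrable M (\<lambda>\<omega>. (\<eta> \<omega>)\<^sup>2)"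
    for a b c d :: real and \<xi> \<eta>
  proof -
    have \<xi>c: "\<xi> \<in> borel_measurable (F c)" by (rule F_measurable_mono[OF ac \<xi>(1)])
    \<comment> \<open>This product is known at time \<open>c\<close>, so its product with the
      increment over \<open>{c..d}\<close> has mean 0.\<close>
    have past: "integrable M (\<lambda>\<omega>. (\<xi> \<omega> * (z e \<omega> - z a \<omega>)) * \<eta> \<omega>)
        \<and> (\<lambda>\<omega>. (\<xi> \<omega> * (z e \<omega> - z a \<omega>)) * \<eta> \<omega>) \<in> borel_measurable (F c)"
      if "a \<le> e" "e \<le> c" for e
    proof -
      have m: "(\<lambda>\<omega>. \<xi> \<omega> * (z e \<omega> - z a \<omega>)) \<in> borel_measurable (F c)"
        using F_measurable_mono[OF that(2) increment_F[OF ab(1) that(1)]] \<xi>c by simp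
      then show ?thesis
        using \<eta> integrable_mult_increment_square[OF ab(1) that(1) \<xi>]
        by (intro conjI integrable_mult_of_squares F_measurable[OF m] F_measurable[OF \<eta>(1)]) auto
    qed
    show ?thesis
    proof (cases "b \<le> c")
      case True
      have "max 0 (min b d - max a c) = 0" using True ac by auto
      moreover note mult_increment(1,2)[OF cd past[OF ab(2) True, THEN conjunct2] past[OF ab(2) True, THEN conjunct1]]
      ultimately show ?thesis by (simp add: mult.assoc)
    next
      case False
      define m where "m = min b d"
      define m' where "m' = max b d"
      have m: "c \<le> m" "m \<le> m'" "0 \<le> m" using False cd by (auto simp: m_def m'_def)
      have X: "(\<lambda>\<omega>. \<xi> \<omega> * \<eta> \<omega>) \<in> borel_measurable (F c)" "integrable M (\<lambda>\<omega>. \<xi> \<omega> * \<eta> \<omega>)"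
        using \<xi>c \<eta> \<xi> by (auto intro!: integrable_mult_of_squares F_measurable[OF \<xi>(1)] F_measurable[OF \<eta>(1)])
      have Y: "(\<lambda>\<omega>. (\<xi> \<omega> * \<eta> \<omega>) * (z m \<omega> - z c \<omega>)) \<in> borel_measurable (F m)"
        using increment_F[OF cd(1) m(1)] F_measurable_mono[OF m(1) X(1)] by simp
      note I1 = mult_increment(1,2)[OF cd past[OF ac order_refl, THEN conjunct2] past[OF ac order_refl, THEN conjunct1]]
      note I2 = mult_increment(3,4)[OF cd(1) m(1) X]
      note I3 = mult_increment(1,2)[OF m(3,2) Y mult_increment(1)[OF cd(1) m(1) X]]
      \<comment> \<open>The increments are cut at \<open>c\<close> and at the earlier of the two
        right ends. Only the middle term, the square over the overlap, has a nonzero mean. Which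
        interval ends first is immaterial, since \<open>m'\<close> is simply the later end.\<close>
      have split: "(\<xi> \<omega> * (z b \<omega> - z a \<omega>)) * (\<eta> \<omega> * (z d \<omega> - z c \<omega>))
        = (\<xi> \<omega> * (z c \<omega> - z a \<omega>)) * \<eta> \<omega> * (z d \<omega> - z c \<omega>)
          + ((\<xi> \<omega> * \<eta> \<omega>) * (z m \<omega> - z c \<omega>)\<^sup>2
          + (\<xi> \<omega> * \<eta> \<omega>) * (z m \<omega> - z c \<omega>) * (z m' \<omega> - z m \<omega>))" for \<omega>
      proof (cases "b \<le> d")
        case True
        then have "m = b" "m' = d" by (auto simp: m_def m'_def)
        then show ?thesis by (simp add: algebra_simps power2_eq_square)
      next
        case False
        then have "m = d" "m' = b" by (auto simp: m_def m'_def)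
        then show ?thesis by (simp add: algebra_simps power2_eq_square)
      qed
      have "max 0 (min b d - max a c) = m - c" using m ac by (auto simp: m_def max_def)
      then show ?thesis
        unfolding split using I1 I2 I3 by simp
    qed
  qed
  have "integrable M ?f \<and> (\<integral>\<omega>. ?f \<omega> \<partial>M) = (\<integral>\<omega>. \<xi> \<omega> * \<eta> \<omega> \<partial>M) * max 0 (min b d - max a c)"
  proof (cases "a \<le> c")
    case False
    then show ?thesis
      using 0[OF _ cd ab \<eta> \<xi>] by (simp add: mult.commute min.commute max.commute)
  qed (use 0 ab cd \<xi> \<eta> in simp)
  then show "integrable M ?f" "(\<integral>\<omega>. ?f \<omega> \<partial>M) = (\<integral>\<omega>. \<xi> \<omega> * \<eta> \<omega> \<partial>M) * max 0 (min b d - max a c)"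
    by auto
qed

section \<open>Isometry for elementary processes on the product with time\<close>

abbreviation path_space :: "real \<Rightarrow> (real \<times> 'a) measure" where
  "path_space T \<equiv> restrict_space lborel {0..T} \<Otimes>\<^sub>M M"

text \<open>\<open>ito_integrand\<close> speaks about Borel sets of times, while mean squares need
  Lebesgue measure there; the two product sigma-algebras coincide.\<close>

lemma sets_path_space: "sets (path_space T) = sets (restrict_space borel {0..T} \<Otimes>\<^sub>M M)"
  by (intro sets_pair_measure_cong sets_restrict_space_cong) auto

text \<open>Tonelli: the definition of the Ito integral integrates over time first, which is the
  second of the two iterated integrals.\<close>

lemma msq_path_space:
  assumes "(\<lambda>(s, \<omega>). H s \<omega>) \<in> borel_measurable (path_space T)"
  shows "msq (path_space T) (\<lambda>(s, \<omega>). H s \<omega>)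
    = (\<integral>\<^sup>+\<omega>. (\<integral>\<^sup>+s\<in>{0..T}. ennreal ((H s \<omega>)\<^sup>2) \<partial>lborel) \<partial>M)"
proof -
  interpret R: sigma_finite_measure "restrict_space lborel {0..T}"
    by (rule sigma_finite_measure_restrict_space) (auto intro: sigma_finite_lborel)
  interpret P: pair_sigma_finite "restrict_space lborel {0..T}" M ..
  have "(\<lambda>p. ennreal (((\<lambda>(s, \<omega>). H s \<omega>) p)\<^sup>2)) \<in> borel_measurable (path_space T)"
    using assms by simp
  from P.nn_integral_snd[OF this] show ?thesis
    by (simp add: msq_def nn_integral_restrict_space)
qed

text \<open>The intervals may overlap.  Hence the isometry applies to the difference of two elementary
  processes with different partitions, without a common refinement.\<close>

lemma isometry_family:
  assumes S: "finite S" and ab: "\<And>k. k \<in> S \<Longrightarrow> 0 \<le> a k \<and> a k \<le> b k \<and> b k \<le> T"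
    and \<xi>: "\<And>k. k \<in> S \<Longrightarrow> \<xi> k \<in> borel_measurable (F (a k))"
    and \<xi>2: "\<And>k. k \<in> S \<Longrightarrow> integrable M (\<lambda>\<omega>. (\<xi> k \<omega>)\<^sup>2)"
  shows "(\<lambda>(s, \<omega>). \<Sum>k\<in>S. \<xi> k \<omega> * indicator {a k..<b k} s) \<in> borel_measurable (path_space T)"
    and "msq M (\<lambda>\<omega>. \<Sum>k\<in>S. \<xi> k \<omega> * (z (b k) \<omega> - z (a k) \<omega>))
      = msq (path_space T) (\<lambda>(s, \<omega>). \<Sum>k\<in>S. \<xi> k \<omega> * indicator {a k..<b k} s)"
proof -
  have \<xi>M[measurable]: "\<xi> k \<in> borel_measurable M" if "k \<in> S" for k
    by (rule F_measurable[OF \<xi>[OF that]])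
  show meas: "(\<lambda>(s, \<omega>). \<Sum>k\<in>S. \<xi> k \<omega> * indicator {a k..<b k} s) \<in> borel_measurable (path_space T)"
    unfolding split_beta'
  proof (rule borel_measurable_sum)
    fix k assume [measurable]: "k \<in> S"
    have [measurable]: "fst \<in> borel_measurable (path_space T)"
      by (rule measurable_compose[OF measurable_fst]) (simp add: measurable_restrict_space1)
    have [measurable]: "(\<lambda>p. indicator {a k..<b k} (fst p) :: real) \<in> borel_measurable (path_space T)"
      by (rule measurable_compose[of fst _ borel]) auto
    show "(\<lambda>p. \<xi> k (snd p) * indicator {a k..<b k} (fst p)) \<in> borel_measurable (path_space T)"
      by measurable
  qed
  let ?f = "\<lambda>k \<omega>. \<xi> k \<omega> * (z (b k) \<omega> - z (a k) \<omega>)"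
  let ?m = "\<lambda>k l. max 0 (min (b k) (b l) - max (a k) (a l))"
  have prod: "integrable M (\<lambda>\<omega>. ?f k \<omega> * ?f l \<omega>)"
    "(\<integral>\<omega>. ?f k \<omega> * ?f l \<omega> \<partial>M) = (\<integral>\<omega>. \<xi> k \<omega> * \<xi> l \<omega> \<partial>M) * ?m k l"
    if "k \<in> S" "l \<in> S" for k l
    using increment_product[of "a k" "b k" "a l" "b l" "\<xi> k" "\<xi> l"] ab \<xi> \<xi>2 that by auto
  have \<xi>\<xi>: "integrable M (\<lambda>\<omega>. \<xi> k \<omega> * \<xi> l \<omega>)" if "k \<in> S" "l \<in> S" for k l
    using that by (intro integrable_mult_of_squares \<xi>M \<xi>2)
  have sq: "(\<lambda>\<omega>. (\<Sum>k\<in>S. ?f k \<omega>)\<^sup>2) = (\<lambda>\<omega>. \<Sum>k\<in>S. \<Sum>l\<in>S. ?f k \<omega> * ?f l \<omega>)"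
    by (simp add: power2_eq_square sum_product)
  \<comment> \<open>For a fixed outcome the time integral is a quadratic form in the values
    \<open>\<xi> k\<close> whose coefficients are the overlaps \<open>?m k l\<close>, the same
    coefficients as in \<open>prod\<close>.\<close>
  have path: "has_bochner_integral lborel (\<lambda>s. (\<Sum>k\<in>S. \<xi> k \<omega> * indicator {a k..<b k} s)\<^sup>2)
      (\<Sum>k\<in>S. \<Sum>l\<in>S. \<xi> k \<omega> * \<xi> l \<omega> * ?m k l)" for \<omega>
  proof -
    have "has_bochner_integral lborel
        (\<lambda>s. \<Sum>k\<in>S. \<Sum>l\<in>S. (\<xi> k \<omega> * \<xi> l \<omega>) * indicator ({a k..<b k} \<inter> {a l..<b l}) s)
        (\<Sum>k\<in>S. \<Sum>l\<in>S. (\<xi> k \<omega> * \<xi> l \<omega>) * measure lborel ({a k..<b k} \<inter> {a l..<b l}))"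
    proof (intro has_bochner_integral_sum has_bochner_integral_mult_right has_bochner_integral_real_indicator)
      fix k l
      show "emeasure lborel ({a k..<b k} \<inter> {a l..<b l}) < \<infinity>"
        by (rule le_less_trans[OF emeasure_mono[of _ "{a k..b k}"]]) (auto simp: emeasure_lborel_Icc_eq)
    qed auto
    moreover have "measure lborel ({a k..<b k} \<inter> {a l..<b l}) = ?m k l" for k l
    proof -
      have "{a k..<b k} \<inter> {a l..<b l} = {max (a k) (a l)..<min (b k) (b l)}" by auto
      then show ?thesis
        by (cases "max (a k) (a l) \<le> min (b k) (b l)")
          (auto simp: measure_lborel_Ico max_def[of 0])
    qed
    moreover have "(\<Sum>k\<in>S. \<xi> k \<omega> * indicator {a k..<b k} s)\<^sup>2
      = (\<Sum>k\<in>S. \<Sum>l\<in>S. (\<xi> k \<omega> * \<xi> l \<omega>) * indicator ({a k..<b k} \<inter> {a l..<b l}) s)" for s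
      by (simp only: power2_eq_square sum_product indicator_inter_arith mult_ac)
    ultimately show ?thesis by simp
  qed
  have nonneg: "0 \<le> (\<Sum>k\<in>S. \<Sum>l\<in>S. \<xi> k \<omega> * \<xi> l \<omega> * ?m k l)" for \<omega>
    using has_bochner_integral_integral_eq[OF path[of \<omega>], symmetric] by simp
  have "msq M (\<lambda>\<omega>. \<Sum>k\<in>S. ?f k \<omega>) = ennreal (\<integral>\<omega>. (\<Sum>k\<in>S. \<Sum>l\<in>S. ?f k \<omega> * ?f l \<omega>) \<partial>M)"
    by (subst msq_eq_integral) (auto simp only: sq intro!: Bochner_Integration.integrable_sum prod)
  also have "(\<integral>\<omega>. (\<Sum>k\<in>S. \<Sum>l\<in>S. ?f k \<omega> * ?f l \<omega>) \<partial>M)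
      = (\<integral>\<omega>. (\<Sum>k\<in>S. \<Sum>l\<in>S. \<xi> k \<omega> * \<xi> l \<omega> * ?m k l) \<partial>M)"
    by (simp add: Bochner_Integration.integral_sum prod \<xi>\<xi>)
  also have "ennreal \<dots> = (\<integral>\<^sup>+\<omega>. ennreal (\<Sum>k\<in>S. \<Sum>l\<in>S. \<xi> k \<omega> * \<xi> l \<omega> * ?m k l) \<partial>M)"
  proof -
    show ?thesis
      using nonneg \<xi>\<xi> by (intro nn_integral_eq_integral[symmetric] AE_I2) auto
  qed
  also have "\<dots> = (\<integral>\<^sup>+\<omega>. (\<integral>\<^sup>+s\<in>{0..T}. ennreal ((\<Sum>k\<in>S. \<xi> k \<omega> * indicator {a k..<b k} s)\<^sup>2) \<partial>lborel) \<partial>M)"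
  proof (rule nn_integral_cong)
    fix \<omega>
    have "(\<integral>\<^sup>+s\<in>{0..T}. ennreal ((\<Sum>k\<in>S. \<xi> k \<omega> * indicator {a k..<b k} s)\<^sup>2) \<partial>lborel)
      = (\<integral>\<^sup>+s. ennreal ((\<Sum>k\<in>S. \<xi> k \<omega> * indicator {a k..<b k} s)\<^sup>2) \<partial>lborel)"
    proof (rule nn_integral_cong)
      fix s
      have "(\<Sum>k\<in>S. \<xi> k \<omega> * indicator {a k..<b k} s) = 0" if "s \<notin> {0..T}"
        using that ab by (intro sum.neutral ballI) (fastforce split: split_indicator)
      then show "ennreal ((\<Sum>k\<in>S. \<xi> k \<omega> * indicator {a k..<b k} s)\<^sup>2) * indicator {0..T} s
        = ennreal ((\<Sum>k\<in>S. \<xi> k \<omega> * indicator {a k..<b k} s)\<^sup>2)"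
        by (auto split: split_indicator)
    qed
    also have "\<dots> = ennreal (\<Sum>k\<in>S. \<Sum>l\<in>S. \<xi> k \<omega> * \<xi> l \<omega> * ?m k l)"
      using path[of \<omega>] by (subst nn_integral_eq_integral) (auto simp: has_bochner_integral_iff)
    finally show "ennreal (\<Sum>k\<in>S. \<Sum>l\<in>S. \<xi> k \<omega> * \<xi> l \<omega> * ?m k l)
      = (\<integral>\<^sup>+s\<in>{0..T}. ennreal ((\<Sum>k\<in>S. \<xi> k \<omega> * indicator {a k..<b k} s)\<^sup>2) \<partial>lborel)" ..
  qed
  also have "\<dots> = msq (path_space T) (\<lambda>(s, \<omega>). \<Sum>k\<in>S. \<xi> k \<omega> * indicator {a k..<b k} s)"
    by (rule msq_path_space[OF meas, symmetric])
  finally show "msq M (\<lambda>\<omega>. \<Sum>k\<in>S. ?f k \<omega>)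
    = msq (path_space T) (\<lambda>(s, \<omega>). \<Sum>k\<in>S. \<xi> k \<omega> * indicator {a k..<b k} s)" .
qed

text \<open>Both partitions are put side by side as one family, indexed by a disjoint sum, in which
  the second has the opposite sign.\<close>

lemma elementary_isometry:
  assumes "elementary_data M F T N \<tau> \<xi>" "elementary_data M F T N' \<tau>' \<xi>'"
  shows "msq M (\<lambda>\<omega>. elementary_integral z N \<tau> \<xi> \<omega> - elementary_integral z N' \<tau>' \<xi>' \<omega>)
    = msq (path_space T) (\<lambda>(s, \<omega>). elementary_process N \<tau> \<xi> s \<omega> - elementary_process N' \<tau>' \<xi>' s \<omega>)"
proof -
  let ?S = "{..<N} <+> {..<N'}"
  let ?a = "case_sum \<tau> \<tau>'" and ?b = "case_sum (\<lambda>i. \<tau> (Suc i)) (\<lambda>i. \<tau>' (Suc i))"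
  let ?\<xi> = "case_sum \<xi> (\<lambda>i \<omega>. - \<xi>' i \<omega>)"
  have "msq M (\<lambda>\<omega>. \<Sum>k\<in>?S. ?\<xi> k \<omega> * (z (?b k) \<omega> - z (?a k) \<omega>))
      = msq (path_space T) (\<lambda>(s, \<omega>). \<Sum>k\<in>?S. ?\<xi> k \<omega> * indicator {?a k..<?b k} s)"
  proof (rule isometry_family)
    fix k assume k: "k \<in> ?S"
    show "0 \<le> ?a k \<and> ?a k \<le> ?b k \<and> ?b k \<le> T"
      using k elementary_times[OF assms(1)] elementary_times[OF assms(2)] by auto
    show "?\<xi> k \<in> borel_measurable (F (?a k))" "integrable M (\<lambda>\<omega>. (?\<xi> k \<omega>)\<^sup>2)"
      using k assms by (auto simp: elementary_data_def)
  qed simp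
  then show ?thesis
    unfolding elementary_integral_def elementary_process_def
    by (simp only: sum.Plus[OF finite_lessThan finite_lessThan] comp_def sum.case mult_minus_left sum_negf
        add_uminus_conv_diff)
qed

lemma elementary_process_measurable:
  assumes "elementary_data M F T N \<tau> \<xi>"
  shows "(\<lambda>(s, \<omega>). elementary_process N \<tau> \<xi> s \<omega>) \<in> borel_measurable (path_space T)"
  unfolding elementary_process_def
  using elementary_times[OF assms] assms
  by (intro isometry_family) (auto simp: elementary_data_def)

lemma elementary_integral_measurable:
  assumes "elementary_data M F T N \<tau> \<xi>"
  shows "elementary_integral z N \<tau> \<xi> \<in> borel_measurable M"
  unfolding elementary_integral_def[abs_def]
proof (intro borel_measurable_sum borel_measurable_times borel_measurable_diff)
  fix i assume "i \<in> {..<N}"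
  then have i: "i < N" by simp
  show "\<xi> i \<in> borel_measurable M"
    using assms i by (auto simp: elementary_data_def intro: F_measurable)
  show "z (\<tau> (Suc i)) \<in> borel_measurable M" "z (\<tau> i) \<in> borel_measurable M"
    using elementary_times[OF assms i] by auto
qed

lemma expectation_elementary_integral:
  assumes "elementary_data M F T N \<tau> \<xi>"
  shows "(\<integral>\<omega>. elementary_integral z N \<tau> \<xi> \<omega> \<partial>M) = 0"
    and "integrable M (\<lambda>\<omega>. (elementary_integral z N \<tau> \<xi> \<omega>)\<^sup>2)"
proof -
  have data: "0 \<le> \<tau> i" "\<tau> i \<le> \<tau> (Suc i)" "\<xi> i \<in> borel_measurable (F (\<tau> i))"
    "integrable M (\<lambda>\<omega>. (\<xi> i \<omega>)\<^sup>2)" if "i < N" for i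
    using that assms elementary_times[OF assms that] by (auto simp: elementary_data_def)
  have int: "integrable M (\<xi> i)" if "i < N" for i
    by (rule square_integrable_imp_integrable[OF F_measurable[OF data(3)] data(4)]) (use that in auto)
  show "(\<integral>\<omega>. elementary_integral z N \<tau> \<xi> \<omega> \<partial>M) = 0"
    unfolding elementary_integral_def
    using mult_increment(1,2)[OF data(1-3) int] by (subst Bochner_Integration.integral_sum) auto
  show "integrable M (\<lambda>\<omega>. (elementary_integral z N \<tau> \<xi> \<omega>)\<^sup>2)"
    unfolding elementary_integral_def power2_eq_square sum_product
    by (intro Bochner_Integration.integrable_sum increment_product(1) data) auto
qed

section \<open>Mean square limits of elementary integrals\<close>

lemma ito_integrand_msq:
  assumes "ito_integrand M F T H"
  shows "(\<lambda>(s, \<omega>). H s \<omega>) \<in> borel_measurable (path_space T)"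
    and "msq (path_space T) (\<lambda>(s, \<omega>). H s \<omega>) < \<infinity>"
proof -
  show m: "(\<lambda>(s, \<omega>). H s \<omega>) \<in> borel_measurable (path_space T)"
    using assms by (simp add: ito_integrand_def measurable_cong_sets[OF sets_path_space refl])
  show "msq (path_space T) (\<lambda>(s, \<omega>). H s \<omega>) < \<infinity>"
    using assms by (simp add: msq_path_space[OF m] ito_integrand_def)
qed

lemma has_ito_integralI:
  assumes H: "ito_integrand M F T H" and I: "I \<in> borel_measurable M"
    and data: "\<And>n. elementary_data M F T (N n) (\<tau> n) (\<xi> n)"
    and proc: "msq_null (path_space T) (\<lambda>n (s, \<omega>). elementary_process (N n) (\<tau> n) (\<xi> n) s \<omega> - H s \<omega>)"
    and int: "msq_null M (\<lambda>n \<omega>. elementary_integral z (N n) (\<tau> n) (\<xi> n) \<omega> - I \<omega>)"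
  shows "has_ito_integral M F z T H I"
proof -
  have "(\<lambda>n. \<integral>\<^sup>+\<omega>. (\<integral>\<^sup>+s\<in>{0..T}.
      ennreal ((elementary_process (N n) (\<tau> n) (\<xi> n) s \<omega> - H s \<omega>)\<^sup>2) \<partial>lborel) \<partial>M) \<longlonglongrightarrow> 0"
    using proc msq_null_measurable[OF proc] by (simp add: msq_null_def msq_path_space)
  then show ?thesis
    unfolding has_ito_integral_def using H I data int by (auto simp: msq_null_def msq_def)
qed

text \<open>Adds the measurability of the differences to the bare limits of the definition, as the
  calculus of \<open>msq_null\<close> requires.\<close>

lemma has_ito_integralE:
  assumes "has_ito_integral M F z T H I"
  obtains N \<tau> \<xi> where "\<And>n. elementary_data M F T (N n) (\<tau> n) (\<xi> n)"
    "msq_null (path_space T) (\<lambda>n (s, \<omega>). elementary_process (N n) (\<tau> n) (\<xi> n) s \<omega> - H s \<omega>)"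
    "msq_null M (\<lambda>n \<omega>. elementary_integral z (N n) (\<tau> n) (\<xi> n) \<omega> - I \<omega>)"
proof -
  from assms obtain N \<tau> \<xi> where data: "\<And>n. elementary_data M F T (N n) (\<tau> n) (\<xi> n)"
    and proc: "(\<lambda>n. \<integral>\<^sup>+\<omega>. (\<integral>\<^sup>+s\<in>{0..T}.
        ennreal ((elementary_process (N n) (\<tau> n) (\<xi> n) s \<omega> - H s \<omega>)\<^sup>2) \<partial>lborel) \<partial>M) \<longlonglongrightarrow> 0"
    and int: "(\<lambda>n. \<integral>\<^sup>+\<omega>. ennreal ((elementary_integral z (N n) (\<tau> n) (\<xi> n) \<omega> - I \<omega>)\<^sup>2) \<partial>M) \<longlonglongrightarrow> 0"
    and H: "ito_integrand M F T H" and I: "I \<in> borel_measurable M"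
    unfolding has_ito_integral_def by blast
  have m: "(\<lambda>(s, \<omega>). elementary_process (N n) (\<tau> n) (\<xi> n) s \<omega> - H s \<omega>) \<in> borel_measurable (path_space T)" for n
    using borel_measurable_diff[OF elementary_process_measurable[OF data] ito_integrand_msq(1)[OF H], of n]
    by (simp add: split_beta')
  show thesis
  proof (rule that[OF data])
    show "msq_null (path_space T) (\<lambda>n (s, \<omega>). elementary_process (N n) (\<tau> n) (\<xi> n) s \<omega> - H s \<omega>)"
      using m proc by (simp add: msq_null_def msq_path_space)
    show "msq_null M (\<lambda>n \<omega>. elementary_integral z (N n) (\<tau> n) (\<xi> n) \<omega> - I \<omega>)"
      using elementary_integral_measurable[OF data] I int by (simp add: msq_null_def msq_def)
  qed
qed

text \<open>The two integrals may come from different approximations. By the elementary isometry the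
  difference of the approximating integrals is as small as that of the approximating processes,
  which have the same limit \<open>H\<close>.\<close>

lemma has_ito_integral_unique:
  assumes I: "has_ito_integral M F z T H I" and I': "has_ito_integral M F z T H I'"
  shows "AE \<omega> in M. I \<omega> = I' \<omega>"
proof -
  have [measurable]: "I \<in> borel_measurable M" "I' \<in> borel_measurable M"
    using I I' by (auto simp: has_ito_integral_def)
  obtain N \<tau> \<xi> where 1: "\<And>n. elementary_data M F T (N n) (\<tau> n) (\<xi> n)"
    "msq_null (path_space T) (\<lambda>n (s, \<omega>). elementary_process (N n) (\<tau> n) (\<xi> n) s \<omega> - H s \<omega>)"
    "msq_null M (\<lambda>n \<omega>. elementary_integral z (N n) (\<tau> n) (\<xi> n) \<omega> - I \<omega>)"
    by (rule has_ito_integralE[OF I]) (rule that)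
  obtain N' \<tau>' \<xi>' where 2: "\<And>n. elementary_data M F T (N' n) (\<tau>' n) (\<xi>' n)"
    "msq_null (path_space T) (\<lambda>n (s, \<omega>). elementary_process (N' n) (\<tau>' n) (\<xi>' n) s \<omega> - H s \<omega>)"
    "msq_null M (\<lambda>n \<omega>. elementary_integral z (N' n) (\<tau>' n) (\<xi>' n) \<omega> - I' \<omega>)"
    by (rule has_ito_integralE[OF I']) (rule that)
  have "msq M (\<lambda>\<omega>. I \<omega> - I' \<omega>) \<le> msq (path_space T) (\<lambda>_. 0)"
  proof (rule msq_limit_le)
    show "msq_null M (\<lambda>n \<omega>. (elementary_integral z (N n) (\<tau> n) (\<xi> n) \<omega>
        - elementary_integral z (N' n) (\<tau>' n) (\<xi>' n) \<omega>) - (I \<omega> - I' \<omega>))"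
      using msq_null_diff[OF 1(3) 2(3)] by (simp add: algebra_simps)
    show "msq_null (path_space T) (\<lambda>n p. (\<lambda>(s, \<omega>). elementary_process (N n) (\<tau> n) (\<xi> n) s \<omega>
        - elementary_process (N' n) (\<tau>' n) (\<xi>' n) s \<omega>) p - 0)"
      using msq_null_diff[OF 1(2) 2(2)] by (simp add: split_beta')
  qed (simp_all add: elementary_isometry[OF 1(1) 2(1)])
  then have "msq M (\<lambda>\<omega>. I \<omega> - I' \<omega>) = 0" by (simp add: msq_def)
  then have "AE \<omega> in M. I \<omega> - I' \<omega> = 0" by (intro msq_eq_0_imp_AE) auto
  then show ?thesis by simp
qed

lemma ito_isometry:
  assumes I: "has_ito_integral M F z T H I"
  shows "msq M I = msq (path_space T) (\<lambda>(s, \<omega>). H s \<omega>)"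
proof -
  have H: "(\<lambda>(s, \<omega>). H s \<omega>) \<in> borel_measurable (path_space T)" and Im: "I \<in> borel_measurable M"
    using I by (auto simp: has_ito_integral_def intro: ito_integrand_msq)
  obtain N \<tau> \<xi> where 1: "\<And>n. elementary_data M F T (N n) (\<tau> n) (\<xi> n)"
    "msq_null (path_space T) (\<lambda>n (s, \<omega>). elementary_process (N n) (\<tau> n) (\<xi> n) s \<omega> - H s \<omega>)"
    "msq_null M (\<lambda>n \<omega>. elementary_integral z (N n) (\<tau> n) (\<xi> n) \<omega> - I \<omega>)"
    by (rule has_ito_integralE[OF I]) (rule that)
  \<comment> \<open>Subtracting the zero process turns the isometry for differences into one for a
    single elementary process.\<close>
  have zero: "elementary_data M F T 1 (\<lambda>i. if i = 0 then 0 else T) (\<lambda>_ _. 0)" if "0 \<le> T"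
    using that by (simp add: elementary_data_def)
  \<comment> \<open>The existence of a partition that ascends from 0 to \<open>T\<close> forces the
    sign of \<open>T\<close>.\<close>
  have T: "0 \<le> T"
  proof -
    have "0 \<le> \<tau> 0 i" if "i \<le> N 0" for i
      using that
      by (induction i) (use 1(1)[of 0] elementary_times[OF 1(1), of _ 0] in \<open>auto simp: elementary_data_def Suc_le_eq intro: order_trans\<close>)
    from this[of "N 0"] show ?thesis using 1(1)[of 0] by (simp add: elementary_data_def)
  qed
  have eq: "msq M (elementary_integral z (N n) (\<tau> n) (\<xi> n))
      = msq (path_space T) (\<lambda>(s, \<omega>). elementary_process (N n) (\<tau> n) (\<xi> n) s \<omega>)" for n
    using elementary_isometry[OF 1(1)[of n] zero[OF T]]
    by (simp add: elementary_integral_def[abs_def] elementary_process_def)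
  have 2: "msq_null (path_space T) (\<lambda>n p. (\<lambda>(s, \<omega>). elementary_process (N n) (\<tau> n) (\<xi> n) s \<omega>) p
      - (\<lambda>(s, \<omega>). H s \<omega>) p)"
    using 1(2) by (simp add: split_beta')
  show ?thesis
    by (intro antisym msq_limit_le[OF 1(3) Im 2 H] msq_limit_le[OF 2 H 1(3) Im]) (simp_all add: eq)
qed

lemma expectation_ito_integral:
  assumes I: "has_ito_integral M F z T H I"
  shows "integrable M (\<lambda>\<omega>. (I \<omega>)\<^sup>2)" "integrable M I" "(\<integral>\<omega>. I \<omega> \<partial>M) = 0"
proof -
  have H: "ito_integrand M F T H" and Im[measurable]: "I \<in> borel_measurable M"
    using I by (auto simp: has_ito_integral_def)
  show I2: "integrable M (\<lambda>\<omega>. (I \<omega>)\<^sup>2)"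
    using ito_integrand_msq(2)[OF H] ito_isometry[OF I] msq_finite_iff[OF Im] by simp
  show I1: "integrable M I"
    by (rule square_integrable_imp_integrable[OF Im I2])
  obtain N \<tau> \<xi> where 1: "\<And>n. elementary_data M F T (N n) (\<tau> n) (\<xi> n)"
    "msq_null (path_space T) (\<lambda>n (s, \<omega>). elementary_process (N n) (\<tau> n) (\<xi> n) s \<omega> - H s \<omega>)"
    "msq_null M (\<lambda>n \<omega>. elementary_integral z (N n) (\<tau> n) (\<xi> n) \<omega> - I \<omega>)"
    by (rule has_ito_integralE[OF I]) (rule that)
  let ?J = "\<lambda>n. elementary_integral z (N n) (\<tau> n) (\<xi> n)"
  have [measurable]: "?J n \<in> borel_measurable M" for n
    by (rule elementary_integral_measurable[OF 1(1)])
  \<comment> \<open>Elementary integrals have mean 0, so the mean of \<open>I\<close> is up to sign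
    that of the error, and its square is at most the mean square of the error.\<close>
  have "ennreal ((\<integral>\<omega>. I \<omega> \<partial>M)\<^sup>2) \<le> msq M (\<lambda>\<omega>. ?J n \<omega> - I \<omega>)" for n
  proof -
    have J2: "integrable M (\<lambda>\<omega>. (?J n \<omega>)\<^sup>2)"
      by (rule expectation_elementary_integral(2)[OF 1(1)])
    have J1: "integrable M (?J n)"
      by (rule square_integrable_imp_integrable[OF _ J2]) simp
    have D2: "integrable M (\<lambda>\<omega>. (?J n \<omega> - I \<omega>)\<^sup>2)"
      unfolding power2_diff
      using integrable_mult_of_squares[OF _ Im J2 I2] I2 J2 by (auto simp: mult.assoc)
    have "(\<integral>\<omega>. I \<omega> \<partial>M)\<^sup>2 = (\<integral>\<omega>. ?J n \<omega> - I \<omega> \<partial>M)\<^sup>2"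
      using I1 J1 expectation_elementary_integral(1)[OF 1(1)[of n]] by simp
    also have "\<dots> \<le> (\<integral>\<omega>. (?J n \<omega> - I \<omega>)\<^sup>2 \<partial>M)"
      using variance_eq[of "\<lambda>\<omega>. ?J n \<omega> - I \<omega>"] variance_positive[of "\<lambda>\<omega>. ?J n \<omega> - I \<omega>"] I1 J1 D2
      by simp
    finally show ?thesis
      using msq_eq_integral[OF D2] by (simp add: ennreal_leI)
  qed
  moreover have "(\<lambda>n. msq M (\<lambda>\<omega>. ?J n \<omega> - I \<omega>)) \<longlonglongrightarrow> 0"
    using 1(3) by (simp add: msq_null_def)
  ultimately have "ennreal ((\<integral>\<omega>. I \<omega> \<partial>M)\<^sup>2) \<le> 0"
    by (intro LIMSEQ_le_const) auto
  then show "(\<integral>\<omega>. I \<omega> \<partial>M) = 0" by (simp add: ennreal_eq_0_iff)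
qed

lemma has_ito_integral_const:
  assumes T: "0 \<le> T"
  shows "has_ito_integral M F z T (\<lambda>_ _. c) (\<lambda>\<omega>. c * z T \<omega>)"
proof -
  let ?\<tau> = "\<lambda>i::nat. if i = 0 then 0 else T"
  have data: "elementary_data M F T 1 ?\<tau> (\<lambda>_ _. c)"
    using T by (simp add: elementary_data_def)
  have H: "ito_integrand M F T (\<lambda>_ _. c)"
    using T by (simp add: ito_integrand_def nn_integral_cmult ennreal_mult_less_top emeasure_eq_measure)
  show ?thesis
  proof (rule has_ito_integralI[where N = "\<lambda>_. 1" and \<tau> = "\<lambda>_. ?\<tau>" and \<xi> = "\<lambda>_ _ _. c"])
    have m: "(\<lambda>(s, \<omega>). elementary_process 1 ?\<tau> (\<lambda>_ _. c) s \<omega> - c) \<in> borel_measurable (path_space T)"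
      using borel_measurable_diff[OF elementary_process_measurable[OF data] ito_integrand_msq(1)[OF H]]
      by (simp add: split_beta')
    have "(\<integral>\<^sup>+s\<in>{0..T}. ennreal ((elementary_process 1 ?\<tau> (\<lambda>_ _. c) s \<omega> - c)\<^sup>2) \<partial>lborel) = 0" for \<omega> :: 'a
    proof -
      \<comment> \<open>Cells are half-open, so the elementary process drops from \<open>c\<close>
        to 0 at the final time, which is a null set.\<close>
      have "AE s in lborel. s \<noteq> T" by (rule AE_lborel_singleton)
      then have "AE s in lborel. ennreal ((elementary_process 1 ?\<tau> (\<lambda>_ _. c) s \<omega> - c)\<^sup>2) * indicator {0..T} s = 0"
        by eventually_elim (auto simp: elementary_process_def split: split_indicator)
      then show ?thesis
        using nn_integral_cong_AE by fastforce
    qed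
    then have "msq (path_space T) (\<lambda>(s, \<omega>). elementary_process 1 ?\<tau> (\<lambda>_ _. c) s \<omega> - c) = 0"
      by (subst msq_path_space[OF m]) (simp del: One_nat_def)
    then show "msq_null (path_space T) (\<lambda>n (s, \<omega>). elementary_process 1 ?\<tau> (\<lambda>_ _. c) s \<omega> - c)"
      using m by (simp add: msq_null_def)
    have "msq M (\<lambda>\<omega>. elementary_integral z 1 ?\<tau> (\<lambda>_ _. c) \<omega> - c * z T \<omega>) = msq M (\<lambda>_. 0)"
      by (intro msq_cong_AE AE_I2) (simp add: elementary_integral_def z_0)
    then show "msq_null M (\<lambda>n \<omega>. elementary_integral z 1 ?\<tau> (\<lambda>_ _. c) \<omega> - c * z T \<omega>)"
      using elementary_integral_measurable[OF data] T by (simp add: msq_null_def msq_def)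
  qed (use data H T in auto)
qed

end

section \<open>Integrals along continuous paths\<close>

lemma integral_grid:
  fixes g :: "real \<Rightarrow> real"
  assumes "0 \<le> d" "continuous_on {a..a + real n * d} g"
  shows "integral {a..a + real n * d} g = (\<Sum>i<n. integral {a + real i * d..a + real (Suc i) * d} g)"
  using assms(2)
proof (induction n)
  case (Suc n)
  have le: "a + real n * d \<le> a + real (Suc n) * d" using assms(1) by (simp add: algebra_simps)
  then have "continuous_on {a..a + real n * d} g"
    using Suc.prems by (rule_tac continuous_on_subset) auto
  moreover have "integral {a..a + real n * d} g + integral {a + real n * d..a + real (Suc n) * d} g
      = integral {a..a + real (Suc n) * d} g"
    using assms(1) le Suc.prems by (intro Henstock_Kurzweil_Integration.integral_combine integrable_continuous_real) auto
  ultimately show ?case using Suc.IH by simp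
qed simp

text \<open>Time integrals of continuous paths are handled as limits of these finite sums, which
  inherit measurability and moment bounds from the values at single times.\<close>

lemma riemann_sums:
  fixes g :: "real \<Rightarrow> real"
  assumes "a \<le> b" and cont: "continuous_on {a..b} g"
  shows "(\<lambda>n. \<Sum>i<n. (b - a) / real n * g (a + real i * ((b - a) / real n))) \<longlonglongrightarrow> integral {a..b} g"
proof (rule LIMSEQ_I)
  fix e :: real assume "0 < e"
  \<comment> \<open>The added 1 keeps the denominator positive when \<open>a = b\<close>.\<close>
  define e' where "e' = e / (2 * (b - a + 1))"
  have "0 < e'" using \<open>0 < e\<close> \<open>a \<le> b\<close> by (simp add: e'_def)
  moreover have "e' * (b - a) < e' * (2 * (b - a + 1))"
    using \<open>0 < e'\<close> \<open>a \<le> b\<close> by (intro mult_strict_left_mono) auto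
  then have "e' * (b - a) < e" using \<open>a \<le> b\<close> by (simp add: e'_def)
  ultimately have e': "0 < e'" "e' * (b - a) < e" by auto
  have "uniformly_continuous_on {a..b} g"
    by (intro compact_uniformly_continuous cont) auto
  then obtain r where r: "0 < r"
    "\<And>u v. u \<in> {a..b} \<Longrightarrow> v \<in> {a..b} \<Longrightarrow> \<bar>v - u\<bar> < r \<Longrightarrow> \<bar>g v - g u\<bar> < e'"
    using e'(1) unfolding uniformly_continuous_on_def dist_real_def by metis
  obtain n0 :: nat where n0: "(b - a) / r < real n0" using reals_Archimedean2 by blast
  show "\<exists>n0. \<forall>n\<ge>n0. norm ((\<Sum>i<n. (b - a) / real n * g (a + real i * ((b - a) / real n))) - integral {a..b} g) < e"
  proof (intro exI[of _ "Suc n0"] allI impI)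
    fix n assume "Suc n0 \<le> n"
    then have n: "0 < real n" "(b - a) / r < real n" using n0 by auto
    define d where "d = (b - a) / real n"
    have d: "0 \<le> d" "d < r" "real n * d = b - a"
      using n r(1) \<open>a \<le> b\<close> by (auto simp: d_def field_simps)
    have end_le: "a + real (Suc i) * d \<le> b" if "i < n" for i
    proof -
      have "real (Suc i) * d \<le> real n * d" using that d(1) by (intro mult_right_mono) auto
      then show ?thesis using d(3) by simp
    qed
    have start: "a \<le> a + real i * d" "a + real i * d \<le> a + real (Suc i) * d" for i
      using d(1) by (auto simp: algebra_simps)
    have cont_i: "continuous_on {a + real i * d..a + real (Suc i) * d} g" if "i < n" for i
      using start(1)[of i] end_le[OF that] by (intro continuous_on_subset[OF cont]) auto
    have cell: "\<bar>d * g (a + real i * d) - integral {a + real i * d..a + real (Suc i) * d} g\<bar> \<le> e' * d"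
      if "i < n" for i
    proof -
      have "d * g (a + real i * d) - integral {a + real i * d..a + real (Suc i) * d} g
          = integral {a + real i * d..a + real (Suc i) * d} (\<lambda>u. g (a + real i * d) - g u)"
        using start(2)[of i] integrable_continuous_real[OF cont_i[OF that]]
        by (subst integral_diff) (auto simp: algebra_simps)
      moreover have "norm (integral {a + real i * d..a + real (Suc i) * d} (\<lambda>u. g (a + real i * d) - g u))
          \<le> e' * (a + real (Suc i) * d - (a + real i * d))"
      proof (rule integral_bound)
        fix u assume u: "u \<in> {a + real i * d..a + real (Suc i) * d}"
        have "u \<in> {a..b}" "a + real i * d \<in> {a..b}"
          using u start[of i] end_le[OF that] by auto
        moreover have "\<bar>a + real i * d - u\<bar> < r" using u d(2) by (auto simp: algebra_simps)
        ultimately show "norm (g (a + real i * d) - g u) \<le> e'"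
          using r(2)[of u "a + real i * d"] by simp
      qed (use start(2)[of i] cont_i[OF that] in \<open>auto intro!: continuous_intros simp del: of_nat_Suc\<close>)
      ultimately show ?thesis by (simp add: algebra_simps)
    qed
    have "integral {a..b} g = (\<Sum>i<n. integral {a + real i * d..a + real (Suc i) * d} g)"
      using integral_grid[of d a n g] d cont by simp
    then have "\<bar>(\<Sum>i<n. d * g (a + real i * d)) - integral {a..b} g\<bar>
        = \<bar>\<Sum>i<n. d * g (a + real i * d) - integral {a + real i * d..a + real (Suc i) * d} g\<bar>"
      by (simp add: sum_subtractf)
    also have "\<dots> \<le> (\<Sum>i<n. e' * d)"
      by (intro order_trans[OF sum_abs] sum_mono cell) auto
    also have "\<dots> = e' * (real n * d)" by simp
    also have "\<dots> = e' * (b - a)" by (simp only: d(3))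
    finally show "norm ((\<Sum>i<n. (b - a) / real n * g (a + real i * ((b - a) / real n))) - integral {a..b} g) < e"
      using e'(2) by (simp add: d_def)
  qed
qed

lemma grid_mem:
  assumes "a \<le> b" "i < n"
  shows "a + real i * ((b - a) / real n) \<in> {a..b}"
proof -
  have "real i * ((b - a) / real n) \<le> real n * ((b - a) / real n)"
    using assms by (intro mult_right_mono) auto
  then show ?thesis using assms by simp
qed

text \<open>\<open>N\<close> may be a member of the filtration, so the lemma also yields adaptedness
  of time integrals.\<close>

lemma borel_measurable_path_integral:
  fixes a b :: real
  assumes "a \<le> b" and X: "\<And>r. r \<in> {a..b} \<Longrightarrow> X r \<in> borel_measurable N"
    and cont: "\<And>\<omega>. \<omega> \<in> space N \<Longrightarrow> continuous_on {a..b} (\<lambda>r. X r \<omega> :: real)"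
  shows "(\<lambda>\<omega>. integral {a..b} (\<lambda>r. X r \<omega>)) \<in> borel_measurable N"
proof (rule borel_measurable_LIMSEQ_real)
  show "(\<lambda>n. \<Sum>i<n. (b - a) / real n * X (a + real i * ((b - a) / real n)) \<omega>)
      \<longlonglongrightarrow> integral {a..b} (\<lambda>r. X r \<omega>)" if "\<omega> \<in> space N" for \<omega>
    by (rule riemann_sums[OF assms(1) cont[OF that]])
  show "(\<lambda>\<omega>. \<Sum>i<n. (b - a) / real n * X (a + real i * ((b - a) / real n)) \<omega>) \<in> borel_measurable N" for n
    using grid_mem[OF assms(1)] X by (intro borel_measurable_sum borel_measurable_times) auto
qed

text \<open>Fatou's lemma along Riemann sums: each sum has mean at most \<open>(b - a) * c\<close>,
  and only measurability at each single time is at hand.\<close>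

lemma nn_integral_path_integral_le:
  fixes a b :: real
  assumes "a \<le> b" and X[measurable]: "\<And>r. r \<in> {a..b} \<Longrightarrow> X r \<in> borel_measurable N"
    and cont: "\<And>\<omega>. \<omega> \<in> space N \<Longrightarrow> continuous_on {a..b} (\<lambda>r. X r \<omega> :: real)"
    and nonneg: "\<And>r \<omega>. 0 \<le> X r \<omega>"
    and c: "0 \<le> c" "\<And>r. r \<in> {a..b} \<Longrightarrow> (\<integral>\<^sup>+\<omega>. ennreal (X r \<omega>) \<partial>N) \<le> ennreal c"
  shows "(\<integral>\<^sup>+\<omega>. ennreal (integral {a..b} (\<lambda>r. X r \<omega>)) \<partial>N) \<le> ennreal ((b - a) * c)"
proof -
  let ?t = "\<lambda>n i. a + real i * ((b - a) / real n)"
  let ?R = "\<lambda>n \<omega>. \<Sum>i<n. (b - a) / real n * X (?t n i) \<omega>"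
  have t: "i < n \<Longrightarrow> ?t n i \<in> {a..b}" for n i by (rule grid_mem[OF assms(1)])
  have [measurable]: "?R n \<in> borel_measurable N" for n
    using t X by (intro borel_measurable_sum borel_measurable_times) auto
  have "(\<integral>\<^sup>+\<omega>. ennreal (?R n \<omega>) \<partial>N) \<le> ennreal ((b - a) * c)" for n
  proof -
    have "(\<integral>\<^sup>+\<omega>. ennreal (?R n \<omega>) \<partial>N)
        = (\<integral>\<^sup>+\<omega>. (\<Sum>i<n. ennreal ((b - a) / real n) * ennreal (X (?t n i) \<omega>)) \<partial>N)"
      using assms(1) nonneg
      by (intro nn_integral_cong) (simp add: ennreal_mult[symmetric] del: ennreal_mult)
    also have "\<dots> = (\<Sum>i<n. ennreal ((b - a) / real n) * (\<integral>\<^sup>+\<omega>. ennreal (X (?t n i) \<omega>) \<partial>N))"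
      using X[OF t] by (subst nn_integral_sum) (auto intro!: sum.cong nn_integral_cmult)
    also have "\<dots> \<le> (\<Sum>i<n. ennreal ((b - a) / real n) * ennreal c)"
      using c(2)[OF t] by (intro sum_mono mult_left_mono) auto
    also have "\<dots> = ennreal (\<Sum>i<n. (b - a) / real n * c)"
      using assms(1) c(1) by (simp only: ennreal_mult[symmetric] sum_ennreal divide_nonneg_nonneg
          mult_nonneg_nonneg of_nat_0_le_iff diff_ge_0_iff_ge)
    also have "\<dots> \<le> ennreal ((b - a) * c)"
      using assms(1) c(1) by (intro ennreal_leI) (cases "n = 0", auto)
    finally show ?thesis .
  qed
  then have "liminf (\<lambda>n. \<integral>\<^sup>+\<omega>. ennreal (?R n \<omega>) \<partial>N) \<le> ennreal ((b - a) * c)"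
    by (intro Liminf_le) auto
  moreover have "(\<integral>\<^sup>+\<omega>. ennreal (integral {a..b} (\<lambda>r. X r \<omega>)) \<partial>N)
      = (\<integral>\<^sup>+\<omega>. liminf (\<lambda>n. ennreal (?R n \<omega>)) \<partial>N)"
  proof (rule nn_integral_cong)
    fix \<omega> assume "\<omega> \<in> space N"
    then have "(\<lambda>n. ?R n \<omega>) \<longlonglongrightarrow> integral {a..b} (\<lambda>r. X r \<omega>)"
      by (intro riemann_sums assms cont)
    then show "ennreal (integral {a..b} (\<lambda>r. X r \<omega>)) = liminf (\<lambda>n. ennreal (?R n \<omega>))"
      by (intro lim_imp_Liminf[symmetric] tendsto_ennrealI) auto
  qed
  moreover have "(\<integral>\<^sup>+\<omega>. liminf (\<lambda>n. ennreal (?R n \<omega>)) \<partial>N) \<le> liminf (\<lambda>n. \<integral>\<^sup>+\<omega>. ennreal (?R n \<omega>) \<partial>N)"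
    by (rule nn_integral_liminf) measurable
  ultimately show ?thesis by simp
qed

text \<open>Cauchy-Schwarz, obtained from the nonnegative integral of the squared deviation of
  \<open>g\<close> from its mean value \<open>c\<close>.\<close>

lemma integral_power2_le:
  fixes g :: "real \<Rightarrow> real"
  assumes "a \<le> b" and cont: "continuous_on {a..b} g"
  shows "(integral {a..b} g)\<^sup>2 \<le> (b - a) * integral {a..b} (\<lambda>r. (g r)\<^sup>2)"
proof (cases "a = b")
  case False
  define I where "I = integral {a..b} g"
  define c where "c = I / (b - a)"
  have ab: "0 < b - a" using assms(1) False by simp
  note int = integrable_continuous_real[OF cont] integrable_continuous_real[OF continuous_on_power[OF cont, of 2]]
  have "0 \<le> integral {a..b} (\<lambda>r. (g r - c)\<^sup>2)"
    by (intro integral_nonneg integrable_continuous_real continuous_intros cont) auto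
  also have "(\<lambda>r. (g r - c)\<^sup>2) = (\<lambda>r. (g r)\<^sup>2 - (2 * c) * g r + c\<^sup>2)"
    by (auto simp: power2_diff)
  also have "integral {a..b} \<dots> = integral {a..b} (\<lambda>r. (g r)\<^sup>2) - 2 * c * I + c\<^sup>2 * (b - a)"
  proof -
    have "((\<lambda>r. (g r)\<^sup>2 - (2 * c) * g r + c\<^sup>2) has_integral
        integral {a..b} (\<lambda>r. (g r)\<^sup>2) - (2 * c) * I + (b - a) * c\<^sup>2) {a..b}"
      unfolding I_def
      by (intro has_integral_add has_integral_diff has_integral_mult_right integrable_integral int)
        (use has_integral_const_real[of "c\<^sup>2" a b] ab in simp)
    then show ?thesis using ab by (simp add: integral_unique mult.commute)
  qed
  also have "\<dots> = integral {a..b} (\<lambda>r. (g r)\<^sup>2) - c * I"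
  proof -
    have "c * (b - a) = I" using ab by (simp add: c_def)
    then have "c\<^sup>2 * (b - a) = c * I" by (metis mult.assoc power2_eq_square)
    then show ?thesis by simp
  qed
  finally have "(b - a) * (c * I) \<le> (b - a) * integral {a..b} (\<lambda>r. (g r)\<^sup>2)"
    using ab by (intro mult_left_mono) auto
  moreover have "(b - a) * (c * I) = I\<^sup>2" using ab by (simp add: c_def power2_eq_square)
  ultimately show ?thesis by (simp add: I_def)
qed simp

lemma integral_power4_le:
  fixes g :: "real \<Rightarrow> real"
  assumes "a \<le> b" and cont: "continuous_on {a..b} g"
  shows "(integral {a..b} g) ^ 4 \<le> (b - a) ^ 3 * integral {a..b} (\<lambda>r. (g r) ^ 4)"
proof -
  have 4: "u ^ 4 = (u\<^sup>2)\<^sup>2" for u :: real by simp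
  have "(integral {a..b} g) ^ 4 \<le> ((b - a) * integral {a..b} (\<lambda>r. (g r)\<^sup>2))\<^sup>2"
    unfolding 4 by (intro power_mono integral_power2_le assms) auto
  also have "\<dots> = (b - a)\<^sup>2 * (integral {a..b} (\<lambda>r. (g r)\<^sup>2))\<^sup>2" by (simp add: power_mult_distrib)
  also have "\<dots> \<le> (b - a)\<^sup>2 * ((b - a) * integral {a..b} (\<lambda>r. ((g r)\<^sup>2)\<^sup>2))"
    by (intro mult_left_mono integral_power2_le assms continuous_intros) auto
  also have "\<dots> = (b - a) ^ 3 * integral {a..b} (\<lambda>r. (g r) ^ 4)"
    unfolding 4[symmetric] by (simp add: eval_nat_numeral)
  finally show ?thesis .
qed

section \<open>Inequalities for squares and fourth powers\<close>

lemma power4_add_le: "(u + v) ^ 4 \<le> 8 * u ^ 4 + 8 * (v :: real) ^ 4"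
proof -
  have 2: "(p + q)\<^sup>2 \<le> 2 * p\<^sup>2 + 2 * q\<^sup>2" for p q :: real
    using power2_add_le[of 1 p q] by simp
  have "(u + v) ^ 4 = ((u + v)\<^sup>2)\<^sup>2" by simp
  also have "\<dots> \<le> (2 * u\<^sup>2 + 2 * v\<^sup>2)\<^sup>2" by (intro power_mono 2) auto
  also have "\<dots> \<le> 2 * (2 * u\<^sup>2)\<^sup>2 + 2 * (2 * v\<^sup>2)\<^sup>2" by (rule 2)
  finally show ?thesis by (simp add: power_mult_distrib)
qed

text \<open>The weight \<open>d\<close> will be the mesh size or the root of the time, chosen so as
  to balance two factors of different orders.\<close>

lemma young:
  fixes d p q :: real
  assumes "0 < d"
  shows "p * q \<le> (d * p\<^sup>2 + q\<^sup>2 / d) / 2"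
proof -
  have "0 \<le> (d * p - q)\<^sup>2 / d" using assms by simp
  also have "\<dots> = d * p\<^sup>2 + q\<^sup>2 / d - 2 * (p * q)"
    using assms by (simp add: power2_eq_square field_simps)
  finally show ?thesis by simp
qed

text \<open>Convexity of the square, used twice, with \<open>v\<close> written as
  \<open>1 - q\<close> times a second point. What matters is the coefficient \<open>q < 1\<close> of
  \<open>u ^ 4\<close>: it preserves the contraction that the factor 8 of
  \<open>power4_add_le\<close> would destroy.\<close>

lemma power4_convex_le:
  assumes "0 < q" "q < 1"
  shows "(q * u + v) ^ 4 \<le> q * u ^ 4 + v ^ 4 / (1 - q :: real) ^ 3"
proof -
  have conv: "(q * a + (1 - q) * b)\<^sup>2 \<le> q * a\<^sup>2 + (1 - q) * b\<^sup>2" for a b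
  proof -
    have "0 \<le> q * (1 - q) * (a - b)\<^sup>2" using assms by simp
    also have "\<dots> = q * a\<^sup>2 + (1 - q) * b\<^sup>2 - (q * a + (1 - q) * b)\<^sup>2"
      by (simp add: power2_eq_square algebra_simps)
    finally show ?thesis by simp
  qed
  define b where "b = v / (1 - q)"
  have v: "v = (1 - q) * b" using assms by (simp add: b_def)
  have "(q * u + v) ^ 4 = ((q * u + (1 - q) * b)\<^sup>2)\<^sup>2" by (simp add: v)
  also have "\<dots> \<le> (q * u\<^sup>2 + (1 - q) * b\<^sup>2)\<^sup>2" by (intro power_mono conv) auto
  also have "\<dots> \<le> q * (u\<^sup>2)\<^sup>2 + (1 - q) * (b\<^sup>2)\<^sup>2" by (rule conv)
  also have "\<dots> = q * u ^ 4 + v ^ 4 / (1 - q) ^ 3"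
  proof -
    have "p * (v / p) ^ 4 = v ^ 4 / p ^ 3" if "0 < p" for p
      using that by (simp add: power_divide field_simps eval_nat_numeral)
    from this[of "1 - q"] show ?thesis using assms by (simp add: b_def)
  qed
  finally show ?thesis .
qed

lemma ennreal_lincomb:
  assumes "0 \<le> a" "0 \<le> b" "0 \<le> u" "0 \<le> v"
  shows "ennreal a * ennreal u + ennreal b * ennreal v = ennreal (a * u + b * v)"
  using assms by (simp add: ennreal_mult ennreal_plus)

text \<open>The process is the pointwise limit of its values at times rounded down to multiples of
  \<open>1 / (n + 1)\<close>. Only countably many such times occur; the maximum with 0 keeps them in
  the range where the process is controlled.\<close>

lemma (in wiener) path_measurable:
  assumes X: "\<And>s. 0 \<le> s \<Longrightarrow> X s \<in> borel_measurable M"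
    and cont: "\<And>\<omega>. \<omega> \<in> space M \<Longrightarrow> continuous_on {0..} (\<lambda>s. X s \<omega> :: real)"
  shows "(\<lambda>(s, \<omega>). X s \<omega>) \<in> borel_measurable (path_space T)"
proof (rule borel_measurable_LIMSEQ_real)
  define u where "u n s = max 0 (of_int \<lfloor>s * real (Suc n)\<rfloor> / real (Suc n))" for n s
  show "(\<lambda>n. (\<lambda>(s, \<omega>). X (u n s) \<omega>) p) \<longlonglongrightarrow> (\<lambda>(s, \<omega>). X s \<omega>) p" if "p \<in> space (path_space T)" for p
  proof -
    obtain s \<omega> where p: "p = (s, \<omega>)" by (cases p)
    then have s: "0 \<le> s" and \<omega>: "\<omega> \<in> space M"
      using that by (auto simp: space_pair_measure space_restrict_space)
    have "(\<lambda>n. of_int \<lfloor>s * real (Suc n)\<rfloor> / real (Suc n)) \<longlonglongrightarrow> s"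
    proof (rule tendsto_sandwich)
      show "\<forall>\<^sub>F n in sequentially. s - inverse (real (Suc n)) \<le> of_int \<lfloor>s * real (Suc n)\<rfloor> / real (Suc n)"
      proof (intro always_eventually allI)
        fix n
        have "s * real (Suc n) - 1 \<le> of_int \<lfloor>s * real (Suc n)\<rfloor>" by linarith
        then have "(s * real (Suc n) - 1) / real (Suc n) \<le> of_int \<lfloor>s * real (Suc n)\<rfloor> / real (Suc n)"
          by (intro divide_right_mono) auto
        then show "s - inverse (real (Suc n)) \<le> of_int \<lfloor>s * real (Suc n)\<rfloor> / real (Suc n)"
          by (simp add: diff_divide_distrib inverse_eq_divide del: of_nat_Suc)
      qed
      show "\<forall>\<^sub>F n in sequentially. of_int \<lfloor>s * real (Suc n)\<rfloor> / real (Suc n) \<le> s"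
        by (intro always_eventually allI) (simp add: pos_divide_le_eq del: of_nat_Suc)
      show "(\<lambda>n. s - inverse (real (Suc n))) \<longlonglongrightarrow> s"
        using tendsto_diff[OF tendsto_const LIMSEQ_inverse_real_of_nat] by simp
    qed auto
    then have "(\<lambda>n. u n s) \<longlonglongrightarrow> max 0 s"
      unfolding u_def by (intro tendsto_max tendsto_const)
    then have "(\<lambda>n. u n s) \<longlonglongrightarrow> s" using s by simp
    then have "(\<lambda>n. X (u n s) \<omega>) \<longlonglongrightarrow> X s \<omega>"
      by (intro continuous_on_tendsto_compose[OF cont[OF \<omega>]]) (auto simp: u_def s)
    then show ?thesis by (simp add: p)
  qed
  show "(\<lambda>(s, \<omega>). X (u n s) \<omega>) \<in> borel_measurable (path_space T)" for n
    unfolding split_beta' u_def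
  proof (rule measurable_compose_countable[where f = "\<lambda>k p. X (max 0 (of_int k / real (Suc n))) (snd p)"
        and g = "\<lambda>p. \<lfloor>fst p * real (Suc n)\<rfloor>"])
    show "(\<lambda>p. X (max 0 (of_int k / real (Suc n))) (snd p)) \<in> borel_measurable (path_space T)" for k
      by (rule measurable_compose[OF measurable_snd X]) simp
    have [measurable]: "fst \<in> borel_measurable (path_space T)"
      by (rule measurable_compose[OF measurable_fst]) (simp add: measurable_restrict_space1)
    show "(\<lambda>p. \<lfloor>fst p * real (Suc n)\<rfloor>) \<in> measurable (path_space T) (count_space UNIV)"
      by measurable
  qed
qed

text \<open>The end point \<open>T\<close> is left out of the bound because half-open cells do not
  reach it.\<close>

lemma (in wiener) msq_path_space_le:
  assumes "(\<lambda>(s, \<omega>). H s \<omega>) \<in> borel_measurable (path_space T)" "0 \<le> T" "0 \<le> c"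
    and le: "\<And>s. s \<in> {0..<T} \<Longrightarrow> msq M (H s) \<le> ennreal c"
  shows "msq (path_space T) (\<lambda>(s, \<omega>). H s \<omega>) \<le> ennreal (T * c)"
proof -
  have "(\<lambda>p. ennreal (((\<lambda>(s, \<omega>). H s \<omega>) p)\<^sup>2)) \<in> borel_measurable (path_space T)"
    using assms(1) by simp
  from nn_integral_fst[OF this] have "msq (path_space T) (\<lambda>(s, \<omega>). H s \<omega>)
      = (\<integral>\<^sup>+s. msq M (H s) * indicator {0..T} s \<partial>lborel)"
    by (simp add: msq_def nn_integral_restrict_space)
  also have "\<dots> \<le> (\<integral>\<^sup>+s. ennreal c * indicator {0..T} s \<partial>lborel)"
  proof (rule nn_integral_mono_AE)
    have "AE s in lborel. s \<noteq> T" by (rule AE_lborel_singleton)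
    then show "AE s in lborel. msq M (H s) * indicator {0..T} s \<le> ennreal c * indicator {0..T} s"
      by eventually_elim (use le in \<open>auto split: split_indicator\<close>)
  qed
  also have "\<dots> = ennreal (T * c)"
    using assms(2,3) by (simp add: nn_integral_cmult_indicator ennreal_mult mult.commute)
  finally show ?thesis .
qed

section \<open>The Ornstein-Uhlenbeck process\<close>

locale ou_process = wiener M F z
  for M :: "'a measure" and F :: "real \<Rightarrow> 'a measure" and z :: "real \<Rightarrow> 'a \<Rightarrow> real" +
  fixes x :: "real \<Rightarrow> 'a \<Rightarrow> real" and \<alpha> \<sigma> :: real
  assumes \<alpha>: "0 < \<alpha>" and \<sigma>: "0 < \<sigma>"
    and ou: "ornstein_uhlenbeck M F z \<alpha> \<sigma> x"
    and x0: "integrable M (\<lambda>\<omega>. (x 0 \<omega>) ^ 4)"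
begin

lemma x_F: "0 \<le> t \<Longrightarrow> x t \<in> borel_measurable (F t)"
  using ou by (simp add: ornstein_uhlenbeck_def has_ito_differential_def)

lemma x_measurable [measurable]: "0 \<le> t \<Longrightarrow> x t \<in> borel_measurable M"
  by (rule F_measurable[OF x_F])

lemma x_continuous: "\<omega> \<in> space M \<Longrightarrow> continuous_on {0..} (\<lambda>t. x t \<omega>)"
  using ou by (simp add: ornstein_uhlenbeck_def has_ito_differential_def)

lemma x_continuous_Icc: "\<omega> \<in> space M \<Longrightarrow> 0 \<le> s \<Longrightarrow> continuous_on {s..t} (\<lambda>r. x r \<omega>)"
  by (rule continuous_on_subset[OF x_continuous]) auto

lemma z_continuous_Icc: "\<omega> \<in> space M \<Longrightarrow> 0 \<le> s \<Longrightarrow> continuous_on {s..t} (\<lambda>r. z r \<omega>)"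
  by (rule continuous_on_subset[OF z_continuous]) auto

lemma compose_continuous:
  assumes "continuous_on UNIV h" "\<omega> \<in> space M" "0 \<le> s"
  shows "continuous_on {s..t} (\<lambda>r. h (x r \<omega>))"
  by (rule continuous_on_compose2[OF assms(1) x_continuous_Icc[OF assms(2,3)]]) auto

text \<open>The differential is given time by time, each time with its own null set. On these
  outcomes the equation holds at all times at once, which is what pathwise calculus
  requires.\<close>

definition ou_path :: "'a \<Rightarrow> bool" where
  "ou_path \<omega> \<longleftrightarrow> \<omega> \<in> space M \<and>
    (\<forall>t\<ge>0. x t \<omega> = x 0 \<omega> - \<alpha> * integral {0..t} (\<lambda>s. x s \<omega>) + \<sigma> * z t \<omega>)"

lemma AE_ou_path: "AE \<omega> in M. ou_path \<omega>"
proof -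
  let ?e = "\<lambda>t \<omega>. x t \<omega> - (x 0 \<omega> - \<alpha> * integral {0..t} (\<lambda>s. x s \<omega>) + \<sigma> * z t \<omega>)"
  have "AE \<omega> in M. ?e t \<omega> = 0" if t: "0 \<le> t" for t
  proof -
    obtain I where I: "has_ito_integral M F z t (\<lambda>s \<omega>. \<sigma>) I"
      and eq: "AE \<omega> in M. set_integrable lborel {0..t} (\<lambda>s. - \<alpha> * x s \<omega>) \<and>
           x t \<omega> = x 0 \<omega> + (LBINT s:{0..t}. - \<alpha> * x s \<omega>) + I \<omega>"
      using ou t unfolding ornstein_uhlenbeck_def has_ito_differential_def by blast
    have "AE \<omega> in M. I \<omega> = \<sigma> * z t \<omega>"
      by (rule has_ito_integral_unique[OF I has_ito_integral_const[OF t]])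
    with eq show ?thesis
    proof eventually_elim
      case (elim \<omega>)
      then have "(LBINT s:{0..t}. - \<alpha> * x s \<omega>) = integral {0..t} (\<lambda>s. - \<alpha> * x s \<omega>)"
        by (intro set_borel_integral_eq_integral) auto
      then show ?case using elim by simp
    qed
  qed
  \<comment> \<open>A countable set of times has a common null set; continuity of both sides then
    reaches every time.\<close>
  then have "AE \<omega> in M. \<forall>q::rat. 0 \<le> real_of_rat q \<longrightarrow> ?e (real_of_rat q) \<omega> = 0"
    by (auto simp: AE_all_countable)
  then show ?thesis
  proof (rule AE_mp, intro AE_I2 impI)
    fix \<omega> assume \<omega>: "\<omega> \<in> space M" and rat: "\<forall>q. 0 \<le> real_of_rat q \<longrightarrow> ?e (real_of_rat q) \<omega> = 0"
    show "ou_path \<omega>"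
      unfolding ou_path_def
    proof (intro conjI \<omega> allI impI)
      fix t :: real assume t: "0 \<le> t"
      \<comment> \<open>Approximation from the right keeps the rational times nonnegative even when
        \<open>t = 0\<close>.\<close>
      have "\<exists>q. t < real_of_rat q \<and> real_of_rat q < t + inverse (real (Suc n))" for n
        by (rule of_rat_dense) simp
      then obtain q where q: "\<And>n. t < real_of_rat (q n) \<and> real_of_rat (q n) < t + inverse (real (Suc n))"
        by metis
      have qt: "(\<lambda>n. real_of_rat (q n)) \<longlonglongrightarrow> t"
      proof (rule tendsto_sandwich[OF _ _ tendsto_const])
        show "(\<lambda>n. t + inverse (real (Suc n))) \<longlonglongrightarrow> t"
          using tendsto_add[OF tendsto_const LIMSEQ_inverse_real_of_nat, of t] by simp
      qed (use q in \<open>auto intro!: always_eventually less_imp_le simp del: of_nat_Suc\<close>)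
      have cont: "continuous_on {0..t + 1} (\<lambda>t. ?e t \<omega>)"
        using integrable_continuous_real[OF x_continuous_Icc[OF \<omega>, of 0 "t + 1"]]
        by (intro continuous_intros x_continuous_Icc z_continuous_Icc \<omega> indefinite_integral_continuous_1) auto
      have "real_of_rat (q n) \<in> {0..t + 1}" for n
      proof -
        have "inverse (real (Suc n)) \<le> 1" by (simp add: inverse_le_1_iff)
        then have "0 \<le> real_of_rat (q n)" "real_of_rat (q n) \<le> t + 1"
          using q[of n] t by linarith+
        then show ?thesis unfolding atLeastAtMost_iff by blast
      qed
      then have "(\<lambda>n. ?e (real_of_rat (q n)) \<omega>) \<longlonglongrightarrow> ?e t \<omega>"
        using t by (intro continuous_on_tendsto_compose[OF cont qt]) auto
      moreover have "?e (real_of_rat (q n)) \<omega> = 0" for n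
        using rat q[of n] t by (meson less_imp_le order_trans)
      ultimately have "?e t \<omega> = 0" by (simp add: LIMSEQ_const_iff)
      then show "x t \<omega> = x 0 \<omega> - \<alpha> * integral {0..t} (\<lambda>s. x s \<omega>) + \<sigma> * z t \<omega>" by simp
    qed
  qed
qed

lemma ou_path_increment:
  assumes "ou_path \<omega>" "0 \<le> s" "s \<le> t"
  shows "x t \<omega> - x s \<omega> = - \<alpha> * integral {s..t} (\<lambda>r. x r \<omega>) + \<sigma> * (z t \<omega> - z s \<omega>)"
proof -
  have \<omega>: "\<omega> \<in> space M" using assms(1) by (simp add: ou_path_def)
  have eq: "x r \<omega> = x 0 \<omega> - \<alpha> * integral {0..r} (\<lambda>s. x s \<omega>) + \<sigma> * z r \<omega>" if "0 \<le> r" for r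
    using assms(1)[unfolded ou_path_def] that by blast
  have "integral {0..s} (\<lambda>r. x r \<omega>) + integral {s..t} (\<lambda>r. x r \<omega>) = integral {0..t} (\<lambda>r. x r \<omega>)"
    using assms by (intro Henstock_Kurzweil_Integration.integral_combine integrable_continuous_real x_continuous_Icc \<omega>) auto
  then have "\<alpha> * integral {0..t} (\<lambda>r. x r \<omega>)
      = \<alpha> * integral {0..s} (\<lambda>r. x r \<omega>) + \<alpha> * integral {s..t} (\<lambda>r. x r \<omega>)"
    by (metis distrib_left)
  then show ?thesis
    using eq[of t] eq[of s] assms by (simp add: algebra_simps)
qed

text \<open>Subtracting the noise from \<open>x\<close> leaves a differentiable path
  \<open>y\<close> with derivative \<open>- \<alpha> * x\<close>, so ordinary calculus applies to
  \<open>exp (- \<alpha> * (t - r)) * y r\<close>. The noise term thus appears integrated by parts,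
  without a stochastic integral, and can be estimated path by path.\<close>

lemma ou_path_variation_of_constants:
  assumes "ou_path \<omega>" "0 \<le> s" "s \<le> t"
  shows "x t \<omega> = exp (- \<alpha> * (t - s)) * x s \<omega> + \<sigma> * ((z t \<omega> - z s \<omega>)
    - \<alpha> * integral {s..t} (\<lambda>r. exp (- \<alpha> * (t - r)) * (z r \<omega> - z s \<omega>)))"
proof -
  have \<omega>: "\<omega> \<in> space M" using assms(1) by (simp add: ou_path_def)
  define y where "y r = x s \<omega> - \<alpha> * integral {s..r} (\<lambda>r. x r \<omega>)" for r
  have y: "y r = x r \<omega> - \<sigma> * (z r \<omega> - z s \<omega>)" if "s \<le> r" for r
    using ou_path_increment[OF assms(1,2) that] by (simp add: y_def)
  have "((\<lambda>r. - (\<alpha> * \<sigma>) * (exp (- \<alpha> * (t - r)) * (z r \<omega> - z s \<omega>))) has_integral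
      exp (- \<alpha> * (t - t)) * y t - exp (- \<alpha> * (t - s)) * y s) {s..t}"
  proof (rule fundamental_theorem_of_calculus[OF assms(3)])
    fix r assume r: "r \<in> {s..t}"
    have "((\<lambda>u. integral {s..u} (\<lambda>r. x r \<omega>)) has_real_derivative x r \<omega>) (at r within {s..t})"
      by (rule integral_has_real_derivative[OF x_continuous_Icc[OF \<omega> assms(2)] r])
    then have "((\<lambda>r. exp (- \<alpha> * (t - r)) * y r) has_real_derivative
        (exp (- \<alpha> * (t - r)) * \<alpha>) * y r + (0 - \<alpha> * x r \<omega>) * exp (- \<alpha> * (t - r))) (at r within {s..t})"
      unfolding y_def by (auto intro!: derivative_eq_intros)
    moreover have "(exp (- \<alpha> * (t - r)) * \<alpha>) * y r + (0 - \<alpha> * x r \<omega>) * exp (- \<alpha> * (t - r))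
        = - (\<alpha> * \<sigma>) * (exp (- \<alpha> * (t - r)) * (z r \<omega> - z s \<omega>))"
    proof -
      have yr: "y r = x r \<omega> - \<sigma> * (z r \<omega> - z s \<omega>)" using r y by simp
      show ?thesis unfolding yr by (simp add: algebra_simps)
    qed
    ultimately show "((\<lambda>r. exp (- \<alpha> * (t - r)) * y r) has_vector_derivative
        - (\<alpha> * \<sigma>) * (exp (- \<alpha> * (t - r)) * (z r \<omega> - z s \<omega>))) (at r within {s..t})"
      by (simp add: has_real_derivative_iff_has_vector_derivative)
  qed
  from integral_unique[OF this] have "y t - exp (- \<alpha> * (t - s)) * y s
      = - (\<alpha> * \<sigma>) * integral {s..t} (\<lambda>r. exp (- \<alpha> * (t - r)) * (z r \<omega> - z s \<omega>))"
    by (simp only: integral_mult_right) simp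
  then show ?thesis
    using y[of t] y[of s] assms by (simp add: algebra_simps)
qed

section \<open>Fourth moments of the noise and of the process\<close>

abbreviation fourth :: "('a \<Rightarrow> real) \<Rightarrow> ennreal" where
  "fourth X \<equiv> (\<integral>\<^sup>+\<omega>. ennreal ((X \<omega>) ^ 4) \<partial>M)"

lemma fourth_increment:
  assumes "0 \<le> s" "s \<le> t"
  shows "fourth (\<lambda>\<omega>. z t \<omega> - z s \<omega>) = ennreal (3 * (t - s)\<^sup>2)"
  using increment_moments(1)[OF assms, of 4] increment_moments(4)[OF assms]
  by (subst nn_integral_eq_integral) auto

text \<open>The constant combines the factor 8 of \<open>power4_add_le\<close> with the fourth
  moment 3 of the standard normal law. The restriction to a time step of length at most 1 makes it
  independent of \<open>s\<close> and \<open>t\<close>.\<close>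

lemma fourth_noise:
  assumes s: "0 \<le> s" "s \<le> t" "t \<le> s + 1"
  shows "fourth (\<lambda>\<omega>. x t \<omega> - exp (- \<alpha> * (t - s)) * x s \<omega>) \<le> ennreal (24 * \<sigma> ^ 4 * (1 + \<alpha> ^ 4))"
proof -
  let ?D = "\<lambda>r \<omega>. z r \<omega> - z s \<omega>"
  have [measurable]: "?D t \<in> borel_measurable M"
    by (rule F_measurable[OF increment_F[OF s(1,2)]])
  have D[measurable]: "?D r \<in> borel_measurable M" if "r \<in> {s..t}" for r
    using that F_measurable[OF increment_F[OF s(1)]] by auto
  have cont: "continuous_on {s..t} (\<lambda>r. (?D r \<omega>) ^ 4)" if "\<omega> \<in> space M" for \<omega>
    by (intro continuous_intros z_continuous_Icc that s)
  have [measurable]: "(\<lambda>\<omega>. integral {s..t} (\<lambda>r. (?D r \<omega>) ^ 4)) \<in> borel_measurable M"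
    using D cont by (intro borel_measurable_path_integral s borel_measurable_power) auto
  have path: "(x t \<omega> - exp (- \<alpha> * (t - s)) * x s \<omega>) ^ 4
      \<le> 8 * \<sigma> ^ 4 * (?D t \<omega>) ^ 4 + 8 * \<sigma> ^ 4 * \<alpha> ^ 4 * integral {s..t} (\<lambda>r. (?D r \<omega>) ^ 4)"
    if "ou_path \<omega>" for \<omega>
  proof -
    have \<omega>: "\<omega> \<in> space M" using that by (simp add: ou_path_def)
    define J where "J = integral {s..t} (\<lambda>r. exp (- \<alpha> * (t - r)) * ?D r \<omega>)"
    have contJ: "continuous_on {s..t} (\<lambda>r. exp (- \<alpha> * (t - r)) * ?D r \<omega>)"
      by (intro continuous_intros z_continuous_Icc \<omega> s)
    have "J ^ 4 \<le> (t - s) ^ 3 * integral {s..t} (\<lambda>r. (exp (- \<alpha> * (t - r)) * ?D r \<omega>) ^ 4)"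
      unfolding J_def by (rule integral_power4_le[OF s(2) contJ])
    also have "\<dots> \<le> 1 * integral {s..t} (\<lambda>r. (?D r \<omega>) ^ 4)"
    proof (rule mult_mono)
      show "(t - s) ^ 3 \<le> 1" using s by (intro power_le_one) auto
      show "integral {s..t} (\<lambda>r. (exp (- \<alpha> * (t - r)) * ?D r \<omega>) ^ 4) \<le> integral {s..t} (\<lambda>r. (?D r \<omega>) ^ 4)"
      proof (rule integral_le)
        fix r assume r: "r \<in> {s..t}"
        have "exp (- \<alpha> * (t - r)) \<le> 1" using r \<alpha> by simp
        then have "exp (- \<alpha> * (t - r)) ^ 4 \<le> 1" by (intro power_le_one) auto
        then have "exp (- \<alpha> * (t - r)) ^ 4 * (?D r \<omega>) ^ 4 \<le> 1 * (?D r \<omega>) ^ 4"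
          by (intro mult_right_mono) auto
        then show "(exp (- \<alpha> * (t - r)) * ?D r \<omega>) ^ 4 \<le> (?D r \<omega>) ^ 4"
          by (simp add: power_mult_distrib)
      qed (intro integrable_continuous_real continuous_on_power contJ cont \<omega>)+
      show "0 \<le> integral {s..t} (\<lambda>r. (exp (- \<alpha> * (t - r)) * ?D r \<omega>) ^ 4)"
        by (intro integral_nonneg integrable_continuous_real continuous_on_power contJ) auto
    qed simp
    finally have J: "J ^ 4 \<le> integral {s..t} (\<lambda>r. (?D r \<omega>) ^ 4)" by simp
    have "x t \<omega> - exp (- \<alpha> * (t - s)) * x s \<omega> = \<sigma> * ?D t \<omega> + (- (\<sigma> * \<alpha> * J))"
      using ou_path_variation_of_constants[OF that s(1,2)] by (simp add: J_def algebra_simps)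
    then have "(x t \<omega> - exp (- \<alpha> * (t - s)) * x s \<omega>) ^ 4 \<le> 8 * (\<sigma> * ?D t \<omega>) ^ 4 + 8 * (\<sigma> * \<alpha> * J) ^ 4"
      using power4_add_le[of "\<sigma> * ?D t \<omega>" "- (\<sigma> * \<alpha> * J)"] by simp
    also have "\<dots> = 8 * \<sigma> ^ 4 * (?D t \<omega>) ^ 4 + 8 * \<sigma> ^ 4 * \<alpha> ^ 4 * J ^ 4"
      by (simp add: power_mult_distrib)
    also have "\<dots> \<le> 8 * \<sigma> ^ 4 * (?D t \<omega>) ^ 4 + 8 * \<sigma> ^ 4 * \<alpha> ^ 4 * integral {s..t} (\<lambda>r. (?D r \<omega>) ^ 4)"
      by (intro add_left_mono mult_left_mono J) auto
    finally show ?thesis .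
  qed
  have J4: "(\<integral>\<^sup>+\<omega>. ennreal (integral {s..t} (\<lambda>r. (?D r \<omega>) ^ 4)) \<partial>M) \<le> ennreal ((t - s) * 3)"
  proof (rule nn_integral_path_integral_le[OF s(2)])
    fix r assume r: "r \<in> {s..t}"
    have "(r - s)\<^sup>2 \<le> 1" using r s by (intro power_le_one) auto
    then show "fourth (?D r) \<le> ennreal 3"
      using fourth_increment[OF s(1), of r] r ennreal_leI[of "3 * (r - s)\<^sup>2" 3] by simp
  qed (use D cont in auto)
  have nonneg: "0 \<le> integral {s..t} (\<lambda>r. (?D r \<omega>) ^ 4)" if "\<omega> \<in> space M" for \<omega>
    by (intro integral_nonneg integrable_continuous_real cont that) auto
  have "fourth (\<lambda>\<omega>. x t \<omega> - exp (- \<alpha> * (t - s)) * x s \<omega>)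
      \<le> (\<integral>\<^sup>+\<omega>. ennreal (8 * \<sigma> ^ 4) * ennreal ((?D t \<omega>) ^ 4)
        + ennreal (8 * \<sigma> ^ 4 * \<alpha> ^ 4) * ennreal (integral {s..t} (\<lambda>r. (?D r \<omega>) ^ 4)) \<partial>M)"
  proof (rule nn_integral_mono_AE)
    show "AE \<omega> in M. ennreal ((x t \<omega> - exp (- \<alpha> * (t - s)) * x s \<omega>) ^ 4)
      \<le> ennreal (8 * \<sigma> ^ 4) * ennreal ((?D t \<omega>) ^ 4)
        + ennreal (8 * \<sigma> ^ 4 * \<alpha> ^ 4) * ennreal (integral {s..t} (\<lambda>r. (?D r \<omega>) ^ 4))"
      using AE_ou_path
    proof eventually_elim
      case (elim \<omega>)
      then have "\<omega> \<in> space M" by (simp add: ou_path_def)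
      then show ?case
        using ennreal_leI[OF path[OF elim]] nonneg by (simp add: ennreal_plus ennreal_mult)
    qed
  qed
  also have "\<dots> = ennreal (8 * \<sigma> ^ 4) * fourth (?D t)
      + ennreal (8 * \<sigma> ^ 4 * \<alpha> ^ 4) * (\<integral>\<^sup>+\<omega>. ennreal (integral {s..t} (\<lambda>r. (?D r \<omega>) ^ 4)) \<partial>M)"
    by (simp add: nn_integral_add nn_integral_cmult)
  also have "\<dots> \<le> ennreal (8 * \<sigma> ^ 4) * ennreal 3 + ennreal (8 * \<sigma> ^ 4 * \<alpha> ^ 4) * ennreal 3"
  proof (intro add_mono mult_left_mono)
    have "(t - s)\<^sup>2 \<le> 1" using s by (intro power_le_one) auto
    then show "fourth (?D t) \<le> ennreal 3"
      using fourth_increment[OF s(1,2)] ennreal_leI[of "3 * (t - s)\<^sup>2" 3] by simp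
    show "(\<integral>\<^sup>+\<omega>. ennreal (integral {s..t} (\<lambda>r. (?D r \<omega>) ^ 4)) \<partial>M) \<le> ennreal 3"
      by (rule order_trans[OF J4]) (use s ennreal_leI[of "(t - s) * 3" 3] in simp)
  qed auto
  also have "\<dots> = ennreal (8 * \<sigma> ^ 4 * 3 + 8 * \<sigma> ^ 4 * \<alpha> ^ 4 * 3)"
    by (rule ennreal_lincomb) auto
  also have "8 * \<sigma> ^ 4 * 3 + 8 * \<sigma> ^ 4 * \<alpha> ^ 4 * 3 = 24 * \<sigma> ^ 4 * (1 + \<alpha> ^ 4)"
    by (simp add: algebra_simps)
  finally show ?thesis .
qed

lemma nn_integral_fourth_le:
  assumes [measurable]: "X \<in> borel_measurable M" "Y \<in> borel_measurable M" and "0 \<le> c" "0 \<le> d"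
    and le: "AE \<omega> in M. V \<omega> \<le> c * (X \<omega>) ^ 4 + d * (Y \<omega>) ^ 4"
  shows "(\<integral>\<^sup>+\<omega>. ennreal (V \<omega>) \<partial>M) \<le> ennreal c * fourth X + ennreal d * fourth Y"
proof -
  have "(\<integral>\<^sup>+\<omega>. ennreal (V \<omega>) \<partial>M) \<le> (\<integral>\<^sup>+\<omega>. ennreal c * ennreal ((X \<omega>) ^ 4) + ennreal d * ennreal ((Y \<omega>) ^ 4) \<partial>M)"
  proof (rule nn_integral_mono_AE)
    show "AE \<omega> in M. ennreal (V \<omega>) \<le> ennreal c * ennreal ((X \<omega>) ^ 4) + ennreal d * ennreal ((Y \<omega>) ^ 4)"
      using le
    proof eventually_elim
      case (elim \<omega>)
      from ennreal_leI[OF this] show ?case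
        using assms(3,4) by (simp add: ennreal_plus ennreal_mult)
    qed
  qed
  then show ?thesis by (simp add: nn_integral_add nn_integral_cmult)
qed

text \<open>Over a unit time step \<open>x\<close> is contracted by \<open>exp (- \<alpha>)\<close> and perturbed by a noise of bounded
  fourth moment.\<close>

lemma fourth_moment_bounded:
  obtains C where "0 \<le> C" "\<And>t. 0 \<le> t \<Longrightarrow> fourth (x t) \<le> ennreal C"
proof -
  define C0 where "C0 = 24 * \<sigma> ^ 4 * (1 + \<alpha> ^ 4)"
  have C0: "0 \<le> C0" by (simp add: C0_def)
  define E where "E = (\<integral>\<omega>. (x 0 \<omega>) ^ 4 \<partial>M)"
  have E: "0 \<le> E" "fourth (x 0) = ennreal E"
    using x0 by (simp_all add: E_def nn_integral_eq_integral)
  define q where "q = exp (- \<alpha>)"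
  have q: "0 < q" "q < 1" using \<alpha> by (auto simp: q_def)
  define D where "D = C0 / (1 - q) ^ 3"
  have D: "0 \<le> D" using C0 q by (simp add: D_def)
  \<comment> \<open>The first entry covers the initial unit interval; the second makes the bound
    reproduce itself, as \<open>q * B + D \<le> B\<close>.\<close>
  define B where "B = max (8 * E + 8 * C0) (D / (1 - q))"
  have B: "0 \<le> B" using E(1) C0 by (simp add: B_def)
  have init: "fourth (x r) \<le> ennreal B" if r: "0 \<le> r" "r \<le> 1" for r
  proof -
    let ?e = "exp (- \<alpha> * (r - 0))"
    have e: "?e \<le> 1" using r \<alpha> by simp
    have "fourth (x r) \<le> ennreal 8 * fourth (x 0) + ennreal 8 * fourth (\<lambda>\<omega>. x r \<omega> - ?e * x 0 \<omega>)"
    proof (rule nn_integral_fourth_le)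
      show "AE \<omega> in M. (x r \<omega>) ^ 4 \<le> 8 * (x 0 \<omega>) ^ 4 + 8 * (x r \<omega> - ?e * x 0 \<omega>) ^ 4"
      proof (rule AE_I2)
        fix \<omega>
        have "?e ^ 4 \<le> 1" using e by (intro power_le_one) auto
        then have "(?e * x 0 \<omega>) ^ 4 \<le> (x 0 \<omega>) ^ 4"
          using mult_right_mono[of "?e ^ 4" 1 "(x 0 \<omega>) ^ 4"] by (simp add: power_mult_distrib)
        then show "(x r \<omega>) ^ 4 \<le> 8 * (x 0 \<omega>) ^ 4 + 8 * (x r \<omega> - ?e * x 0 \<omega>) ^ 4"
          using power4_add_le[of "?e * x 0 \<omega>" "x r \<omega> - ?e * x 0 \<omega>"] by simp
      qed
    qed (use r in auto)
    also have "\<dots> \<le> ennreal 8 * ennreal E + ennreal 8 * ennreal C0"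
      using fourth_noise[of 0 r] r E(2) by (intro add_mono mult_left_mono) (auto simp: C0_def)
    also have "\<dots> = ennreal (8 * E + 8 * C0)"
      using E(1) C0 by (intro ennreal_lincomb) auto
    also have "\<dots> \<le> ennreal B" by (intro ennreal_leI) (simp add: B_def)
    finally show ?thesis .
  qed
  have step: "fourth (x (s + 1)) \<le> ennreal B" if s: "0 \<le> s" "fourth (x s) \<le> ennreal B" for s
  proof -
    let ?N = "\<lambda>\<omega>. x (s + 1) \<omega> - q * x s \<omega>"
    have "fourth (x (s + 1)) \<le> ennreal q * fourth (x s) + ennreal (1 / (1 - q) ^ 3) * fourth ?N"
    proof (rule nn_integral_fourth_le)
      show "AE \<omega> in M. (x (s + 1) \<omega>) ^ 4 \<le> q * (x s \<omega>) ^ 4 + 1 / (1 - q) ^ 3 * (?N \<omega>) ^ 4"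
        using power4_convex_le[OF q, of "x s \<omega>" "?N \<omega>" for \<omega>] by simp
    qed (use s q in auto)
    also have "\<dots> \<le> ennreal q * ennreal B + ennreal (1 / (1 - q) ^ 3) * ennreal C0"
      using fourth_noise[of s "s + 1"] s by (intro add_mono mult_left_mono) (auto simp: C0_def q_def)
    also have "\<dots> = ennreal (q * B + D)"
      using q B C0 by (subst ennreal_plus) (auto simp: ennreal_mult[symmetric] D_def)
    also have "\<dots> \<le> ennreal B"
    proof (rule ennreal_leI)
      have "D / (1 - q) \<le> B" by (simp add: B_def)
      then have "D \<le> B * (1 - q)" using q by (simp add: pos_divide_le_eq)
      then show "q * B + D \<le> B" by (simp add: algebra_simps)
    qed
    finally show ?thesis .
  qed
  have all: "fourth (x (r + real n)) \<le> ennreal B" if r: "0 \<le> r" "r \<le> 1" for r n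
  proof (induction n)
    case (Suc n)
    then show ?case using step[of "r + real n"] r by (simp add: add_ac)
  qed (use init[OF r] in simp)
  show thesis
  proof (rule that[OF B])
    fix t :: real assume t: "0 \<le> t"
    \<comment> \<open>Every time is a whole number of unit steps after a time in
      \<open>{0..1}\<close>.\<close>
    define n where "n = nat \<lfloor>t\<rfloor>"
    have "real n = of_int \<lfloor>t\<rfloor>" using t by (simp add: n_def)
    then have "0 \<le> t - real n" "t - real n \<le> 1" by linarith+
    from all[OF this, of n] show "fourth (x t) \<le> ennreal B" by simp
  qed
qed

lemma fourth_path_integral:
  assumes C: "0 \<le> C" "\<And>t. 0 \<le> t \<Longrightarrow> fourth (x t) \<le> ennreal C" and s: "0 \<le> s" "s \<le> t"
  shows "fourth (\<lambda>\<omega>. integral {s..t} (\<lambda>r. x r \<omega>)) \<le> ennreal (C * (t - s) ^ 4)"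
proof -
  have "fourth (\<lambda>\<omega>. integral {s..t} (\<lambda>r. x r \<omega>))
      \<le> (\<integral>\<^sup>+\<omega>. ennreal ((t - s) ^ 3) * ennreal (integral {s..t} (\<lambda>r. (x r \<omega>) ^ 4)) \<partial>M)"
  proof (rule nn_integral_mono)
    fix \<omega> assume "\<omega> \<in> space M"
    then have cont: "continuous_on {s..t} (\<lambda>r. x r \<omega>)" by (rule x_continuous_Icc[OF _ s(1)])
    have "0 \<le> integral {s..t} (\<lambda>r. (x r \<omega>) ^ 4)"
      by (intro integral_nonneg integrable_continuous_real continuous_intros cont) auto
    then show "ennreal (integral {s..t} (\<lambda>r. x r \<omega>) ^ 4)
        \<le> ennreal ((t - s) ^ 3) * ennreal (integral {s..t} (\<lambda>r. (x r \<omega>) ^ 4))"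
      using ennreal_leI[OF integral_power4_le[OF s(2) cont]] s by (simp add: ennreal_mult)
  qed
  also have "\<dots> = ennreal ((t - s) ^ 3) * (\<integral>\<^sup>+\<omega>. ennreal (integral {s..t} (\<lambda>r. (x r \<omega>) ^ 4)) \<partial>M)"
    using s x_continuous_Icc[OF _ s(1)] by (intro nn_integral_cmult measurable_compose_rev[OF measurable_ennreal]
      borel_measurable_path_integral borel_measurable_power continuous_intros) auto
  also have "\<dots> \<le> ennreal ((t - s) ^ 3) * ennreal ((t - s) * C)"
    using s C x_continuous_Icc[OF _ s(1)]
    by (intro mult_left_mono nn_integral_path_integral_le borel_measurable_power continuous_intros) auto
  also have "\<dots> = ennreal (C * (t - s) ^ 4)"
    using s C(1) by (simp add: ennreal_mult[symmetric] eval_nat_numeral mult_ac)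
  finally show ?thesis .
qed

text \<open>The noise is of order \<open>(t - s)\<^sup>2\<close> and decides. The drift would even
  give the fourth power, two factors of which are absorbed into \<open>T\<^sup>2\<close>.\<close>

lemma fourth_x_increment:
  assumes C: "0 \<le> C" "\<And>t. 0 \<le> t \<Longrightarrow> fourth (x t) \<le> ennreal C" and s: "0 \<le> s" "s \<le> t" "t \<le> T"
  shows "fourth (\<lambda>\<omega>. x t \<omega> - x s \<omega>) \<le> ennreal ((8 * \<alpha> ^ 4 * C * T\<^sup>2 + 24 * \<sigma> ^ 4) * (t - s)\<^sup>2)"
proof -
  let ?A = "\<lambda>\<omega>. integral {s..t} (\<lambda>r. x r \<omega>)" and ?D = "\<lambda>\<omega>. z t \<omega> - z s \<omega>"
  have "fourth (\<lambda>\<omega>. x t \<omega> - x s \<omega>) \<le> ennreal (8 * \<alpha> ^ 4) * fourth ?A + ennreal (8 * \<sigma> ^ 4) * fourth ?D"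
  proof (rule nn_integral_fourth_le)
    show "?A \<in> borel_measurable M"
      using s x_continuous_Icc[OF _ s(1)] by (intro borel_measurable_path_integral) auto
    show "?D \<in> borel_measurable M" by (rule F_measurable[OF increment_F[OF s(1,2)]])
    show "AE \<omega> in M. (x t \<omega> - x s \<omega>) ^ 4 \<le> 8 * \<alpha> ^ 4 * (?A \<omega>) ^ 4 + 8 * \<sigma> ^ 4 * (?D \<omega>) ^ 4"
      using AE_ou_path
    proof eventually_elim
      case (elim \<omega>)
      show ?case
        unfolding ou_path_increment[OF elim s(1,2)]
        using power4_add_le[of "- \<alpha> * ?A \<omega>" "\<sigma> * ?D \<omega>"] by (simp add: power_mult_distrib)
    qed
  qed auto
  also have "\<dots> \<le> ennreal (8 * \<alpha> ^ 4) * ennreal (C * (t - s) ^ 4) + ennreal (8 * \<sigma> ^ 4) * ennreal (3 * (t - s)\<^sup>2)"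
    using fourth_path_integral[OF C s(1,2)] fourth_increment[OF s(1,2)]
    by (intro add_mono mult_left_mono) auto
  also have "\<dots> = ennreal (8 * \<alpha> ^ 4 * (C * (t - s) ^ 4) + 8 * \<sigma> ^ 4 * (3 * (t - s)\<^sup>2))"
    using C(1) by (intro ennreal_lincomb) auto
  also have "\<dots> \<le> ennreal ((8 * \<alpha> ^ 4 * C * T\<^sup>2 + 24 * \<sigma> ^ 4) * (t - s)\<^sup>2)"
  proof (rule ennreal_leI)
    have "(t - s)\<^sup>2 \<le> T\<^sup>2" using s by (intro power_mono) auto
    then have "(8 * \<alpha> ^ 4 * C * (t - s)\<^sup>2) * (t - s)\<^sup>2 \<le> (8 * \<alpha> ^ 4 * C * T\<^sup>2) * (t - s)\<^sup>2"
      using C(1) by (intro mult_right_mono mult_left_mono) auto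
    then have "8 * \<alpha> ^ 4 * C * (t - s)\<^sup>2 * (t - s)\<^sup>2 + 24 * \<sigma> ^ 4 * (t - s)\<^sup>2
        \<le> (8 * \<alpha> ^ 4 * C * T\<^sup>2 + 24 * \<sigma> ^ 4) * (t - s)\<^sup>2"
      unfolding distrib_right by (rule add_right_mono)
    moreover have "(t - s) ^ 4 = (t - s)\<^sup>2 * (t - s)\<^sup>2" by (simp add: eval_nat_numeral)
    ultimately show "8 * \<alpha> ^ 4 * (C * (t - s) ^ 4) + 8 * \<sigma> ^ 4 * (3 * (t - s)\<^sup>2)
        \<le> (8 * \<alpha> ^ 4 * C * T\<^sup>2 + 24 * \<sigma> ^ 4) * (t - s)\<^sup>2"
      by (simp only: mult.assoc)
  qed
  finally show ?thesis .
qed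

end

section \<open>Ito's formula\<close>

text \<open>Two applications of the mean value inequality replace the usual Lagrange remainder; the
  missing factor \<open>1 / 2\<close> on the right is irrelevant.\<close>

lemma taylor2_remainder_le:
  fixes f f' G :: "real \<Rightarrow> real"
  assumes G: "\<And>y. (G has_real_derivative f y) (at y)" and f: "\<And>y. (f has_real_derivative f' y) (at y)"
    and e: "\<And>y. y \<in> closed_segment a b \<Longrightarrow> \<bar>f' y - f' a\<bar> \<le> e"
  shows "\<bar>G b - G a - f a * (b - a) - f' a * (b - a)\<^sup>2 / 2\<bar> \<le> e * (b - a)\<^sup>2"
proof -
  have dist: "\<bar>u - a\<bar> \<le> \<bar>b - a\<bar>" if "u \<in> closed_segment a b" for u
    using segment_bound(1)[OF that] by (simp add: norm_minus_commute)
  have 1: "\<bar>f u - f a - f' a * (u - a)\<bar> \<le> e * \<bar>b - a\<bar>" if u: "u \<in> closed_segment a b" for u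
  proof -
    have "norm ((f u - f' a * u) - (f a - f' a * a)) \<le> e * norm (u - a)"
    proof (rule field_differentiable_bound[where S = "closed_segment a b" and f' = "\<lambda>y. f' y - f' a"])
      show "((\<lambda>y. f y - f' a * y) has_real_derivative f' y - f' a) (at y within closed_segment a b)" for y
        by (rule DERIV_subset[of _ _ _ UNIV]) (auto intro!: derivative_eq_intros f)
    qed (use e u in auto)
    also have "\<dots> \<le> e * \<bar>b - a\<bar>"
      using dist[OF u] e[of a] by (intro mult_left_mono) auto
    finally show ?thesis by (simp add: algebra_simps)
  qed
  let ?h = "\<lambda>u. G u - f a * u - f' a * (u - a)\<^sup>2 / 2"
  have "norm (?h b - ?h a) \<le> (e * \<bar>b - a\<bar>) * norm (b - a)"
  proof (rule field_differentiable_bound[where S = "closed_segment a b" and f' = "\<lambda>y. f y - f a - f' a * (y - a)"])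
    show "(?h has_real_derivative f y - f a - f' a * (y - a)) (at y within closed_segment a b)" for y
      by (rule DERIV_subset[of _ _ _ UNIV]) (auto intro!: derivative_eq_intros G simp: field_simps)
  qed (use 1 in auto)
  also have "\<dots> = e * (b - a)\<^sup>2" by (simp add: power2_eq_square mult.assoc)
  finally show ?thesis by (simp add: algebra_simps)
qed

lemma linear_growth:
  fixes f f' :: "real \<Rightarrow> real"
  assumes f: "\<And>y. (f has_real_derivative f' y) (at y)" and "\<And>y. \<bar>f' y\<bar> \<le> K"
  shows "\<bar>f y\<bar> \<le> \<bar>f 0\<bar> + K * \<bar>y\<bar>" and "\<bar>f u - f v\<bar> \<le> K * \<bar>u - v\<bar>"
proof -
  show lip: "\<bar>f u - f v\<bar> \<le> K * \<bar>u - v\<bar>" for u v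
    using field_differentiable_bound[of UNIV f f' K u v] assms by auto
  show "\<bar>f y\<bar> \<le> \<bar>f 0\<bar> + K * \<bar>y\<bar>" using lip[of y 0] by simp
qed

context ou_process
begin

section \<open>Equidistant partitions of a fixed horizon\<close>

context
  fixes C T :: real
  assumes C: "0 \<le> C" "\<And>t. 0 \<le> t \<Longrightarrow> fourth (x t) \<le> ennreal C" and T: "0 < T"
begin

text \<open>The number of cells is \<open>Suc n\<close>, hence never 0.\<close>

definition mesh :: "nat \<Rightarrow> real" where "mesh n = T / real (Suc n)"

definition node :: "nat \<Rightarrow> nat \<Rightarrow> real" where "node n i = real i * mesh n"

lemma mesh: "0 < mesh n" "mesh n \<le> T" "real (Suc n) * mesh n = T"
proof -
  show "0 < mesh n" "real (Suc n) * mesh n = T" using T by (auto simp: mesh_def)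
  show "mesh n \<le> T" using T by (simp add: mesh_def divide_le_eq mult_left_le)
qed

lemma mesh_tendsto: "mesh \<longlonglongrightarrow> 0"
  using tendsto_mult[OF tendsto_const LIMSEQ_inverse_real_of_nat, of T]
  by (simp add: mesh_def[abs_def] divide_inverse)

lemma node: "0 \<le> node n i" "node n i \<le> node n (Suc i)" "node n (Suc i) - node n i = mesh n"
  "node n 0 = 0" "node n (Suc n) = T"
  using mesh(1)[of n] mesh(3)[of n] by (auto simp: node_def algebra_simps)

lemma node_mono: "i \<le> j \<Longrightarrow> node n i \<le> node n j"
  using mesh(1)[of n] by (simp add: node_def mult_right_mono)

lemma node_le: "i \<le> Suc n \<Longrightarrow> node n i \<le> T"
  using node_mono[of i "Suc n" n] node(5)[of n] by simp

lemma integral_node: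
  assumes "continuous_on {0..T} g"
  shows "integral {0..T} g = (\<Sum>i<Suc n. integral {node n i..node n (Suc i)} (g :: real \<Rightarrow> real))"
  using integral_grid[of "mesh n" 0 "Suc n" g] assms mesh[of n] by (simp add: node_def del: sum.lessThan_Suc)

text \<open>Bounds of the order of \<open>mesh n ^ 3\<close> for the mean squares of the \<open>n + 1\<close> summands suffice,
  even without orthogonality.\<close>

lemma msq_null_node_sum:
  assumes "\<And>n i. i < Suc n \<Longrightarrow> Y n i \<in> borel_measurable M" and "0 \<le> c"
    and "\<And>n i. i < Suc n \<Longrightarrow> msq M (Y n i) \<le> ennreal (c * mesh n ^ 3)"
  shows "msq_null M (\<lambda>n \<omega>. \<Sum>i<Suc n. Y n i \<omega>)"
proof (rule msq_null_bound)
  show "(\<lambda>\<omega>. \<Sum>i<Suc n. Y n i \<omega>) \<in> borel_measurable M" for n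
    using assms(1) by (intro borel_measurable_sum) auto
  have "msq M (\<lambda>\<omega>. \<Sum>i<Suc n. Y n i \<omega>) \<le> ennreal ((real (Suc n))\<^sup>2 * (c * mesh n ^ 3))" for n
    using assms mesh(1)[of n] by (intro msq_sum_le) auto
  moreover have "(real (Suc n))\<^sup>2 * (c * mesh n ^ 3) = c * T\<^sup>2 * mesh n" for n
  proof -
    have "(real (Suc n))\<^sup>2 * (c * mesh n ^ 3) = c * (real (Suc n) * mesh n)\<^sup>2 * mesh n"
      by (simp only: power2_eq_square power3_eq_cube mult_ac)
    then show ?thesis by (simp only: mesh(3))
  qed
  ultimately show "msq M (\<lambda>\<omega>. \<Sum>i<Suc n. Y n i \<omega>) \<le> ennreal (c * T\<^sup>2 * mesh n)" for n by metis
  show "(\<lambda>n. c * T\<^sup>2 * mesh n) \<longlonglongrightarrow> 0"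
    using tendsto_mult[OF tendsto_const mesh_tendsto, of "c * T\<^sup>2"] by simp
qed

abbreviation dx :: "nat \<Rightarrow> nat \<Rightarrow> 'a \<Rightarrow> real" where
  "dx n i \<omega> \<equiv> x (node n (Suc i)) \<omega> - x (node n i) \<omega>"

abbreviation dz :: "nat \<Rightarrow> nat \<Rightarrow> 'a \<Rightarrow> real" where
  "dz n i \<omega> \<equiv> z (node n (Suc i)) \<omega> - z (node n i) \<omega>"

abbreviation drift :: "nat \<Rightarrow> nat \<Rightarrow> 'a \<Rightarrow> real" where
  "drift n i \<omega> \<equiv> integral {node n i..node n (Suc i)} (\<lambda>r. x r \<omega>)"

lemma node_measurable [measurable]:
  "x (node n i) \<in> borel_measurable M" "z (node n i) \<in> borel_measurable M"
  using node(1) by auto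

lemma drift_measurable [measurable]: "drift n i \<in> borel_measurable M"
proof (rule borel_measurable_path_integral)
  show "x r \<in> borel_measurable M" if "r \<in> {node n i..node n (Suc i)}" for r
    using that node(1)[of n i] by auto
qed (use node x_continuous_Icc in auto)

text \<open>The summands have mean squares of order \<open>mesh n ^ 2\<close>, too large for
  \<open>msq_null_node_sum\<close>, so orthogonality is essential. The partial sums form a
  martingale, and their second moments add up to the order of \<open>mesh n\<close>.\<close>

lemma msq_null_quadratic_variation_z:
  assumes [measurable]: "\<phi> \<in> borel_measurable borel" and \<phi>: "\<And>y. \<bar>\<phi> y\<bar> \<le> B"
  shows "msq_null M (\<lambda>n \<omega>. \<Sum>i<Suc n. \<phi> (x (node n i) \<omega>) * ((dz n i \<omega>)\<^sup>2 - mesh n))"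
proof (rule msq_null_bound)
  let ?S = "\<lambda>n k \<omega>. \<Sum>i<k. \<phi> (x (node n i) \<omega>) * ((dz n i \<omega>)\<^sup>2 - mesh n)"
  have \<phi>2: "(\<phi> y)\<^sup>2 \<le> B\<^sup>2" for y using \<phi>[of y] by (metis abs_ge_zero power2_abs power_mono)
  have S: "?S n k \<in> borel_measurable (F (node n k)) \<and> integrable M (\<lambda>\<omega>. (?S n k \<omega>)\<^sup>2)
    \<and> (\<integral>\<omega>. (?S n k \<omega>)\<^sup>2 \<partial>M) \<le> real k * (2 * B\<^sup>2 * (mesh n)\<^sup>2)" for n k
  proof (induction k)
    case (Suc k)
    let ?s = "node n k" and ?t = "node n (Suc k)" and ?d = "mesh n"
    let ?p = "\<lambda>\<omega>. \<phi> (x ?s \<omega>)" and ?Y = "\<lambda>\<omega>. (dz n k \<omega>)\<^sup>2 - ?d"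
    note st = node(1)[of n k] node(2)[of n k]
    have xs: "x ?s \<in> borel_measurable (F ?s)" by (rule x_F[OF st(1)])
    have p: "?p \<in> borel_measurable (F ?s)" by (rule measurable_compose[OF xs]) simp
    have p2: "integrable M (\<lambda>\<omega>. (?p \<omega>)\<^sup>2)"
      using \<phi>2 by (intro integrable_const_bound[of _ "B\<^sup>2"]) auto
    have S1: "?S n k \<in> borel_measurable (F ?s)" "integrable M (\<lambda>\<omega>. (?S n k \<omega>)\<^sup>2)"
      using Suc by auto
    have Sp: "integrable M (\<lambda>\<omega>. ?S n k \<omega> * ?p \<omega>)"
      by (rule integrable_mult_of_squares[OF F_measurable[OF S1(1)] F_measurable[OF p] S1(2) p2])
    \<comment> \<open>With \<open>d\<close> the mesh, the second moment is
      \<open>3 * d\<^sup>2 - 2 * d\<^sup>2 + d\<^sup>2\<close>.\<close>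
    have Y_int: "integrable M ?Y" "integrable M (\<lambda>\<omega>. (?Y \<omega>)\<^sup>2)"
      and Y_exp: "(\<integral>\<omega>. ?Y \<omega> \<partial>M) = 0" "(\<integral>\<omega>. (?Y \<omega>)\<^sup>2 \<partial>M) = 2 * ?d\<^sup>2"
    proof -
      note m = increment_moments[OF st, unfolded node(3)]
      have eq: "(\<lambda>\<omega>. (?Y \<omega>)\<^sup>2) = (\<lambda>\<omega>. (dz n k \<omega>) ^ 4 - (2 * ?d) * (dz n k \<omega>)\<^sup>2 + ?d\<^sup>2)"
        by (auto simp: power2_eq_square algebra_simps eval_nat_numeral)
      show "integrable M ?Y" "integrable M (\<lambda>\<omega>. (?Y \<omega>)\<^sup>2)"
        unfolding eq using m(1)[of 2] m(1)[of 4] by auto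
      show "(\<integral>\<omega>. ?Y \<omega> \<partial>M) = 0" using m(1)[of 2] m(3) by (simp add: prob_space)
      show "(\<integral>\<omega>. (?Y \<omega>)\<^sup>2 \<partial>M) = 2 * ?d\<^sup>2"
        unfolding eq using m(1)[of 2] m(1)[of 4] m(3,4) by (simp add: prob_space power2_eq_square)
    qed
    \<comment> \<open>The cross term vanishes: the past sum and the weight are known at the left
      node, and the compensated square is centred and independent of them.\<close>
    have I1: "integrable M (\<lambda>\<omega>. ?S n k \<omega> * ?p \<omega> * ?Y \<omega>)" "(\<integral>\<omega>. ?S n k \<omega> * ?p \<omega> * ?Y \<omega> \<partial>M) = 0"
      using integral_mult_increment[OF st borel_measurable_times[OF S1(1) p] Sp, of "\<lambda>y. y\<^sup>2 - ?d"] Y_int Y_exp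
      by auto
    have I2: "integrable M (\<lambda>\<omega>. (?p \<omega>)\<^sup>2 * (?Y \<omega>)\<^sup>2)"
      "(\<integral>\<omega>. (?p \<omega>)\<^sup>2 * (?Y \<omega>)\<^sup>2 \<partial>M) = (\<integral>\<omega>. (?p \<omega>)\<^sup>2 \<partial>M) * (2 * ?d\<^sup>2)"
      using integral_mult_increment[OF st borel_measurable_power[OF p] p2, of "\<lambda>y. (y\<^sup>2 - ?d)\<^sup>2"] Y_int Y_exp
      by auto
    have eq: "(\<lambda>\<omega>. (?S n (Suc k) \<omega>)\<^sup>2)
      = (\<lambda>\<omega>. (?S n k \<omega>)\<^sup>2 + (2 * (?S n k \<omega> * ?p \<omega> * ?Y \<omega>) + (?p \<omega>)\<^sup>2 * (?Y \<omega>)\<^sup>2))"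
      by (auto simp: power2_sum power_mult_distrib mult.assoc)
    have "(\<integral>\<omega>. (?p \<omega>)\<^sup>2 \<partial>M) \<le> (\<integral>\<omega>. B\<^sup>2 \<partial>M)"
      using p2 \<phi>2 by (intro Bochner_Integration.integral_mono) auto
    then have "(\<integral>\<omega>. (?p \<omega>)\<^sup>2 \<partial>M) * (2 * ?d\<^sup>2) \<le> B\<^sup>2 * (2 * ?d\<^sup>2)"
      by (intro mult_right_mono) (auto simp: prob_space)
    moreover have "(\<integral>\<omega>. (?S n (Suc k) \<omega>)\<^sup>2 \<partial>M)
        = (\<integral>\<omega>. (?S n k \<omega>)\<^sup>2 \<partial>M) + (\<integral>\<omega>. (?p \<omega>)\<^sup>2 \<partial>M) * (2 * ?d\<^sup>2)"
      unfolding eq using I1 I2 S1(2) by simp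
    moreover have "(\<integral>\<omega>. (?S n k \<omega>)\<^sup>2 \<partial>M) \<le> real k * (2 * B\<^sup>2 * ?d\<^sup>2)"
      using Suc by blast
    moreover have "real (Suc k) * (2 * B\<^sup>2 * ?d\<^sup>2) = real k * (2 * B\<^sup>2 * ?d\<^sup>2) + B\<^sup>2 * (2 * ?d\<^sup>2)"
      by (simp add: algebra_simps)
    ultimately have "(\<integral>\<omega>. (?S n (Suc k) \<omega>)\<^sup>2 \<partial>M) \<le> real (Suc k) * (2 * B\<^sup>2 * ?d\<^sup>2)"
      by linarith
    moreover have "integrable M (\<lambda>\<omega>. (?S n (Suc k) \<omega>)\<^sup>2)"
      unfolding eq using I1 I2 S1 by (intro Bochner_Integration.integrable_add integrable_mult_right)
    moreover have "?S n (Suc k) \<in> borel_measurable (F ?t)"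
      using F_measurable_mono[OF st(2) S1(1)] F_measurable_mono[OF st(2) p] increment_F[OF st]
      by (simp add: borel_measurable_add borel_measurable_times borel_measurable_diff borel_measurable_power)
    ultimately show ?case by blast
  qed simp
  show "?S n (Suc n) \<in> borel_measurable M" for n by (rule F_measurable) (use S in blast)
  show "msq M (?S n (Suc n)) \<le> ennreal (2 * B\<^sup>2 * T * mesh n)" for n
  proof -
    have "real (Suc n) * (2 * B\<^sup>2 * (mesh n)\<^sup>2) = 2 * B\<^sup>2 * (real (Suc n) * mesh n) * mesh n"
      by (simp only: power2_eq_square mult_ac)
    then have eq: "real (Suc n) * (2 * B\<^sup>2 * (mesh n)\<^sup>2) = 2 * B\<^sup>2 * T * mesh n" by (simp only: mesh(3))
    have "(\<integral>\<omega>. (?S n (Suc n) \<omega>)\<^sup>2 \<partial>M) \<le> 2 * B\<^sup>2 * T * mesh n"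
      using S[of n "Suc n"] unfolding eq by blast
    moreover have "msq M (?S n (Suc n)) = ennreal (\<integral>\<omega>. (?S n (Suc n) \<omega>)\<^sup>2 \<partial>M)"
      by (rule msq_eq_integral) (use S[of n "Suc n"] in blast)
    ultimately show ?thesis by (simp only: ennreal_leI)
  qed
  show "(\<lambda>n. 2 * B\<^sup>2 * T * mesh n) \<longlonglongrightarrow> 0"
    using tendsto_mult[OF tendsto_const mesh_tendsto, of "2 * B\<^sup>2 * T"] by simp
qed

text \<open>Apart from the martingale part treated before, a squared increment of \<open>x\<close>
  contains noise times drift and drift squared, collected in \<open>?R\<close>. Their mean squares
  are of order \<open>mesh n ^ 3\<close>, so the crude summation is enough.\<close>

lemma msq_null_quadratic_variation:
  assumes [measurable]: "\<phi> \<in> borel_measurable borel" and \<phi>: "\<And>y. \<bar>\<phi> y\<bar> \<le> B"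
  shows "msq_null M (\<lambda>n \<omega>. \<Sum>i<Suc n. \<phi> (x (node n i) \<omega>) * ((dx n i \<omega>)\<^sup>2 - \<sigma>\<^sup>2 * mesh n))"
proof -
  \<comment> \<open>Collects the estimate below: 12 is 4 times the normal fourth moment 3, and
    \<open>mesh n\<close> in the last term is replaced by its bound \<open>T\<close>.\<close>
  define c where "c = 12 * \<sigma>\<^sup>2 * \<alpha>\<^sup>2 + (4 * \<sigma>\<^sup>2 * \<alpha>\<^sup>2 + 2 * \<alpha> ^ 4 * T) * C"
  have c: "0 \<le> c" using C(1) T by (simp add: c_def)
  let ?R = "\<lambda>n i \<omega>. - 2 * \<sigma> * \<alpha> * (dz n i \<omega>) * (drift n i \<omega>) + \<alpha>\<^sup>2 * (drift n i \<omega>)\<^sup>2"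
  have R: "msq M (?R n i) \<le> ennreal (c * mesh n ^ 3)" for n i
  proof -
    let ?d = "mesh n"
    have d: "0 < ?d" by (rule mesh)
    let ?c1 = "4 * \<sigma>\<^sup>2 * \<alpha>\<^sup>2 * ?d" and ?c2 = "4 * \<sigma>\<^sup>2 * \<alpha>\<^sup>2 / ?d + 2 * \<alpha> ^ 4"
    have "msq M (?R n i) \<le> ennreal ?c1 * fourth (dz n i) + ennreal ?c2 * fourth (drift n i)"
      unfolding msq_def
    proof (rule nn_integral_fourth_le)
      show "AE \<omega> in M. (?R n i \<omega>)\<^sup>2 \<le> ?c1 * (dz n i \<omega>) ^ 4 + ?c2 * (drift n i \<omega>) ^ 4"
      proof (rule AE_I2)
        fix \<omega>
        define u v where "u = dz n i \<omega>" and "v = drift n i \<omega>"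
        \<comment> \<open>The fourth moments of \<open>u\<close> and \<open>v\<close> are of order
          \<open>d ^ 2\<close> and \<open>d ^ 4\<close>; with weight \<open>d\<close> both terms
          become of order \<open>d ^ 3\<close>.\<close>
        have uv: "2 * (u\<^sup>2 * v\<^sup>2) \<le> ?d * u ^ 4 + v ^ 4 / ?d"
          using young[OF d, of "u\<^sup>2" "v\<^sup>2"] by simp
        have "(- 2 * \<sigma> * \<alpha> * u * v + \<alpha>\<^sup>2 * v\<^sup>2)\<^sup>2 \<le> 2 * (- 2 * \<sigma> * \<alpha> * u * v)\<^sup>2 + 2 * (\<alpha>\<^sup>2 * v\<^sup>2)\<^sup>2"
          using power2_add_le[of 1 "- 2 * \<sigma> * \<alpha> * u * v" "\<alpha>\<^sup>2 * v\<^sup>2"] by simp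
        also have "\<dots> = 4 * \<sigma>\<^sup>2 * \<alpha>\<^sup>2 * (2 * (u\<^sup>2 * v\<^sup>2)) + 2 * \<alpha> ^ 4 * v ^ 4"
          by (simp add: power_mult_distrib)
        also have "\<dots> \<le> 4 * \<sigma>\<^sup>2 * \<alpha>\<^sup>2 * (?d * u ^ 4 + v ^ 4 / ?d) + 2 * \<alpha> ^ 4 * v ^ 4"
          by (intro add_right_mono mult_left_mono uv) auto
        also have "\<dots> = ?c1 * u ^ 4 + ?c2 * v ^ 4" by (simp add: algebra_simps)
        finally show "(?R n i \<omega>)\<^sup>2 \<le> ?c1 * (dz n i \<omega>) ^ 4 + ?c2 * (drift n i \<omega>) ^ 4"
          by (simp only: u_def v_def)
      qed
    qed (use d in auto)
    also have "\<dots> \<le> ennreal ?c1 * ennreal (3 * ?d\<^sup>2) + ennreal ?c2 * ennreal (C * ?d ^ 4)"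
      using fourth_increment[OF node(1,2)[of n i]] fourth_path_integral[OF C node(1,2)[of n i]]
      by (intro add_mono mult_left_mono) (auto simp: node(3))
    also have "\<dots> = ennreal (?c1 * (3 * ?d\<^sup>2) + ?c2 * (C * ?d ^ 4))"
      using d C(1) by (intro ennreal_lincomb) auto
    also have "\<dots> \<le> ennreal (c * ?d ^ 3)"
    proof (rule ennreal_leI)
      have "?c1 * (3 * ?d\<^sup>2) + ?c2 * (C * ?d ^ 4) = (12 * \<sigma>\<^sup>2 * \<alpha>\<^sup>2 + (4 * \<sigma>\<^sup>2 * \<alpha>\<^sup>2 + 2 * \<alpha> ^ 4 * ?d) * C) * ?d ^ 3"
        using d by (simp add: field_simps eval_nat_numeral)
      also have "\<dots> \<le> c * ?d ^ 3"
        unfolding c_def using mesh(2)[of n] C(1) d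
        by (intro mult_right_mono add_left_mono mult_left_mono) auto
      finally show "?c1 * (3 * ?d\<^sup>2) + ?c2 * (C * ?d ^ 4) \<le> c * ?d ^ 3" .
    qed
    finally show ?thesis .
  qed
  have 2: "msq_null M (\<lambda>n \<omega>. \<Sum>i<Suc n. \<phi> (x (node n i) \<omega>) * ?R n i \<omega>)"
  proof (rule msq_null_node_sum)
    show "msq M (\<lambda>\<omega>. \<phi> (x (node n i) \<omega>) * ?R n i \<omega>) \<le> ennreal (B\<^sup>2 * c * mesh n ^ 3)" for n i
    proof -
      have "msq M (\<lambda>\<omega>. \<phi> (x (node n i) \<omega>) * ?R n i \<omega>) \<le> msq M (\<lambda>\<omega>. B * ?R n i \<omega>)"
      proof (intro msq_mono_AE AE_I2)
        fix \<omega>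
        have "\<bar>\<phi> (x (node n i) \<omega>)\<bar> \<le> \<bar>B\<bar>" using \<phi>[of "x (node n i) \<omega>"] by simp
        then show "\<bar>\<phi> (x (node n i) \<omega>) * ?R n i \<omega>\<bar> \<le> \<bar>B * ?R n i \<omega>\<bar>"
          unfolding abs_mult by (rule mult_right_mono) simp
      qed
      also have "\<dots> = ennreal (B\<^sup>2) * msq M (?R n i)" by (rule msq_cmult) measurable
      also have "\<dots> \<le> ennreal (B\<^sup>2) * ennreal (c * mesh n ^ 3)" by (intro mult_left_mono R) auto
      also have "\<dots> = ennreal (B\<^sup>2 * c * mesh n ^ 3)"
        using c mesh(1)[of n] by (simp add: ennreal_mult[symmetric] mult.assoc)
      finally show ?thesis .
    qed
  qed (use c in auto)
  show ?thesis
  proof (rule msq_null_dominated)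
    show "msq_null M (\<lambda>n \<omega>. \<sigma>\<^sup>2 * (\<Sum>i<Suc n. \<phi> (x (node n i) \<omega>) * ((dz n i \<omega>)\<^sup>2 - mesh n))
        + (\<Sum>i<Suc n. \<phi> (x (node n i) \<omega>) * ?R n i \<omega>))"
      by (intro msq_null_add msq_null_cmult msq_null_quadratic_variation_z[OF assms] 2)
    show "(\<lambda>\<omega>. \<Sum>i<Suc n. \<phi> (x (node n i) \<omega>) * ((dx n i \<omega>)\<^sup>2 - \<sigma>\<^sup>2 * mesh n)) \<in> borel_measurable M" for n
      by measurable
    show "AE \<omega> in M. \<bar>\<Sum>i<Suc n. \<phi> (x (node n i) \<omega>) * ((dx n i \<omega>)\<^sup>2 - \<sigma>\<^sup>2 * mesh n)\<bar>
      \<le> \<bar>\<sigma>\<^sup>2 * (\<Sum>i<Suc n. \<phi> (x (node n i) \<omega>) * ((dz n i \<omega>)\<^sup>2 - mesh n))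
        + (\<Sum>i<Suc n. \<phi> (x (node n i) \<omega>) * ?R n i \<omega>)\<bar>" for n
      using AE_ou_path
    proof eventually_elim
      case (elim \<omega>)
      have "\<phi> (x (node n i) \<omega>) * ((dx n i \<omega>)\<^sup>2 - \<sigma>\<^sup>2 * mesh n)
        = \<sigma>\<^sup>2 * (\<phi> (x (node n i) \<omega>) * ((dz n i \<omega>)\<^sup>2 - mesh n)) + \<phi> (x (node n i) \<omega>) * ?R n i \<omega>" for i
        unfolding ou_path_increment[OF elim node(1,2)]
        by (simp add: power2_eq_square algebra_simps)
      then show ?case
        by (simp only: sum.distrib sum_distrib_left)
    qed
  qed
qed

section \<open>Error terms of the discretised Ito formula\<close>

context
  fixes f f' G :: "real \<Rightarrow> real" and K :: real
  assumes G: "\<And>y. (G has_real_derivative f y) (at y)"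
    and f: "\<And>y. (f has_real_derivative f' y) (at y)"
    and f': "continuous_on UNIV f'" and K: "\<And>y. \<bar>f' y\<bar> \<le> K"
begin

lemma f_continuous: "continuous_on A f"
  by (rule DERIV_imp_continuous_on[OF f])

lemma f_measurable [measurable]: "f \<in> borel_measurable borel"
  by (rule borel_measurable_continuous_onI[OF f_continuous])

lemma G_measurable [measurable]: "G \<in> borel_measurable borel"
  by (rule borel_measurable_continuous_onI[OF DERIV_imp_continuous_on[OF G]])

lemma f'_measurable [measurable]: "f' \<in> borel_measurable borel"
  by (rule borel_measurable_continuous_onI[OF f'])

text \<open>The error of freezing \<open>f\<close> at the left node inside the drift integral.
  Cauchy-Schwarz in time gives two factors \<open>mesh n\<close>, and the Lipschitz bound on
  \<open>f\<close> supplies the third.\<close>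

lemma msq_null_drift:
  "msq_null M (\<lambda>n \<omega>. \<Sum>i<Suc n.
     integral {node n i..node n (Suc i)} (\<lambda>s. (f (x s \<omega>) - f (x (node n i) \<omega>)) * x s \<omega>))"
proof (rule msq_null_node_sum)
  define C' where "C' = 8 * \<alpha> ^ 4 * C * T\<^sup>2 + 24 * \<sigma> ^ 4"
  have C': "0 \<le> C'" using C(1) by (simp add: C'_def)
  define c where "c = K\<^sup>2 / 2 * (C' + C)"
  show c: "0 \<le> c" using C(1) C' by (simp add: c_def)
  fix n i assume i: "i < Suc n"
  let ?s = "node n i" and ?t = "node n (Suc i)" and ?d = "mesh n"
  let ?g = "\<lambda>r \<omega>. (f (x r \<omega>) - f (x ?s \<omega>)) * x r \<omega>"
  have d: "0 < ?d" by (rule mesh)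
  have xr[measurable]: "x r \<in> borel_measurable M" if "r \<in> {?s..?t}" for r
    using that node(1)[of n i] by auto
  have g: "?g r \<in> borel_measurable M" if [measurable]: "r \<in> {?s..?t}" for r
    by measurable
  have cont: "continuous_on {?s..?t} (\<lambda>r. ?g r \<omega>)" if "\<omega> \<in> space M" for \<omega>
    by (intro continuous_intros compose_continuous f_continuous x_continuous_Icc that node)
  show "(\<lambda>\<omega>. integral {?s..?t} (\<lambda>r. ?g r \<omega>)) \<in> borel_measurable M"
    by (intro borel_measurable_path_integral node g cont)
  have "msq M (\<lambda>\<omega>. integral {?s..?t} (\<lambda>r. ?g r \<omega>))
      \<le> (\<integral>\<^sup>+\<omega>. ennreal ?d * ennreal (integral {?s..?t} (\<lambda>r. (?g r \<omega>)\<^sup>2)) \<partial>M)"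
    unfolding msq_def
  proof (rule nn_integral_mono)
    fix \<omega> assume \<omega>: "\<omega> \<in> space M"
    have "0 \<le> integral {?s..?t} (\<lambda>r. (?g r \<omega>)\<^sup>2)"
      by (intro integral_nonneg integrable_continuous_real continuous_on_power cont \<omega>) auto
    then show "ennreal ((integral {?s..?t} (\<lambda>r. ?g r \<omega>))\<^sup>2)
        \<le> ennreal ?d * ennreal (integral {?s..?t} (\<lambda>r. (?g r \<omega>)\<^sup>2))"
      using ennreal_leI[OF integral_power2_le[OF node(2) cont[OF \<omega>]]] d
      by (simp add: node(3) ennreal_mult)
  qed
  also have "\<dots> = ennreal ?d * (\<integral>\<^sup>+\<omega>. ennreal (integral {?s..?t} (\<lambda>r. (?g r \<omega>)\<^sup>2)) \<partial>M)"
    by (intro nn_integral_cmult measurable_compose_rev[OF measurable_ennreal]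
      borel_measurable_path_integral borel_measurable_power continuous_on_power node g cont)
  also have "\<dots> \<le> ennreal ?d * ennreal ((?t - ?s) * (c * ?d))"
  proof (intro mult_left_mono nn_integral_path_integral_le node borel_measurable_power continuous_on_power g cont)
    fix r assume r: "r \<in> {?s..?t}"
    have sr: "0 \<le> ?s" "?s \<le> r" "r \<le> T" using r node(1) node_le[of "Suc i" n] i by auto
    have "(\<integral>\<^sup>+\<omega>. ennreal ((?g r \<omega>)\<^sup>2) \<partial>M)
      \<le> ennreal (K\<^sup>2 / (2 * ?d)) * fourth (\<lambda>\<omega>. x r \<omega> - x ?s \<omega>) + ennreal (K\<^sup>2 * ?d / 2) * fourth (x r)"
    proof (rule nn_integral_fourth_le)
      show "AE \<omega> in M. (?g r \<omega>)\<^sup>2 \<le> K\<^sup>2 / (2 * ?d) * (x r \<omega> - x ?s \<omega>) ^ 4 + K\<^sup>2 * ?d / 2 * (x r \<omega>) ^ 4"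
      proof (rule AE_I2)
        fix \<omega>
        define u v where "u = x r \<omega> - x ?s \<omega>" and "v = x r \<omega>"
        \<comment> \<open>Here \<open>u\<close> is an increment with fourth moment of order
          \<open>d ^ 2\<close> while that of \<open>v\<close> is only bounded, so this weight makes
          both terms of order \<open>d\<close>.\<close>
        have uv: "u\<^sup>2 * v\<^sup>2 \<le> u ^ 4 / (2 * ?d) + ?d / 2 * v ^ 4"
          using young[OF d, of "v\<^sup>2" "u\<^sup>2"] by (simp add: add_divide_distrib mult.commute)
        have "\<bar>f (x r \<omega>) - f (x ?s \<omega>)\<bar> \<le> K * \<bar>u\<bar>"
          unfolding u_def by (rule linear_growth(2)[OF f K])
        then have "(f (x r \<omega>) - f (x ?s \<omega>))\<^sup>2 \<le> (K * \<bar>u\<bar>)\<^sup>2"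
          by (metis abs_ge_zero power2_abs power_mono)
        then have "(?g r \<omega>)\<^sup>2 \<le> (K * \<bar>u\<bar>)\<^sup>2 * v\<^sup>2"
          unfolding power_mult_distrib[of "f (x r \<omega>) - f (x ?s \<omega>)"] v_def by (rule mult_right_mono) simp
        also have "\<dots> = K\<^sup>2 * (u\<^sup>2 * v\<^sup>2)" by (simp add: power_mult_distrib)
        also have "\<dots> \<le> K\<^sup>2 * (u ^ 4 / (2 * ?d) + ?d / 2 * v ^ 4)" by (intro mult_left_mono uv) auto
        also have "\<dots> = K\<^sup>2 / (2 * ?d) * u ^ 4 + K\<^sup>2 * ?d / 2 * v ^ 4" by (simp add: algebra_simps)
        finally show "(?g r \<omega>)\<^sup>2 \<le> K\<^sup>2 / (2 * ?d) * (x r \<omega> - x ?s \<omega>) ^ 4 + K\<^sup>2 * ?d / 2 * (x r \<omega>) ^ 4"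
          by (simp only: u_def v_def)
      qed
      have [measurable]: "x r \<in> borel_measurable M" by (rule xr[OF r])
      show "x r \<in> borel_measurable M" "(\<lambda>\<omega>. x r \<omega> - x ?s \<omega>) \<in> borel_measurable M"
        by measurable
    qed (use d in auto)
    also have "\<dots> \<le> ennreal (K\<^sup>2 / (2 * ?d)) * ennreal (C' * ?d\<^sup>2) + ennreal (K\<^sup>2 * ?d / 2) * ennreal C"
    proof (intro add_mono mult_left_mono)
      have "(r - ?s)\<^sup>2 \<le> ?d\<^sup>2" using r node(3)[of n i] by (intro power_mono) auto
      then have "C' * (r - ?s)\<^sup>2 \<le> C' * ?d\<^sup>2" using C' by (rule mult_left_mono)
      then show "fourth (\<lambda>\<omega>. x r \<omega> - x ?s \<omega>) \<le> ennreal (C' * ?d\<^sup>2)"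
        using fourth_x_increment[OF C sr] by (auto simp: C'_def intro: order_trans ennreal_leI)
      show "fourth (x r) \<le> ennreal C" using C(2) sr by simp
    qed auto
    also have "\<dots> = ennreal (K\<^sup>2 / (2 * ?d) * (C' * ?d\<^sup>2) + K\<^sup>2 * ?d / 2 * C)"
      using d C(1) C' by (intro ennreal_lincomb) auto
    also have "K\<^sup>2 / (2 * ?d) * (C' * ?d\<^sup>2) + K\<^sup>2 * ?d / 2 * C = c * ?d"
      using d by (simp add: c_def field_simps power2_eq_square)
    finally show "(\<integral>\<^sup>+\<omega>. ennreal ((?g r \<omega>)\<^sup>2) \<partial>M) \<le> ennreal (c * ?d)" .
  qed (use c d in auto)
  also have "\<dots> = ennreal (c * ?d ^ 3)"
    using c d by (simp add: node(3) ennreal_mult[symmetric] power3_eq_cube mult_ac)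
  finally show "msq M (\<lambda>\<omega>. integral {?s..?t} (\<lambda>r. ?g r \<omega>)) \<le> ennreal (c * ?d ^ 3)" .
qed

lemma path_integral_f'_measurable [measurable]:
  "(\<lambda>\<omega>. integral {0..T} (\<lambda>s. f' (x s \<omega>))) \<in> borel_measurable M"
  using T by (intro borel_measurable_path_integral compose_continuous f') auto

text \<open>Continuity of \<open>f'\<close> gives no rate for the Riemann sums, but the bound
  \<open>K\<close> permits bounded convergence.\<close>

lemma msq_null_riemann:
  "msq_null M (\<lambda>n \<omega>. (\<Sum>i<Suc n. f' (x (node n i) \<omega>) * mesh n) - integral {0..T} (\<lambda>s. f' (x s \<omega>)))"
proof (rule msq_null_bounded_convergence)
  show "finite_measure M" by unfold_locales
  show "AE \<omega> in M. \<bar>(\<Sum>i<Suc n. f' (x (node n i) \<omega>) * mesh n) - integral {0..T} (\<lambda>s. f' (x s \<omega>))\<bar> \<le> 2 * (K * T)" for n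
  proof (rule AE_I2)
    fix \<omega> assume \<omega>: "\<omega> \<in> space M"
    have "\<bar>\<Sum>i<Suc n. f' (x (node n i) \<omega>) * mesh n\<bar> \<le> (\<Sum>i<Suc n. K * mesh n)"
      using mesh(1)[of n] K by (intro order_trans[OF sum_abs] sum_mono) (auto simp: abs_mult intro: mult_right_mono)
    also have "\<dots> = K * (real (Suc n) * mesh n)" by simp
    also have "\<dots> = K * T" by (simp only: mesh(3))
    finally have 1: "\<bar>\<Sum>i<Suc n. f' (x (node n i) \<omega>) * mesh n\<bar> \<le> K * T" .
    have "norm (integral {0..T} (\<lambda>s. f' (x s \<omega>))) \<le> K * (T - 0)"
      using T K by (intro integral_bound compose_continuous f' \<omega>) auto
    then show "\<bar>(\<Sum>i<Suc n. f' (x (node n i) \<omega>) * mesh n) - integral {0..T} (\<lambda>s. f' (x s \<omega>))\<bar> \<le> 2 * (K * T)"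
      using 1 by (simp del: sum.lessThan_Suc)
  qed
  show "AE \<omega> in M. (\<lambda>n. (\<Sum>i<Suc n. f' (x (node n i) \<omega>) * mesh n) - integral {0..T} (\<lambda>s. f' (x s \<omega>))) \<longlonglongrightarrow> 0"
  proof (rule AE_I2)
    fix \<omega> assume "\<omega> \<in> space M"
    then have "(\<lambda>n. \<Sum>i<Suc n. (T - 0) / real (Suc n) * f' (x (0 + real i * ((T - 0) / real (Suc n))) \<omega>))
        \<longlonglongrightarrow> integral {0..T} (\<lambda>s. f' (x s \<omega>))"
      using T by (intro LIMSEQ_Suc[OF riemann_sums] compose_continuous f') auto
    then have "(\<lambda>n. \<Sum>i<Suc n. f' (x (node n i) \<omega>) * mesh n) \<longlonglongrightarrow> integral {0..T} (\<lambda>s. f' (x s \<omega>))"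
      by (simp add: node_def mesh_def mult.commute del: sum.lessThan_Suc of_nat_Suc)
    then show "(\<lambda>n. (\<Sum>i<Suc n. f' (x (node n i) \<omega>) * mesh n) - integral {0..T} (\<lambda>s. f' (x s \<omega>))) \<longlonglongrightarrow> 0"
      by (rule LIM_zero)
  qed
qed measurable

section \<open>The Taylor remainder\<close>

abbreviation remainder :: "nat \<Rightarrow> nat \<Rightarrow> 'a \<Rightarrow> real" where
  "remainder n i \<omega> \<equiv> G (x (node n (Suc i)) \<omega>) - G (x (node n i) \<omega>) - f (x (node n i) \<omega>) * dx n i \<omega>
     - f' (x (node n i) \<omega>) * (dx n i \<omega>)\<^sup>2 / 2"

text \<open>It stands in for the modulus of continuity of \<open>f'\<close> along the path; being a
  finite maximum of quotients it is evidently measurable. Where an increment is 0, the remainder is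
  0 as well, in agreement with the value 0 of the quotient.\<close>

definition max_ratio :: "nat \<Rightarrow> 'a \<Rightarrow> real" where
  "max_ratio n \<omega> = Max ((\<lambda>i. \<bar>remainder n i \<omega>\<bar> / (dx n i \<omega>)\<^sup>2) ` {..<Suc n})"

lemma max_ratio_measurable [measurable]: "max_ratio n \<in> borel_measurable M"
  unfolding max_ratio_def[abs_def] by (rule borel_measurable_Max) auto

lemma max_ratio_le:
  assumes "\<And>i y. i < Suc n \<Longrightarrow> y \<in> closed_segment (x (node n i) \<omega>) (x (node n (Suc i)) \<omega>)
    \<Longrightarrow> \<bar>f' y - f' (x (node n i) \<omega>)\<bar> \<le> e"
  shows "max_ratio n \<omega> \<le> e"
proof -
  have "\<bar>remainder n i \<omega>\<bar> / (dx n i \<omega>)\<^sup>2 \<le> e" if "i < Suc n" for i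
  proof -
    have e: "0 \<le> e" using assms[OF that, of "x (node n i) \<omega>"] by simp
    have "\<bar>remainder n i \<omega>\<bar> \<le> e * (dx n i \<omega>)\<^sup>2"
      by (rule taylor2_remainder_le[OF G f assms[OF that]])
    then show ?thesis
      using e by (cases "dx n i \<omega> = 0") (auto simp: pos_divide_le_eq)
  qed
  then show ?thesis unfolding max_ratio_def by (subst Max_le_iff) auto
qed

lemma max_ratio_nonneg: "0 \<le> max_ratio n \<omega>"
proof -
  have "\<bar>remainder n 0 \<omega>\<bar> / (dx n 0 \<omega>)\<^sup>2 \<le> max_ratio n \<omega>"
    unfolding max_ratio_def by (rule Max_ge) auto
  then show ?thesis by (rule order_trans[rotated]) simp
qed

lemma max_ratio_bounded: "\<bar>max_ratio n \<omega>\<bar> \<le> 2 * K"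
proof -
  have "max_ratio n \<omega> \<le> 2 * K"
  proof (rule max_ratio_le)
    show "\<bar>f' y - f' (x (node n i) \<omega>)\<bar> \<le> 2 * K" for i y
      using K[of y] K[of "x (node n i) \<omega>"] by linarith
  qed
  then show ?thesis using max_ratio_nonneg[of n \<omega>] by simp
qed

text \<open>On a fixed path \<open>x\<close> is uniformly continuous in time and stays in a compact
  interval, on which \<open>f'\<close> is uniformly continuous. Small cells thus lead to small
  oscillations of \<open>f'\<close> on the segments between successive values of
  \<open>x\<close>.\<close>

lemma max_ratio_tendsto:
  assumes \<omega>: "\<omega> \<in> space M"
  shows "(\<lambda>n. max_ratio n \<omega>) \<longlonglongrightarrow> 0"
proof (rule LIMSEQ_I)
  fix e :: real assume e: "0 < e"
  have xc: "continuous_on {0..T} (\<lambda>r. x r \<omega>)" by (rule x_continuous_Icc[OF \<omega>]) simp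
  have "bounded ((\<lambda>r. x r \<omega>) ` {0..T})"
    by (intro compact_imp_bounded compact_continuous_image xc) auto
  then obtain R where "\<forall>r\<in>{0..T}. \<bar>x r \<omega>\<bar> \<le> R"
    by (auto simp: bounded_iff)
  then have R: "\<bar>x r \<omega>\<bar> \<le> R" if "r \<in> {0..T}" for r
    using that by blast
  have "uniformly_continuous_on {-R..R} f'"
    by (intro compact_uniformly_continuous continuous_on_subset[OF f']) auto
  then obtain \<eta> where \<eta>: "0 < \<eta>"
    "\<And>u v. u \<in> {-R..R} \<Longrightarrow> v \<in> {-R..R} \<Longrightarrow> \<bar>v - u\<bar> < \<eta> \<Longrightarrow> \<bar>f' v - f' u\<bar> < e / 2"
    using e unfolding uniformly_continuous_on_def dist_real_def by (metis half_gt_zero)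
  have "uniformly_continuous_on {0..T} (\<lambda>r. x r \<omega>)"
    by (intro compact_uniformly_continuous xc) auto
  then obtain \<theta> where \<theta>: "0 < \<theta>"
    "\<And>u v. u \<in> {0..T} \<Longrightarrow> v \<in> {0..T} \<Longrightarrow> \<bar>v - u\<bar> < \<theta> \<Longrightarrow> \<bar>x v \<omega> - x u \<omega>\<bar> < \<eta>"
    using \<eta>(1) unfolding uniformly_continuous_on_def dist_real_def by metis
  obtain n0 where n0: "\<And>n. n0 \<le> n \<Longrightarrow> mesh n < \<theta>"
    using LIMSEQ_D[OF mesh_tendsto \<theta>(1)] mesh(1) by (metis abs_of_pos diff_zero real_norm_def)
  have "max_ratio n \<omega> \<le> e / 2" if "n0 \<le> n" for n
  proof (rule max_ratio_le)
    fix i y assume i: "i < Suc n" and y: "y \<in> closed_segment (x (node n i) \<omega>) (x (node n (Suc i)) \<omega>)"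
    have mem: "node n i \<in> {0..T}" "node n (Suc i) \<in> {0..T}"
      using node(1) node_le i by auto
    have "\<bar>node n (Suc i) - node n i\<bar> < \<theta>" using n0[OF that] mesh(1)[of n] by (simp add: node(3))
    then have "\<bar>x (node n (Suc i)) \<omega> - x (node n i) \<omega>\<bar> < \<eta>" by (rule \<theta>(2)[OF mem])
    moreover have "\<bar>y - x (node n i) \<omega>\<bar> \<le> \<bar>x (node n (Suc i)) \<omega> - x (node n i) \<omega>\<bar>"
      using segment_bound(1)[OF y] by (simp add: norm_minus_commute)
    moreover have "x (node n i) \<omega> \<in> {-R..R}" "x (node n (Suc i)) \<omega> \<in> {-R..R}"
      using R[OF mem(1)] R[OF mem(2)] by auto
    moreover have "y \<in> {-R..R}"
      using y closed_segment_subset[OF calculation(3,4) convex_real_interval(5)] by auto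
    ultimately show "\<bar>f' y - f' (x (node n i) \<omega>)\<bar> \<le> e / 2"
      using \<eta>(2)[of "x (node n i) \<omega>" y] by linarith
  qed
  then have "norm (max_ratio n \<omega> - 0) < e" if "n0 \<le> n" for n
    using that max_ratio_nonneg[of n \<omega>] e by fastforce
  then show "\<exists>n0. \<forall>n\<ge>n0. norm (max_ratio n \<omega> - 0) < e" by blast
qed

text \<open>The sum is at most \<open>max_ratio\<close> times the sum of squared increments, and the
  latter is \<open>\<sigma>\<^sup>2 * T\<close> plus a null sequence. In the product with that null
  sequence the boundedness of \<open>max_ratio\<close> is used, in the product with the constant its
  convergence to 0.\<close>

lemma msq_null_remainder: "msq_null M (\<lambda>n \<omega>. \<Sum>i<Suc n. remainder n i \<omega>)"
proof (rule msq_null_dominated)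
  let ?V = "\<lambda>n \<omega>. \<Sum>i<Suc n. (dx n i \<omega>)\<^sup>2 - \<sigma>\<^sup>2 * mesh n"
  have V: "msq_null M ?V"
    using msq_null_quadratic_variation[of "\<lambda>_. 1" 1] by simp
  have R: "msq_null M max_ratio"
    by (rule msq_null_bounded_convergence[where C = "2 * K"])
      (auto simp: max_ratio_bounded max_ratio_tendsto finite_measure_axioms)
  show "msq_null M (\<lambda>n \<omega>. max_ratio n \<omega> * ?V n \<omega> + \<sigma>\<^sup>2 * T * max_ratio n \<omega>)"
    by (intro msq_null_add msq_null_bounded_mult[OF V, of _ "2 * K"] msq_null_cmult R max_ratio_bounded) auto
  show "AE \<omega> in M. \<bar>\<Sum>i<Suc n. remainder n i \<omega>\<bar> \<le> \<bar>max_ratio n \<omega> * ?V n \<omega> + \<sigma>\<^sup>2 * T * max_ratio n \<omega>\<bar>" for n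
  proof (rule AE_I2)
    fix \<omega>
    have "\<bar>remainder n i \<omega>\<bar> \<le> max_ratio n \<omega> * (dx n i \<omega>)\<^sup>2" if "i < Suc n" for i
    proof (cases "dx n i \<omega> = 0")
      case False
      have "\<bar>remainder n i \<omega>\<bar> / (dx n i \<omega>)\<^sup>2 \<le> max_ratio n \<omega>"
        unfolding max_ratio_def using that by (intro Max_ge) auto
      then show ?thesis using False by (simp add: pos_divide_le_eq)
    qed simp
    then have "\<bar>\<Sum>i<Suc n. remainder n i \<omega>\<bar> \<le> (\<Sum>i<Suc n. max_ratio n \<omega> * (dx n i \<omega>)\<^sup>2)"
      by (intro order_trans[OF sum_abs] sum_mono) auto
    also have "\<dots> = max_ratio n \<omega> * (\<Sum>i<Suc n. (dx n i \<omega>)\<^sup>2)"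
      by (simp only: sum_distrib_left)
    also have "(\<Sum>i<Suc n. (dx n i \<omega>)\<^sup>2) = ?V n \<omega> + \<sigma>\<^sup>2 * T"
    proof -
      have "(\<Sum>i<Suc n. \<sigma>\<^sup>2 * mesh n) = \<sigma>\<^sup>2 * (real (Suc n) * mesh n)" by simp
      then show ?thesis by (simp only: sum_subtractf mesh(3) diff_add_cancel)
    qed
    finally show "\<bar>\<Sum>i<Suc n. remainder n i \<omega>\<bar> \<le> \<bar>max_ratio n \<omega> * ?V n \<omega> + \<sigma>\<^sup>2 * T * max_ratio n \<omega>\<bar>"
      by (simp only: distrib_left mult.commute)
  qed
qed measurable

text \<open>Ito's formula for \<open>G (x T)\<close>, solved for the stochastic integral.\<close>

abbreviation ito_value :: "'a \<Rightarrow> real" where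
  "ito_value \<omega> \<equiv> G (x T \<omega>) - G (x 0 \<omega>) - \<sigma>\<^sup>2 / 2 * integral {0..T} (\<lambda>s. f' (x s \<omega>))
     + \<alpha> * integral {0..T} (\<lambda>s. f (x s \<omega>) * x s \<omega>)"

lemma ito_value_decomposition:
  assumes "ou_path \<omega>"
  shows "(\<Sum>i<Suc n. f (x (node n i) \<omega>) * \<sigma> * dz n i \<omega>) - ito_value \<omega>
    = - ((\<Sum>i<Suc n. remainder n i \<omega>)
      + (1 / 2) * (\<Sum>i<Suc n. f' (x (node n i) \<omega>) * ((dx n i \<omega>)\<^sup>2 - \<sigma>\<^sup>2 * mesh n))
      + \<sigma>\<^sup>2 / 2 * ((\<Sum>i<Suc n. f' (x (node n i) \<omega>) * mesh n) - integral {0..T} (\<lambda>s. f' (x s \<omega>)))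
      + \<alpha> * (\<Sum>i<Suc n. integral {node n i..node n (Suc i)}
          (\<lambda>s. (f (x s \<omega>) - f (x (node n i) \<omega>)) * x s \<omega>)))"
proof -
  have \<omega>: "\<omega> \<in> space M" using assms by (simp add: ou_path_def)
  let ?Y = "\<lambda>i. integral {node n i..node n (Suc i)} (\<lambda>s. (f (x s \<omega>) - f (x (node n i) \<omega>)) * x s \<omega>)"
  let ?J = "\<lambda>i. integral {node n i..node n (Suc i)} (\<lambda>s. f (x s \<omega>) * x s \<omega>)"
  have J: "?J i = ?Y i + f (x (node n i) \<omega>) * drift n i \<omega>" for i
  proof -
    have "?Y i = integral {node n i..node n (Suc i)} (\<lambda>s. f (x s \<omega>) * x s \<omega> - f (x (node n i) \<omega>) * x s \<omega>)"
      by (simp add: left_diff_distrib)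
    also have "\<dots> = ?J i - integral {node n i..node n (Suc i)} (\<lambda>s. f (x (node n i) \<omega>) * x s \<omega>)"
      by (intro Henstock_Kurzweil_Integration.integral_diff integrable_continuous_real continuous_intros
        compose_continuous f_continuous x_continuous_Icc \<omega> node)
    finally show ?thesis by simp
  qed
  have step: "f (x (node n i) \<omega>) * \<sigma> * dz n i \<omega> = (G (x (node n (Suc i)) \<omega>) - G (x (node n i) \<omega>))
      + \<alpha> * ?J i
      - (remainder n i \<omega> + (1 / 2) * (f' (x (node n i) \<omega>) * ((dx n i \<omega>)\<^sup>2 - \<sigma>\<^sup>2 * mesh n))
        + \<sigma>\<^sup>2 / 2 * (f' (x (node n i) \<omega>) * mesh n) + \<alpha> * ?Y i)" for i
  proof -
    have "\<sigma> * dz n i \<omega> = dx n i \<omega> + \<alpha> * drift n i \<omega>"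
      using ou_path_increment[OF assms node(1,2)[of n i]] by simp
    then have "f (x (node n i) \<omega>) * \<sigma> * dz n i \<omega> = f (x (node n i) \<omega>) * (dx n i \<omega> + \<alpha> * drift n i \<omega>)"
      by (metis mult.assoc)
    then show ?thesis unfolding J by (simp add: field_simps)
  qed
  have tele: "(\<Sum>i<Suc n. G (x (node n (Suc i)) \<omega>) - G (x (node n i) \<omega>)) = G (x T \<omega>) - G (x 0 \<omega>)"
    using sum_lessThan_telescope[of "\<lambda>i. G (x (node n i) \<omega>)" "Suc n"] by (simp only: node)
  have sumJ: "(\<Sum>i<Suc n. ?J i) = integral {0..T} (\<lambda>s. f (x s \<omega>) * x s \<omega>)"
    by (intro integral_node[symmetric] continuous_intros compose_continuous f_continuous x_continuous_Icc \<omega>) auto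
  \<comment> \<open>Stated for arbitrary sequences so that the long summands stay opaque in the
    rearrangement.\<close>
  have lin: "(\<Sum>i<N. a i + \<alpha> * j i - (r i + (1 / 2) * q i + \<sigma>\<^sup>2 / 2 * m i + \<alpha> * y i))
    = (\<Sum>i<N. a i) + \<alpha> * (\<Sum>i<N. j i) - ((\<Sum>i<N. r i) + (1 / 2) * (\<Sum>i<N. q i)
      + \<sigma>\<^sup>2 / 2 * (\<Sum>i<N. m i) + \<alpha> * (\<Sum>i<N. y i))" for a j r q m y :: "nat \<Rightarrow> real" and N
    by (simp only: sum.distrib sum_subtractf sum_distrib_left)
  have regroup: "(g + aj - (r + q + b * m + y)) - (g - b * l + aj) = - (r + q + b * (m - l) + y)"
    for g aj r q b m l y :: real
    by (simp add: algebra_simps)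
  show ?thesis
    unfolding step lin tele sumJ by (rule regroup)
qed

lemma ito_value_measurable: "ito_value \<in> borel_measurable M"
proof -
  have [measurable]: "(\<lambda>\<omega>. integral {0..T} (\<lambda>s. f (x s \<omega>) * x s \<omega>)) \<in> borel_measurable M"
    using T by (intro borel_measurable_path_integral continuous_intros compose_continuous f_continuous x_continuous_Icc) auto
  have [measurable]: "x T \<in> borel_measurable M" "x 0 \<in> borel_measurable M" using T by auto
  show ?thesis by measurable
qed

text \<open>The index is \<open>s / mesh n\<close> rounded down. Exactly one half-open cell contains
  \<open>s\<close>, provided that \<open>s < T\<close>.\<close>

lemma node_process:
  assumes "s \<in> {0..<T}"
  obtains i where "i < Suc n" "node n i \<le> s" "s \<le> node n (Suc i)"
    "\<And>\<xi> \<omega>. elementary_process (Suc n) (node n) \<xi> s (\<omega> :: 'a) = \<xi> i \<omega>"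
proof -
  define i where "i = nat \<lfloor>s / mesh n\<rfloor>"
  have m: "0 < mesh n" by (rule mesh)
  have i: "real i = of_int \<lfloor>s / mesh n\<rfloor>" using assms m by (simp add: i_def)
  have lo: "node n i \<le> s"
  proof -
    have "real i \<le> s / mesh n" unfolding i by linarith
    then show ?thesis using m by (simp add: node_def pos_le_divide_eq)
  qed
  have hi: "s < node n (Suc i)"
  proof -
    have "s / mesh n < real (Suc i)" using i by simp linarith
    then show ?thesis using m by (simp add: node_def pos_divide_less_eq)
  qed
  have iff: "node n k \<le> s \<and> s < node n (Suc k) \<longleftrightarrow> k = i" for k
  proof
    assume k: "node n k \<le> s \<and> s < node n (Suc k)"
    have "\<not> Suc k \<le> i" using node_mono[of "Suc k" i n] k lo by linarith
    moreover have "\<not> Suc i \<le> k" using node_mono[of "Suc i" k n] k hi by linarith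
    ultimately show "k = i" by simp
  qed (use lo hi in simp)
  have in_range: "i < Suc n"
  proof (rule ccontr)
    assume "\<not> i < Suc n"
    then have "T \<le> node n i" using node_mono[of "Suc n" i n] node(5)[of n] by simp
    then show False using lo assms by simp
  qed
  show thesis
  proof (rule that[OF in_range lo less_imp_le[OF hi]])
    fix \<xi> and \<omega> :: 'a
    have "elementary_process (Suc n) (node n) \<xi> s \<omega> = (\<Sum>k<Suc n. if k = i then \<xi> k \<omega> else 0)"
      unfolding elementary_process_def
    proof (rule sum.cong)
      show "\<xi> k \<omega> * indicator {node n k..<node n (Suc k)} s = (if k = i then \<xi> k \<omega> else 0)" for k
        using iff[of k] by (auto simp: indicator_def)
    qed simp
    also have "\<dots> = \<xi> i \<omega>" using in_range by (simp del: sum.lessThan_Suc)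
    finally show "elementary_process (Suc n) (node n) \<xi> s \<omega> = \<xi> i \<omega>" .
  qed
qed

lemma policy_value:
  assumes "0 \<le> t"
  shows "(\<lambda>\<omega>. f (x t \<omega>) * \<sigma>) \<in> borel_measurable (F t)"
    and "msq M (\<lambda>\<omega>. f (x t \<omega>) * \<sigma>) \<le> ennreal (\<sigma>\<^sup>2 * (2 * (f 0)\<^sup>2 + K\<^sup>2 * (1 + C)))"
proof -
  show "(\<lambda>\<omega>. f (x t \<omega>) * \<sigma>) \<in> borel_measurable (F t)"
    using measurable_compose[OF x_F[OF assms] f_measurable] by simp
  let ?a = "\<sigma>\<^sup>2 * (2 * (f 0)\<^sup>2 + K\<^sup>2)" and ?b = "\<sigma>\<^sup>2 * K\<^sup>2"
  have "msq M (\<lambda>\<omega>. f (x t \<omega>) * \<sigma>) \<le> ennreal ?a * fourth (\<lambda>_. 1) + ennreal ?b * fourth (x t)"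
    unfolding msq_def
  proof (rule nn_integral_fourth_le)
    show "AE \<omega> in M. (f (x t \<omega>) * \<sigma>)\<^sup>2 \<le> ?a * 1 ^ 4 + ?b * (x t \<omega>) ^ 4"
    proof (rule AE_I2)
      fix \<omega>
      let ?y = "x t \<omega>"
      have "(f ?y)\<^sup>2 \<le> (\<bar>f 0\<bar> + K * \<bar>?y\<bar>)\<^sup>2"
        using power_mono[OF linear_growth(1)[OF f K, of ?y], of 2] by simp
      also have "\<dots> \<le> 2 * (f 0)\<^sup>2 + 2 * (K\<^sup>2 * ?y\<^sup>2)"
        using power2_add_le[of 1 "\<bar>f 0\<bar>" "K * \<bar>?y\<bar>"] by (simp add: power_mult_distrib)
      \<comment> \<open>Trades the square for a fourth power, the moment of \<open>x t\<close> that
        is kept under control.\<close>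
      also have "2 * (K\<^sup>2 * ?y\<^sup>2) \<le> K\<^sup>2 * (1 + ?y ^ 4)"
      proof -
        have "0 \<le> (?y\<^sup>2 - 1)\<^sup>2" by simp
        then have "2 * ?y\<^sup>2 \<le> 1 + ?y ^ 4" by (simp add: power2_diff)
        then have "K\<^sup>2 * (2 * ?y\<^sup>2) \<le> K\<^sup>2 * (1 + ?y ^ 4)" by (intro mult_left_mono) auto
        then show ?thesis by simp
      qed
      finally have "(f ?y)\<^sup>2 \<le> 2 * (f 0)\<^sup>2 + K\<^sup>2 * (1 + ?y ^ 4)" by simp
      then have "\<sigma>\<^sup>2 * (f ?y)\<^sup>2 \<le> \<sigma>\<^sup>2 * (2 * (f 0)\<^sup>2 + K\<^sup>2 * (1 + ?y ^ 4))"
        by (rule mult_left_mono) simp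
      then show "(f ?y * \<sigma>)\<^sup>2 \<le> ?a * 1 ^ 4 + ?b * ?y ^ 4"
        by (simp add: power_mult_distrib algebra_simps)
    qed
  qed (use assms in auto)
  also have "\<dots> \<le> ennreal ?a * ennreal 1 + ennreal ?b * ennreal C"
    using C(2)[OF assms] by (intro add_mono mult_left_mono) (auto simp: emeasure_space_1)
  also have "\<dots> = ennreal (?a * 1 + ?b * C)" using C(1) by (intro ennreal_lincomb) auto
  also have "?a * 1 + ?b * C = \<sigma>\<^sup>2 * (2 * (f 0)\<^sup>2 + K\<^sup>2 * (1 + C))" by (simp add: algebra_simps)
  finally show "msq M (\<lambda>\<omega>. f (x t \<omega>) * \<sigma>) \<le> ennreal (\<sigma>\<^sup>2 * (2 * (f 0)\<^sup>2 + K\<^sup>2 * (1 + C)))" .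
qed

lemma policy_ito_integrand: "ito_integrand M F T (\<lambda>s \<omega>. f (x s \<omega>) * \<sigma>)"
proof -
  have m: "(\<lambda>(s, \<omega>). f (x s \<omega>) * \<sigma>) \<in> borel_measurable (path_space T)"
  proof (rule path_measurable)
    show "continuous_on {0..} (\<lambda>s. f (x s \<omega>) * \<sigma>)" if "\<omega> \<in> space M" for \<omega>
      by (intro continuous_intros continuous_on_compose2[OF f_continuous x_continuous[OF that]]) auto
  qed (use F_measurable[OF policy_value(1)] in auto)
  have "msq (path_space T) (\<lambda>(s, \<omega>). f (x s \<omega>) * \<sigma>) \<le> ennreal (T * (\<sigma>\<^sup>2 * (2 * (f 0)\<^sup>2 + K\<^sup>2 * (1 + C))))"
    using T C(1) by (intro msq_path_space_le m policy_value(2)) auto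
  also have "\<dots> < \<infinity>" by simp
  finally show ?thesis
    using m policy_value(1)
    by (simp add: ito_integrand_def measurable_cong_sets[OF sets_path_space refl] msq_path_space)
qed

lemma policy_elementary_data: "elementary_data M F T (Suc n) (node n) (\<lambda>i \<omega>. f (x (node n i) \<omega>) * \<sigma>)"
proof -
  have "integrable M (\<lambda>\<omega>. (f (x (node n i) \<omega>) * \<sigma>)\<^sup>2)" for i
  proof -
    have "msq M (\<lambda>\<omega>. f (x (node n i) \<omega>) * \<sigma>) < \<infinity>"
      by (rule le_less_trans[OF policy_value(2)[OF node(1)]]) simp
    then show ?thesis
      using msq_finite_iff[OF F_measurable[OF policy_value(1)[OF node(1)]]] by simp
  qed
  then show ?thesis
    unfolding elementary_data_def using node policy_value(1)[OF node(1)] by auto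
qed

text \<open>By the Lipschitz bound on \<open>f\<close> the error at time \<open>s\<close> is at most
  a multiple of the increment of \<open>x\<close> since the last node, uniformly of mean square
  order \<open>mesh n\<close>.\<close>

lemma msq_null_policy_process:
  "msq_null (path_space T) (\<lambda>n (s, \<omega>).
     elementary_process (Suc n) (node n) (\<lambda>i \<omega>. f (x (node n i) \<omega>) * \<sigma>) s \<omega> - f (x s \<omega>) * \<sigma>)"
proof (rule msq_null_bound)
  let ?\<xi> = "\<lambda>n i \<omega>. f (x (node n i) \<omega>) * \<sigma>"
  let ?e = "\<lambda>n s \<omega>. elementary_process (Suc n) (node n) (?\<xi> n) s \<omega> - f (x s \<omega>) * \<sigma>"
  show m: "(\<lambda>(s, \<omega>). ?e n s \<omega>) \<in> borel_measurable (path_space T)" for n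
    using borel_measurable_diff[OF elementary_process_measurable[OF policy_elementary_data[of n]]
        ito_integrand_msq(1)[OF policy_ito_integrand]] by (simp add: split_beta')
  define C' where "C' = 8 * \<alpha> ^ 4 * C * T\<^sup>2 + 24 * \<sigma> ^ 4"
  have C': "0 \<le> C'" using C(1) by (simp add: C'_def)
  define c where "c = \<sigma>\<^sup>2 * K\<^sup>2 / 2 * (1 + C')"
  have c: "0 \<le> c" using C' by (simp add: c_def)
  have "msq M (?e n s) \<le> ennreal (c * mesh n)" if s: "s \<in> {0..<T}" for n s
  proof -
    let ?d = "mesh n"
    have d: "0 < ?d" by (rule mesh)
    obtain i where i: "i < Suc n" "node n i \<le> s" "s \<le> node n (Suc i)"
      "\<And>\<xi> \<omega>. elementary_process (Suc n) (node n) \<xi> s (\<omega> :: 'a) = \<xi> i \<omega>"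
      by (rule node_process[OF s, of n]) (rule that)
    let ?D = "\<lambda>\<omega>. x s \<omega> - x (node n i) \<omega>"
    have [measurable]: "x s \<in> borel_measurable M" using s by auto
    let ?a = "\<sigma>\<^sup>2 * K\<^sup>2 * ?d / 2" and ?b = "\<sigma>\<^sup>2 * K\<^sup>2 / (2 * ?d)"
    have "msq M (?e n s) \<le> ennreal ?a * fourth (\<lambda>_. 1) + ennreal ?b * fourth ?D"
      unfolding msq_def
    proof (rule nn_integral_fourth_le)
      show "AE \<omega> in M. (?e n s \<omega>)\<^sup>2 \<le> ?a * 1 ^ 4 + ?b * (?D \<omega>) ^ 4"
      proof (rule AE_I2)
        fix \<omega>
        define u where "u = ?D \<omega>"
        have "\<bar>f (x s \<omega>) - f (x (node n i) \<omega>)\<bar> \<le> K * \<bar>u\<bar>"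
          unfolding u_def by (rule linear_growth(2)[OF f K])
        then have "(f (x s \<omega>) - f (x (node n i) \<omega>))\<^sup>2 \<le> K\<^sup>2 * u\<^sup>2"
          by (metis abs_ge_zero power2_abs power_mono power_mult_distrib)
        moreover have "(?e n s \<omega>)\<^sup>2 = \<sigma>\<^sup>2 * (f (x s \<omega>) - f (x (node n i) \<omega>))\<^sup>2"
          unfolding i(4) by (simp add: left_diff_distrib[symmetric] power_mult_distrib power2_commute)
        ultimately have "(?e n s \<omega>)\<^sup>2 \<le> \<sigma>\<^sup>2 * (K\<^sup>2 * u\<^sup>2)"
          by (simp add: mult_left_mono)
        \<comment> \<open>The weight \<open>d\<close> turns the fourth moment of order
          \<open>d ^ 2\<close> into a second moment of order \<open>d\<close>.\<close>
        moreover have "u\<^sup>2 \<le> ?d / 2 + u ^ 4 / (2 * ?d)"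
          using young[OF d, of 1 "u\<^sup>2"] by (simp add: add_divide_distrib mult.commute)
        then have "\<sigma>\<^sup>2 * (K\<^sup>2 * u\<^sup>2) \<le> \<sigma>\<^sup>2 * (K\<^sup>2 * (?d / 2 + u ^ 4 / (2 * ?d)))"
          by (intro mult_left_mono) auto
        moreover have "\<sigma>\<^sup>2 * (K\<^sup>2 * (?d / 2 + u ^ 4 / (2 * ?d))) = ?a * 1 ^ 4 + ?b * u ^ 4"
          by (simp add: algebra_simps)
        ultimately show "(?e n s \<omega>)\<^sup>2 \<le> ?a * 1 ^ 4 + ?b * (?D \<omega>) ^ 4"
          unfolding u_def by linarith
      qed
    qed (use d in auto)
    also have "\<dots> \<le> ennreal ?a * ennreal 1 + ennreal ?b * ennreal (C' * ?d\<^sup>2)"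
    proof (intro add_mono mult_left_mono)
      have "(s - node n i)\<^sup>2 \<le> ?d\<^sup>2" using i(2,3) node(3)[of n i] by (intro power_mono) auto
      then have "C' * (s - node n i)\<^sup>2 \<le> C' * ?d\<^sup>2" using C' by (rule mult_left_mono)
      then show "fourth ?D \<le> ennreal (C' * ?d\<^sup>2)"
        using fourth_x_increment[OF C node(1) i(2), of T] s by (auto simp: C'_def intro: order_trans ennreal_leI)
    qed (auto simp: emeasure_space_1)
    also have "\<dots> = ennreal (?a * 1 + ?b * (C' * ?d\<^sup>2))" using d C' by (intro ennreal_lincomb) auto
    also have "?a * 1 + ?b * (C' * ?d\<^sup>2) = c * ?d"
      using d by (simp add: c_def field_simps power2_eq_square)
    finally show ?thesis .
  qed
  then show "msq (path_space T) (\<lambda>(s, \<omega>). ?e n s \<omega>) \<le> ennreal (T * (c * mesh n))" for n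
    using T c mesh(1)[of n] by (intro msq_path_space_le m) auto
  show "(\<lambda>n. T * (c * mesh n)) \<longlonglongrightarrow> 0"
    using tendsto_mult[OF tendsto_const mesh_tendsto, of "T * c"] by (simp add: mult.assoc)
qed

text \<open>Process and integral converge along the same partitions, as the definition of the Ito
  integral demands.\<close>

lemma has_ito_integral_policy: "has_ito_integral M F z T (\<lambda>s \<omega>. f (x s \<omega>) * \<sigma>) ito_value"
proof (rule has_ito_integralI[OF policy_ito_integrand ito_value_measurable policy_elementary_data
      msq_null_policy_process])
  let ?e = "\<lambda>n \<omega>. (\<Sum>i<Suc n. remainder n i \<omega>)
      + (1 / 2) * (\<Sum>i<Suc n. f' (x (node n i) \<omega>) * ((dx n i \<omega>)\<^sup>2 - \<sigma>\<^sup>2 * mesh n))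
      + \<sigma>\<^sup>2 / 2 * ((\<Sum>i<Suc n. f' (x (node n i) \<omega>) * mesh n) - integral {0..T} (\<lambda>s. f' (x s \<omega>)))
      + \<alpha> * (\<Sum>i<Suc n. integral {node n i..node n (Suc i)}
          (\<lambda>s. (f (x s \<omega>) - f (x (node n i) \<omega>)) * x s \<omega>))"
  show "msq_null M (\<lambda>n \<omega>. elementary_integral z (Suc n) (node n) (\<lambda>i \<omega>. f (x (node n i) \<omega>) * \<sigma>) \<omega> - ito_value \<omega>)"
  proof (rule msq_null_dominated)
    show "msq_null M ?e"
      by (intro msq_null_add msq_null_cmult msq_null_remainder msq_null_riemann msq_null_drift
        msq_null_quadratic_variation[OF f'_measurable K])
    show "(\<lambda>\<omega>. elementary_integral z (Suc n) (node n) (\<lambda>i \<omega>. f (x (node n i) \<omega>) * \<sigma>) \<omega> - ito_value \<omega>)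
        \<in> borel_measurable M" for n
      by (intro borel_measurable_diff elementary_integral_measurable[OF policy_elementary_data] ito_value_measurable)
    show "AE \<omega> in M. \<bar>elementary_integral z (Suc n) (node n) (\<lambda>i \<omega>. f (x (node n i) \<omega>) * \<sigma>) \<omega> - ito_value \<omega>\<bar>
        \<le> \<bar>?e n \<omega>\<bar>" for n
      using AE_ou_path
    proof eventually_elim
      case (elim \<omega>)
      show ?case
        unfolding elementary_integral_def ito_value_decomposition[OF elim] abs_minus_cancel ..
    qed
  qed
qed

end

end

end

section \<open>Growth rates of the log wealth\<close>

lemma has_ito_integral_cong:
  assumes "has_ito_integral M F z T H I" "\<And>\<omega>. \<omega> \<in> space M \<Longrightarrow> I \<omega> = I' \<omega>"
  shows "has_ito_integral M F z T H I'"
proof -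
  have "I' \<in> borel_measurable M"
    using assms measurable_cong[of M I I' borel] by (simp add: has_ito_integral_def)
  moreover have "(\<integral>\<^sup>+\<omega>. ennreal ((e \<omega> - I' \<omega>)\<^sup>2) \<partial>M) = (\<integral>\<^sup>+\<omega>. ennreal ((e \<omega> - I \<omega>)\<^sup>2) \<partial>M)" for e
    by (rule nn_integral_cong) (simp add: assms(2))
  ultimately show ?thesis
    using assms(1) by (simp add: has_ito_integral_def)
qed

text \<open>The partitions above need \<open>0 < T\<close>. At \<open>T = 0\<close> the partition
  without cells serves, as every process on a null set of times has mean square 0.\<close>

lemma (in wiener) has_ito_integral_0:
  assumes m: "(\<lambda>(s, \<omega>). H s \<omega>) \<in> borel_measurable (path_space 0)" and H: "H 0 \<in> borel_measurable (F 0)"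
  shows "has_ito_integral M F z 0 H (\<lambda>_. 0)"
proof (rule has_ito_integralI[where N = "\<lambda>_. 0" and \<tau> = "\<lambda>_ _. 0" and \<xi> = "\<lambda>_ _ _. 0"])
  have null: "msq (path_space 0) (\<lambda>(s, \<omega>). H' s \<omega>) = 0"
    if "(\<lambda>(s, \<omega>). H' s \<omega>) \<in> borel_measurable (path_space 0)" for H'
    using msq_path_space_le[OF that, of 0] by simp
  show "ito_integrand M F 0 H"
    using m H null[OF m] msq_path_space[OF m]
    by (simp add: ito_integrand_def measurable_cong_sets[OF sets_path_space refl])
  have m': "(\<lambda>(s, \<omega>). elementary_process 0 (\<lambda>_. 0) (\<lambda>_ _. 0) s \<omega> - H s \<omega>) \<in> borel_measurable (path_space 0)"
    using borel_measurable_uminus[OF m] by (simp add: elementary_process_def split_beta')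
  show "msq_null (path_space 0) (\<lambda>n (s, \<omega>). elementary_process 0 (\<lambda>_. 0) (\<lambda>_ _. 0) s \<omega> - H s \<omega>)"
    using m' null[OF m'] by (simp add: msq_null_def)
qed (auto simp: elementary_data_def elementary_integral_def msq_null_def msq_def)

lemma continuous_on_atLeastI:
  fixes h :: "real \<Rightarrow> real"
  assumes "\<And>b. continuous_on {a..b} h"
  shows "continuous_on {a..} h"
  unfolding continuous_on_eq_continuous_within
proof
  fix t assume t: "t \<in> {a..}"
  then have "continuous (at t within {a..t + 1}) h"
    using assms[of "t + 1"] by (simp add: continuous_on_eq_continuous_within)
  moreover have "at t within {a..} = at t within {a..t + 1}"
    by (rule at_within_nhd[of t "{..<t + 1}"]) auto
  ultimately show "continuous (at t within {a..}) h" by simp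
qed

lemma antiderivative_exists:
  fixes f :: "real \<Rightarrow> real"
  assumes "continuous_on UNIV f"
  obtains G where "\<And>y. (G has_real_derivative f y) (at y)" "G 0 = 0"
proof -
  have "\<exists>G. \<forall>y::real. -\<infinity> < ereal y \<longrightarrow> ereal y < \<infinity> \<longrightarrow> (G has_vector_derivative f y) (at y)"
    using assms by (intro einterval_antiderivative) (auto simp: continuous_on_eq_continuous_at)
  then obtain G where G: "\<And>y. (G has_real_derivative f y) (at y)"
    by (auto simp: has_real_derivative_iff_has_vector_derivative)
  show thesis
    by (rule that[of "\<lambda>y. G y - G 0"]) (auto intro!: derivative_eq_intros G)
qed

lemma antiderivative_bound:
  fixes f G :: "real \<Rightarrow> real"
  assumes G: "\<And>y. (G has_real_derivative f y) (at y)" "G 0 = 0"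
    and f: "\<And>y. \<bar>f y\<bar> \<le> a + b * \<bar>y\<bar>" and ab: "0 \<le> a" "0 \<le> b"
  shows "\<bar>G y\<bar> \<le> (a + b) * (1 + y\<^sup>2)"
proof -
  have "norm (G y - G 0) \<le> (a + b * \<bar>y\<bar>) * norm (y - 0)"
  proof (rule field_differentiable_bound[where S = "closed_segment 0 y" and f' = f])
    fix u assume u: "u \<in> closed_segment 0 y"
    show "(G has_real_derivative f u) (at u within closed_segment 0 y)"
      by (rule DERIV_subset[OF G(1)]) simp
    have "\<bar>u\<bar> \<le> \<bar>y\<bar>" using segment_bound(1)[OF u] by simp
    then have "b * \<bar>u\<bar> \<le> b * \<bar>y\<bar>" using ab(2) by (rule mult_left_mono)
    then show "norm (f u) \<le> a + b * \<bar>y\<bar>" using f[of u] by simp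
  qed auto
  then have "\<bar>G y\<bar> \<le> a * \<bar>y\<bar> + b * y\<^sup>2"
    using G(2) by (simp add: algebra_simps power2_eq_square abs_mult_self_eq)
  also have "a * \<bar>y\<bar> \<le> a * (1 + y\<^sup>2)"
  proof (rule mult_left_mono[OF _ ab(1)])
    have "0 \<le> (\<bar>y\<bar> - 1)\<^sup>2" by simp
    then have "2 * \<bar>y\<bar> \<le> 1 + y\<^sup>2" by (simp add: power2_diff)
    then show "\<bar>y\<bar> \<le> 1 + y\<^sup>2" by linarith
  qed
  also have "b * y\<^sup>2 \<le> b * (1 + y\<^sup>2)" using ab(2) by (intro mult_left_mono) auto
  finally show ?thesis by (simp add: algebra_simps)
qed

context ou_process
begin

lemma ito_formula:
  fixes f f' G :: "real \<Rightarrow> real"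
  assumes G: "\<And>y. (G has_real_derivative f y) (at y)" and f: "\<And>y. (f has_real_derivative f' y) (at y)"
    and f': "continuous_on UNIV f'" and K: "\<And>y. \<bar>f' y\<bar> \<le> K" and t: "0 \<le> t"
  shows "has_ito_integral M F z t (\<lambda>s \<omega>. f (x s \<omega>) * \<sigma>) (\<lambda>\<omega>. G (x t \<omega>) - G (x 0 \<omega>)
    - \<sigma>\<^sup>2 / 2 * integral {0..t} (\<lambda>s. f' (x s \<omega>)) + \<alpha> * integral {0..t} (\<lambda>s. f (x s \<omega>) * x s \<omega>))"
proof (cases "t = 0")
  case False
  obtain C where "0 \<le> C" "\<And>t. 0 \<le> t \<Longrightarrow> fourth (x t) \<le> ennreal C"
    using fourth_moment_bounded by blast
  then show ?thesis
    using has_ito_integral_policy[OF _ _ _ G f f' K] t False by simp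
next
  case True
  have fc: "continuous_on A f" for A
    by (rule DERIV_imp_continuous_on[OF f])
  have fF: "(\<lambda>\<omega>. f (x s \<omega>) * \<sigma>) \<in> borel_measurable (F s)" if "0 \<le> s" for s
    using measurable_compose[OF x_F[OF that] borel_measurable_continuous_onI[OF fc]] by simp
  have "(\<lambda>(s, \<omega>). f (x s \<omega>) * \<sigma>) \<in> borel_measurable (path_space 0)"
    using F_measurable[OF fF]
    by (intro path_measurable continuous_intros continuous_on_compose2[OF fc x_continuous]) auto
  then show ?thesis
    unfolding True using has_ito_integral_0 fF[of 0] by simp
qed

lemma path_integral_F:
  fixes h :: "real \<Rightarrow> real"
  assumes "continuous_on UNIV h" "0 \<le> t"
  shows "(\<lambda>\<omega>. integral {0..t} (\<lambda>s. h (x s \<omega>))) \<in> borel_measurable (F t)"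
proof (rule borel_measurable_path_integral[OF assms(2)])
  fix s assume "s \<in> {0..t}"
  then have "x s \<in> borel_measurable (F t)" using F_measurable_mono[OF _ x_F, of s t] by auto
  then show "(\<lambda>\<omega>. h (x s \<omega>)) \<in> borel_measurable (F t)"
    using borel_measurable_continuous_onI[OF assms(1)] by (rule measurable_compose)
qed (use compose_continuous[OF assms(1)] in auto)

lemma LBINT_path:
  fixes g :: "real \<Rightarrow> real"
  assumes "continuous_on {0..t} g"
  shows "set_integrable lborel {0..t} g" "(LBINT s:{0..t}. g s) = integral {0..t} g"
  using borel_integrable_atLeastAtMost'[OF assms] set_borel_integral_eq_integral(2) by auto

section \<open>Existence and uniqueness of the log wealth\<close>

context
  fixes f f' G :: "real \<Rightarrow> real" and K w :: real
  assumes G: "\<And>y. (G has_real_derivative f y) (at y)" and f: "\<And>y. (f has_real_derivative f' y) (at y)"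
    and f': "continuous_on UNIV f'" and K: "\<And>y. \<bar>f' y\<bar> \<le> K"
begin

definition wealth_path :: "real \<Rightarrow> 'a \<Rightarrow> real" where
  "wealth_path t \<omega> = w + G (x t \<omega>) - G (x 0 \<omega>) - \<sigma>\<^sup>2 / 2 * integral {0..t} (\<lambda>s. f' (x s \<omega>))"

lemma policy_drift:
  assumes "\<omega> \<in> space M" "0 \<le> t"
  shows "set_integrable lborel {0..t} (\<lambda>s. f (x s \<omega>) * (- \<alpha> * x s \<omega>))"
    and "(LBINT s:{0..t}. f (x s \<omega>) * (- \<alpha> * x s \<omega>)) = - (\<alpha> * integral {0..t} (\<lambda>s. f (x s \<omega>) * x s \<omega>))"
proof -
  have fc: "continuous_on UNIV f"
    by (rule DERIV_imp_continuous_on[OF f])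
  have cont: "continuous_on {0..t} (\<lambda>s. f (x s \<omega>) * (- \<alpha> * x s \<omega>))"
    by (intro continuous_intros compose_continuous fc x_continuous_Icc assms) auto
  show "set_integrable lborel {0..t} (\<lambda>s. f (x s \<omega>) * (- \<alpha> * x s \<omega>))"
    by (rule LBINT_path(1)[OF cont])
  have "(LBINT s:{0..t}. f (x s \<omega>) * (- \<alpha> * x s \<omega>)) = integral {0..t} (\<lambda>s. (- \<alpha>) * (f (x s \<omega>) * x s \<omega>))"
    unfolding LBINT_path(2)[OF cont] by (simp add: mult_ac)
  also have "\<dots> = - \<alpha> * integral {0..t} (\<lambda>s. f (x s \<omega>) * x s \<omega>)"
    by (rule integral_mult_right)
  finally show "(LBINT s:{0..t}. f (x s \<omega>) * (- \<alpha> * x s \<omega>)) = - (\<alpha> * integral {0..t} (\<lambda>s. f (x s \<omega>) * x s \<omega>))"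
    by simp
qed

lemma wealth_path_F: "0 \<le> t \<Longrightarrow> wealth_path t \<in> borel_measurable (F t)"
proof -
  assume t: "0 \<le> t"
  have Gm: "G \<in> borel_measurable borel"
    by (rule borel_measurable_continuous_onI[OF DERIV_imp_continuous_on[OF G]])
  have [measurable]: "(\<lambda>\<omega>. G (x t \<omega>)) \<in> borel_measurable (F t)" "(\<lambda>\<omega>. G (x 0 \<omega>)) \<in> borel_measurable (F t)"
    "(\<lambda>\<omega>. integral {0..t} (\<lambda>s. f' (x s \<omega>))) \<in> borel_measurable (F t)"
    using measurable_compose[OF x_F[OF t] Gm] measurable_compose[OF F_measurable_mono[OF t x_F] Gm]
      path_integral_F[OF f' t] by auto
  show ?thesis unfolding wealth_path_def[abs_def] by measurable
qed

text \<open>The drift integral of \<open>f (x s) * x s\<close> cancels against the same term in the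
  Ito integral, which leaves the boundary terms and the integral of \<open>f'\<close>.\<close>

lemma log_wealth_wealth_path: "log_wealth M F z \<alpha> \<sigma> x w f wealth_path"
  unfolding log_wealth_def has_ito_differential_def
proof (intro conjI ballI allI impI)
  fix t :: real assume t: "0 \<le> t"
  show "wealth_path t \<in> borel_measurable (F t)" by (rule wealth_path_F[OF t])
  let ?I = "\<lambda>\<omega>. G (x t \<omega>) - G (x 0 \<omega>) - \<sigma>\<^sup>2 / 2 * integral {0..t} (\<lambda>s. f' (x s \<omega>))
    + \<alpha> * integral {0..t} (\<lambda>s. f (x s \<omega>) * x s \<omega>)"
  show "\<exists>I. has_ito_integral M F z t (\<lambda>s \<omega>. f (x s \<omega>) * \<sigma>) I \<and>
      (AE \<omega> in M. set_integrable lborel {0..t} (\<lambda>s. f (x s \<omega>) * (- \<alpha> * x s \<omega>)) \<and>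
        wealth_path t \<omega> = wealth_path 0 \<omega> + (LBINT s:{0..t}. f (x s \<omega>) * (- \<alpha> * x s \<omega>)) + I \<omega>)"
  proof (intro exI[of _ ?I] conjI AE_I2)
    show "has_ito_integral M F z t (\<lambda>s \<omega>. f (x s \<omega>) * \<sigma>) ?I"
      by (rule ito_formula[OF G f f' K t])
    fix \<omega> assume \<omega>: "\<omega> \<in> space M"
    show "set_integrable lborel {0..t} (\<lambda>s. f (x s \<omega>) * (- \<alpha> * x s \<omega>))" by (rule policy_drift[OF \<omega> t])
    show "wealth_path t \<omega> = wealth_path 0 \<omega> + (LBINT s:{0..t}. f (x s \<omega>) * (- \<alpha> * x s \<omega>)) + ?I \<omega>"
      unfolding policy_drift(2)[OF \<omega> t] by (simp add: wealth_path_def)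
  qed
next
  fix \<omega> assume \<omega>: "\<omega> \<in> space M"
  show "wealth_path 0 \<omega> = w" by (simp add: wealth_path_def)
  have Gc: "continuous_on UNIV G" by (rule DERIV_imp_continuous_on[OF G])
  have "continuous_on {0..b} (\<lambda>t. integral {0..t} (\<lambda>s. f' (x s \<omega>)))" for b
    by (intro indefinite_integral_continuous_1 integrable_continuous_real compose_continuous f' \<omega>) simp
  then show "continuous_on {0..} (\<lambda>t. wealth_path t \<omega>)"
    unfolding wealth_path_def
    by (intro continuous_intros continuous_on_atLeastI compose_continuous Gc \<omega>) auto
qed

text \<open>Agreement at each fixed time suffices for the growth rates, which involve the law of
  \<open>u t\<close> at one time only.\<close>

lemma log_wealth_unique:
  assumes u: "log_wealth M F z \<alpha> \<sigma> x w f u" and t: "0 \<le> t"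
  shows "AE \<omega> in M. u t \<omega> = wealth_path t \<omega>"
proof -
  obtain I where I: "has_ito_integral M F z t (\<lambda>s \<omega>. f (x s \<omega>) * \<sigma>) I"
    and eq: "AE \<omega> in M. set_integrable lborel {0..t} (\<lambda>s. f (x s \<omega>) * (- \<alpha> * x s \<omega>)) \<and>
        u t \<omega> = u 0 \<omega> + (LBINT s:{0..t}. f (x s \<omega>) * (- \<alpha> * x s \<omega>)) + I \<omega>"
    using u t unfolding log_wealth_def has_ito_differential_def by blast
  show ?thesis
    using eq has_ito_integral_unique[OF I ito_formula[OF G f f' K t]] AE_space
  proof eventually_elim
    case (elim \<omega>)
    then have "u 0 \<omega> = w" using u by (simp add: log_wealth_def)
    then show ?case
      using elim policy_drift(2)[OF elim(3) t] by (simp add: wealth_path_def)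
  qed
qed

end

section \<open>Time averages and the Poisson equation\<close>

lemma moment_growth:
  assumes C: "0 \<le> C" "\<And>t. 0 \<le> t \<Longrightarrow> fourth (x t) \<le> ennreal C"
    and Q: "Q \<in> borel_measurable borel" "\<And>y. \<bar>Q y\<bar> \<le> A * (1 + y\<^sup>2)" and t: "0 \<le> t"
  shows "integrable M (\<lambda>\<omega>. (Q (x t \<omega>))\<^sup>2)" "(\<integral>\<omega>. (Q (x t \<omega>))\<^sup>2 \<partial>M) \<le> 2 * A\<^sup>2 * (1 + C)"
proof -
  note [measurable] = Q(1) x_measurable[OF t]
  have "msq M (\<lambda>\<omega>. Q (x t \<omega>)) \<le> ennreal (2 * A\<^sup>2) * fourth (\<lambda>_. 1) + ennreal (2 * A\<^sup>2) * fourth (x t)"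
    unfolding msq_def
  proof (rule nn_integral_fourth_le)
    show "AE \<omega> in M. (Q (x t \<omega>))\<^sup>2 \<le> 2 * A\<^sup>2 * 1 ^ 4 + 2 * A\<^sup>2 * (x t \<omega>) ^ 4"
    proof (rule AE_I2)
      fix \<omega>
      let ?y = "x t \<omega>"
      have "(Q ?y)\<^sup>2 \<le> (A * (1 + ?y\<^sup>2))\<^sup>2" using Q(2)[of ?y] by (metis abs_ge_zero power2_abs power_mono)
      also have "\<dots> = A\<^sup>2 * (1 + ?y\<^sup>2)\<^sup>2" by (simp add: power_mult_distrib)
      also have "\<dots> \<le> A\<^sup>2 * (2 * 1\<^sup>2 + 2 * (?y\<^sup>2)\<^sup>2)"
        using power2_add_le[of 1 1 "?y\<^sup>2"] by (intro mult_left_mono) auto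
      also have "\<dots> = 2 * A\<^sup>2 * 1 ^ 4 + 2 * A\<^sup>2 * ?y ^ 4" by (simp add: algebra_simps)
      finally show "(Q ?y)\<^sup>2 \<le> 2 * A\<^sup>2 * 1 ^ 4 + 2 * A\<^sup>2 * ?y ^ 4" .
    qed
  qed auto
  also have "\<dots> \<le> ennreal (2 * A\<^sup>2) * ennreal 1 + ennreal (2 * A\<^sup>2) * ennreal C"
    using C(2)[OF t] by (intro add_mono mult_left_mono) (auto simp: emeasure_space_1)
  also have "\<dots> = ennreal (2 * A\<^sup>2 * 1 + 2 * A\<^sup>2 * C)" using C(1) by (intro ennreal_lincomb) auto
  also have "2 * A\<^sup>2 * 1 + 2 * A\<^sup>2 * C = 2 * A\<^sup>2 * (1 + C)" by (simp add: algebra_simps)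
  finally have le: "msq M (\<lambda>\<omega>. Q (x t \<omega>)) \<le> ennreal (2 * A\<^sup>2 * (1 + C))" .
  then have "msq M (\<lambda>\<omega>. Q (x t \<omega>)) < \<infinity>" by (rule le_less_trans) simp
  then show int: "integrable M (\<lambda>\<omega>. (Q (x t \<omega>))\<^sup>2)" by (subst (asm) msq_finite_iff) auto
  show "(\<integral>\<omega>. (Q (x t \<omega>))\<^sup>2 \<partial>M) \<le> 2 * A\<^sup>2 * (1 + C)"
    using le C(1) unfolding msq_eq_integral[OF int] by (subst (asm) ennreal_le_iff) auto
qed

text \<open>The standard deviation of the stationary law \<open>N(0, \<sigma>\<^sup>2 / (2 \<alpha>))\<close>.\<close>

definition stat_dev :: real where "stat_dev = \<sigma> / sqrt (2 * \<alpha>)"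

lemma stat_dev: "0 < stat_dev" "\<alpha> * stat_dev\<^sup>2 = \<sigma>\<^sup>2 / 2"
  using \<alpha> \<sigma> by (auto simp: stat_dev_def power_divide)

text \<open>Ito's formula for \<open>\<Psi>\<close>, with Stein's equation substituted for
  \<open>\<psi>'\<close>. Because of
  \<open>\<alpha> * stat_dev\<^sup>2 = \<sigma>\<^sup>2 / 2\<close> the two integrals of
  \<open>\<psi> (x s) * x s\<close> cancel.\<close>

lemma poisson_ito:
  assumes h: "continuous_on UNIV h" "\<And>y. \<bar>h y\<bar> \<le> B"
    and \<psi>: "\<And>y. (\<psi> has_real_derivative (h y - stat_mean stat_dev h + y * \<psi> y) / stat_dev\<^sup>2) (at y)"
    "\<And>y. \<bar>\<psi> y\<bar> \<le> L" "\<And>y. \<bar>y * \<psi> y\<bar> \<le> L"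
    and \<Psi>: "\<And>y. (\<Psi> has_real_derivative \<psi> y) (at y)" and t: "0 \<le> t"
  shows "has_ito_integral M F z t (\<lambda>s \<omega>. \<psi> (x s \<omega>) * \<sigma>) (\<lambda>\<omega>. \<Psi> (x t \<omega>) - \<Psi> (x 0 \<omega>)
    - \<alpha> * (integral {0..t} (\<lambda>s. h (x s \<omega>)) - stat_mean stat_dev h * t))"
proof (rule has_ito_integral_cong)
  let ?c = "stat_mean stat_dev h"
  let ?\<psi>' = "\<lambda>y. (h y - ?c + y * \<psi> y) / stat_dev\<^sup>2"
  have \<psi>c: "continuous_on UNIV \<psi>" by (rule DERIV_imp_continuous_on[OF \<psi>(1)])
  have \<psi>'c: "continuous_on UNIV ?\<psi>'"
    using stat_dev(1) by (intro continuous_intros h \<psi>c) auto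
  show "has_ito_integral M F z t (\<lambda>s \<omega>. \<psi> (x s \<omega>) * \<sigma>) (\<lambda>\<omega>. \<Psi> (x t \<omega>) - \<Psi> (x 0 \<omega>)
    - \<sigma>\<^sup>2 / 2 * integral {0..t} (\<lambda>s. ?\<psi>' (x s \<omega>)) + \<alpha> * integral {0..t} (\<lambda>s. \<psi> (x s \<omega>) * x s \<omega>))"
  proof (rule ito_formula[OF \<Psi> \<psi>(1) \<psi>'c _ t])
    \<comment> \<open>Ito's formula asks for a bounded derivative of \<open>\<psi>\<close>; this is
      where the bound on \<open>y * \<psi> y\<close> is used.\<close>
    fix y
    have "\<bar>h y - ?c + y * \<psi> y\<bar> \<le> B + \<bar>?c\<bar> + L" using h(2)[of y] \<psi>(3)[of y] by linarith
    then show "\<bar>?\<psi>' y\<bar> \<le> (B + \<bar>?c\<bar> + L) / stat_dev\<^sup>2"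
      by (simp add: divide_right_mono)
  qed
  fix \<omega> assume \<omega>: "\<omega> \<in> space M"
  have cont: "continuous_on {0..t} (\<lambda>s. h (x s \<omega>))" "continuous_on {0..t} (\<lambda>s. \<psi> (x s \<omega>) * x s \<omega>)"
    by (intro continuous_intros compose_continuous x_continuous_Icc h \<psi>c \<omega>; simp)+
  have "((\<lambda>s. h (x s \<omega>) - ?c + \<psi> (x s \<omega>) * x s \<omega>) has_integral
      integral {0..t} (\<lambda>s. h (x s \<omega>)) - ?c * t + integral {0..t} (\<lambda>s. \<psi> (x s \<omega>) * x s \<omega>)) {0..t}"
    using cont has_integral_const_real[of ?c 0 t] t
    by (intro has_integral_add has_integral_diff integrable_integral integrable_continuous_real)
      (auto simp: mult.commute)
  then have "((\<lambda>s. (h (x s \<omega>) - ?c + \<psi> (x s \<omega>) * x s \<omega>) * (1 / stat_dev\<^sup>2)) has_integral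
      (integral {0..t} (\<lambda>s. h (x s \<omega>)) - ?c * t + integral {0..t} (\<lambda>s. \<psi> (x s \<omega>) * x s \<omega>)) * (1 / stat_dev\<^sup>2)) {0..t}"
    by (rule has_integral_mult_left)
  moreover have "(\<lambda>s. ?\<psi>' (x s \<omega>)) = (\<lambda>s. (h (x s \<omega>) - ?c + \<psi> (x s \<omega>) * x s \<omega>) * (1 / stat_dev\<^sup>2))"
    by (simp add: mult.commute)
  ultimately have "integral {0..t} (\<lambda>s. ?\<psi>' (x s \<omega>))
      = (integral {0..t} (\<lambda>s. h (x s \<omega>)) - ?c * t + integral {0..t} (\<lambda>s. \<psi> (x s \<omega>) * x s \<omega>)) * (1 / stat_dev\<^sup>2)"
    by (simp only: integral_unique)
  then have "stat_dev\<^sup>2 * integral {0..t} (\<lambda>s. ?\<psi>' (x s \<omega>))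
      = integral {0..t} (\<lambda>s. h (x s \<omega>)) - ?c * t + integral {0..t} (\<lambda>s. \<psi> (x s \<omega>) * x s \<omega>)"
    using stat_dev(1) by simp
  then have "\<sigma>\<^sup>2 / 2 * integral {0..t} (\<lambda>s. ?\<psi>' (x s \<omega>))
      = \<alpha> * (integral {0..t} (\<lambda>s. h (x s \<omega>)) - ?c * t + integral {0..t} (\<lambda>s. \<psi> (x s \<omega>) * x s \<omega>))"
    by (simp only: stat_dev(2)[symmetric] mult.assoc)
  then show "\<Psi> (x t \<omega>) - \<Psi> (x 0 \<omega>)
    - \<sigma>\<^sup>2 / 2 * integral {0..t} (\<lambda>s. ?\<psi>' (x s \<omega>)) + \<alpha> * integral {0..t} (\<lambda>s. \<psi> (x s \<omega>) * x s \<omega>)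
    = \<Psi> (x t \<omega>) - \<Psi> (x 0 \<omega>) - \<alpha> * (integral {0..t} (\<lambda>s. h (x s \<omega>)) - ?c * t)"
    by (simp add: algebra_simps)
qed

lemma path_integral_integrable:
  fixes h :: "real \<Rightarrow> real"
  assumes h: "continuous_on UNIV h" "\<And>y. \<bar>h y\<bar> \<le> B" and t: "0 \<le> t"
  shows "integrable M (\<lambda>\<omega>. integral {0..t} (\<lambda>s. h (x s \<omega>)))"
proof (rule integrable_const_bound[of _ "B * t"])
  show "AE \<omega> in M. norm (integral {0..t} (\<lambda>s. h (x s \<omega>))) \<le> B * t"
  proof (rule AE_I2)
    fix \<omega> assume "\<omega> \<in> space M"
    then have "norm (integral {0..t} (\<lambda>s. h (x s \<omega>))) \<le> B * (t - 0)"
      using t h(2) by (intro integral_bound compose_continuous h) auto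
    then show "norm (integral {0..t} (\<lambda>s. h (x s \<omega>))) \<le> B * t" by simp
  qed
  show "(\<lambda>\<omega>. integral {0..t} (\<lambda>s. h (x s \<omega>))) \<in> borel_measurable M"
    by (rule F_measurable[OF path_integral_F[OF h(1) t]])
qed

lemma abs_expectation_le:
  fixes X :: "'a \<Rightarrow> real"
  assumes [measurable]: "X \<in> borel_measurable M" and X: "integrable M (\<lambda>\<omega>. (X \<omega>)\<^sup>2)" "(\<integral>\<omega>. (X \<omega>)\<^sup>2 \<partial>M) \<le> c"
  shows "integrable M X" "\<bar>\<integral>\<omega>. X \<omega> \<partial>M\<bar> \<le> 1 + c"
proof -
  show int: "integrable M X" by (rule square_integrable_imp_integrable[OF assms(1) X(1)])
  have "(\<integral>\<omega>. X \<omega> \<partial>M)\<^sup>2 \<le> c"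
    using variance_eq[OF int X(1)] variance_positive[of X] X(2) by simp
  moreover have "0 \<le> (\<bar>\<integral>\<omega>. X \<omega> \<partial>M\<bar> - 1)\<^sup>2" by simp
  then have "2 * \<bar>\<integral>\<omega>. X \<omega> \<partial>M\<bar> \<le> 1 + (\<integral>\<omega>. X \<omega> \<partial>M)\<^sup>2" by (simp add: power2_diff)
  ultimately show "\<bar>\<integral>\<omega>. X \<omega> \<partial>M\<bar> \<le> 1 + c" by linarith
qed

lemma tendsto_bounded_over_time:
  assumes "\<And>t. 0 \<le> t \<Longrightarrow> \<bar>q t\<bar> \<le> (c :: real)"
  shows "((\<lambda>t. q t / t) \<longlongrightarrow> 0) at_top"
proof (rule Lim_null_comparison)
  show "\<forall>\<^sub>F t in at_top. norm (q t / t) \<le> c / t"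
    using eventually_gt_at_top[of 0]
    by eventually_elim (use assms in \<open>auto simp: divide_right_mono\<close>)
  show "((\<lambda>t. c / t) \<longlongrightarrow> 0) at_top" by real_asymp
qed

text \<open>Take expectations in \<open>poisson_ito\<close>: the stochastic integral has mean 0 and
  the boundary terms have bounded means, so the time average misses the stationary mean by a term of
  order \<open>1 / t\<close>.\<close>

lemma ergodic_mean:
  fixes h :: "real \<Rightarrow> real"
  assumes h: "continuous_on UNIV h" "\<And>y. \<bar>h y\<bar> \<le> B"
  shows "((\<lambda>t. (\<integral>\<omega>. integral {0..t} (\<lambda>s. h (x s \<omega>)) \<partial>M) / t) \<longlongrightarrow> stat_mean stat_dev h) at_top"
proof -
  let ?c = "stat_mean stat_dev h"
  obtain C where C: "0 \<le> C" "\<And>t. 0 \<le> t \<Longrightarrow> fourth (x t) \<le> ennreal C"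
    using fourth_moment_bounded by blast
  obtain \<psi> L where \<psi>: "\<And>y. (\<psi> has_real_derivative (h y - ?c + y * \<psi> y) / stat_dev\<^sup>2) (at y)"
    "\<And>y. \<bar>\<psi> y\<bar> \<le> L" "\<And>y. \<bar>y * \<psi> y\<bar> \<le> L"
    using stein_equation[OF stat_dev(1) h] by blast
  have \<psi>c: "continuous_on UNIV \<psi>" by (rule DERIV_imp_continuous_on[OF \<psi>(1)])
  obtain \<Psi> where \<Psi>: "\<And>y. (\<Psi> has_real_derivative \<psi> y) (at y)" "\<Psi> 0 = 0"
    using antiderivative_exists[OF \<psi>c] by blast
  have \<Psi>m[measurable]: "\<Psi> \<in> borel_measurable borel"
    by (rule borel_measurable_continuous_onI[OF DERIV_imp_continuous_on[OF \<Psi>(1)]])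
  have L: "0 \<le> L" using \<psi>(2)[of 0] by simp
  have \<Psi>b: "\<bar>\<Psi> y\<bar> \<le> L * (1 + y\<^sup>2)" for y
    using antiderivative_bound[OF \<Psi>, of L 0] \<psi>(2) L by simp
  let ?E = "\<lambda>t. \<integral>\<omega>. \<Psi> (x t \<omega>) \<partial>M"
  define D where "D = 1 + 2 * L\<^sup>2 * (1 + C)"
  have E: "integrable M (\<lambda>\<omega>. \<Psi> (x t \<omega>))" "\<bar>?E t\<bar> \<le> D" if t: "0 \<le> t" for t
  proof -
    have m: "(\<lambda>\<omega>. \<Psi> (x t \<omega>)) \<in> borel_measurable M" using t by simp
    note m2 = moment_growth[OF C(1) _ \<Psi>m \<Psi>b t, OF C(2)]
    show "integrable M (\<lambda>\<omega>. \<Psi> (x t \<omega>))" "\<bar>?E t\<bar> \<le> D"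
      unfolding D_def by (rule abs_expectation_le[OF m m2]; assumption)+
  qed
  have mean: "(\<integral>\<omega>. integral {0..t} (\<lambda>s. h (x s \<omega>)) \<partial>M) = ?c * t + (?E t - ?E 0) / \<alpha>" if t: "0 \<le> t" for t
  proof -
    have "0 = (\<integral>\<omega>. \<Psi> (x t \<omega>) - \<Psi> (x 0 \<omega>) - \<alpha> * (integral {0..t} (\<lambda>s. h (x s \<omega>)) - ?c * t) \<partial>M)"
      using expectation_ito_integral(3)[OF poisson_ito[OF h \<psi> \<Psi>(1) t]] by simp
    also have "\<dots> = ?E t - ?E 0 - \<alpha> * ((\<integral>\<omega>. integral {0..t} (\<lambda>s. h (x s \<omega>)) \<partial>M) - ?c * t)"
      using E(1)[OF t] E(1)[of 0] path_integral_integrable[OF h t] by (simp add: prob_space)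
    finally show ?thesis using \<alpha> by (simp add: field_simps)
  qed
  have "((\<lambda>t. ?c + ((?E t - ?E 0) / \<alpha>) / t) \<longlongrightarrow> ?c + 0) at_top"
  proof (intro tendsto_add tendsto_const tendsto_bounded_over_time)
    fix t :: real assume t: "0 \<le> t"
    have "\<bar>?E t - ?E 0\<bar> \<le> 2 * D"
      using E(2)[OF t] E(2)[OF order_refl] by linarith
    then show "\<bar>(?E t - ?E 0) / \<alpha>\<bar> \<le> 2 * D / \<alpha>"
      using \<alpha> by (simp add: divide_right_mono)
  qed
  moreover have "\<forall>\<^sub>F t in at_top. ?c + ((?E t - ?E 0) / \<alpha>) / t
      = (\<integral>\<omega>. integral {0..t} (\<lambda>s. h (x s \<omega>)) \<partial>M) / t"
    using eventually_gt_at_top[of 0]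
    by eventually_elim (simp add: mean add_divide_distrib)
  ultimately show ?thesis
    by (simp add: tendsto_cong)
qed

text \<open>Rephrases the isometry with the time integral of a bounded function of \<open>x\<close>,
  so that \<open>ergodic_mean\<close> applies to the second moment of the martingale.\<close>

lemma isometry_policy:
  assumes \<psi>: "continuous_on UNIV \<psi>" "\<And>y. \<bar>\<psi> y\<bar> \<le> L" and t: "0 \<le> t"
    and J: "has_ito_integral M F z t (\<lambda>s \<omega>. \<psi> (x s \<omega>) * \<sigma>) J"
  shows "(\<integral>\<omega>. (J \<omega>)\<^sup>2 \<partial>M) = \<sigma>\<^sup>2 * (\<integral>\<omega>. integral {0..t} (\<lambda>s. (\<psi> (x s \<omega>))\<^sup>2) \<partial>M)"
proof -
  let ?A = "\<lambda>\<omega>. integral {0..t} (\<lambda>s. (\<psi> (x s \<omega>))\<^sup>2)"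
  have H: "ito_integrand M F t (\<lambda>s \<omega>. \<psi> (x s \<omega>) * \<sigma>)" using J by (simp add: has_ito_integral_def)
  have \<psi>2: "continuous_on UNIV (\<lambda>y. (\<psi> y)\<^sup>2)" "\<And>y. \<bar>(\<psi> y)\<^sup>2\<bar> \<le> L\<^sup>2"
    using \<psi> by (auto intro!: continuous_intros simp: abs_le_square_iff[symmetric] intro: order_trans[OF _ abs_ge_self])
  have A: "integrable M ?A" by (rule path_integral_integrable[OF \<psi>2 t])
  have A_nonneg: "0 \<le> ?A \<omega>" if "\<omega> \<in> space M" for \<omega>
    by (intro integral_nonneg integrable_continuous_real compose_continuous[OF \<psi>2(1) that]) auto
  have "ennreal (\<integral>\<omega>. (J \<omega>)\<^sup>2 \<partial>M) = msq (path_space t) (\<lambda>(s, \<omega>). \<psi> (x s \<omega>) * \<sigma>)"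
    using msq_eq_integral[OF expectation_ito_integral(1)[OF J]] ito_isometry[OF J] by simp
  also have "\<dots> = (\<integral>\<^sup>+\<omega>. (\<integral>\<^sup>+s\<in>{0..t}. ennreal ((\<psi> (x s \<omega>) * \<sigma>)\<^sup>2) \<partial>lborel) \<partial>M)"
    by (rule msq_path_space[OF ito_integrand_msq(1)[OF H]])
  also have "\<dots> = (\<integral>\<^sup>+\<omega>. ennreal (\<sigma>\<^sup>2 * ?A \<omega>) \<partial>M)"
  proof (rule nn_integral_cong)
    fix \<omega> assume \<omega>: "\<omega> \<in> space M"
    have cont: "continuous_on {0..t} (\<lambda>s. (\<psi> (x s \<omega>) * \<sigma>)\<^sup>2)"
      by (intro continuous_intros compose_continuous \<psi> \<omega>) simp
    have "(\<integral>\<^sup>+s\<in>{0..t}. ennreal ((\<psi> (x s \<omega>) * \<sigma>)\<^sup>2) \<partial>lborel)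
        = (\<integral>\<^sup>+s. ennreal (indicator {0..t} s *\<^sub>R (\<psi> (x s \<omega>) * \<sigma>)\<^sup>2) \<partial>lborel)"
      by (intro nn_integral_cong) (auto split: split_indicator)
    also have "\<dots> = ennreal (LBINT s:{0..t}. (\<psi> (x s \<omega>) * \<sigma>)\<^sup>2)"
      using LBINT_path(1)[OF cont] unfolding set_integrable_def set_lebesgue_integral_def
      by (intro nn_integral_eq_integral) auto
    also have "(LBINT s:{0..t}. (\<psi> (x s \<omega>) * \<sigma>)\<^sup>2) = integral {0..t} (\<lambda>s. \<sigma>\<^sup>2 * (\<psi> (x s \<omega>))\<^sup>2)"
      unfolding LBINT_path(2)[OF cont] by (simp add: power_mult_distrib mult.commute)
    finally show "(\<integral>\<^sup>+s\<in>{0..t}. ennreal ((\<psi> (x s \<omega>) * \<sigma>)\<^sup>2) \<partial>lborel) = ennreal (\<sigma>\<^sup>2 * ?A \<omega>)"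
      by (simp only: integral_mult_right)
  qed
  also have "\<dots> = ennreal (\<integral>\<omega>. \<sigma>\<^sup>2 * ?A \<omega> \<partial>M)"
    using A A_nonneg by (intro nn_integral_eq_integral) auto
  finally have "(\<integral>\<omega>. (J \<omega>)\<^sup>2 \<partial>M) = (\<integral>\<omega>. \<sigma>\<^sup>2 * ?A \<omega> \<partial>M)"
    using A_nonneg by (subst (asm) ennreal_inj) (auto intro!: integral_nonneg_AE)
  then show ?thesis by simp
qed

text \<open>\<open>B\<close> is bounded in mean square and \<open>J\<close> is of order
  \<open>sqrt t\<close>, so only \<open>J\<close> contributes to the variance rate, and the
  deterministic drift alone to the mean rate.\<close>

lemma growth_rates_perturbed_martingale:
  fixes B J :: "real \<Rightarrow> 'a \<Rightarrow> real" and k b :: real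
  assumes u: "\<And>t. 0 \<le> t \<Longrightarrow> u t \<in> borel_measurable M"
    "\<And>t. 0 \<le> t \<Longrightarrow> AE \<omega> in M. u t \<omega> = w - k * t + B t \<omega> + b * J t \<omega>"
    and B: "\<And>t. 0 \<le> t \<Longrightarrow> B t \<in> borel_measurable M" "\<And>t. 0 \<le> t \<Longrightarrow> integrable M (\<lambda>\<omega>. (B t \<omega>)\<^sup>2)"
    "\<And>t. 0 \<le> t \<Longrightarrow> (\<integral>\<omega>. (B t \<omega>)\<^sup>2 \<partial>M) \<le> D"
    and J: "\<And>t. 0 \<le> t \<Longrightarrow> J t \<in> borel_measurable M" "\<And>t. 0 \<le> t \<Longrightarrow> integrable M (\<lambda>\<omega>. (J t \<omega>)\<^sup>2)"
    "\<And>t. 0 \<le> t \<Longrightarrow> (\<integral>\<omega>. J t \<omega> \<partial>M) = 0"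
    "((\<lambda>t. (\<integral>\<omega>. (J t \<omega>)\<^sup>2 \<partial>M) / t) \<longlongrightarrow> v) at_top"
  shows "growth_rates M u (- k) (b\<^sup>2 * v)"
proof -
  let ?Y = "\<lambda>t \<omega>. B t \<omega> + b * J t \<omega>"
  let ?BB = "\<lambda>t. \<integral>\<omega>. (B t \<omega>)\<^sup>2 \<partial>M" and ?JJ = "\<lambda>t. \<integral>\<omega>. (J t \<omega>)\<^sup>2 \<partial>M" and ?BJ = "\<lambda>t. \<integral>\<omega>. B t \<omega> * J t \<omega> \<partial>M"
  let ?EB = "\<lambda>t. \<integral>\<omega>. B t \<omega> \<partial>M"
  note abs_B = abs_expectation_le[OF B]
  have intJ: "integrable M (J t)" if "0 \<le> t" for t
    by (rule square_integrable_imp_integrable[OF J(1,2)[OF that]])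
  have intBJ: "integrable M (\<lambda>\<omega>. B t \<omega> * J t \<omega>)" if "0 \<le> t" for t
    by (rule integrable_mult_of_squares[OF B(1)[OF that] J(1)[OF that] B(2)[OF that] J(2)[OF that]])
  have Y2_eq: "(\<lambda>\<omega>. (?Y t \<omega>)\<^sup>2) = (\<lambda>\<omega>. (B t \<omega>)\<^sup>2 + (2 * b * (B t \<omega> * J t \<omega>) + b\<^sup>2 * (J t \<omega>)\<^sup>2))" for t
    by (auto simp: power2_sum power_mult_distrib)
  have Y: "integrable M (?Y t)" "integrable M (\<lambda>\<omega>. (?Y t \<omega>)\<^sup>2)" "(\<integral>\<omega>. ?Y t \<omega> \<partial>M) = ?EB t"
    "(\<integral>\<omega>. (?Y t \<omega>)\<^sup>2 \<partial>M) = ?BB t + (2 * b * ?BJ t + b\<^sup>2 * ?JJ t)" if t: "0 \<le> t" for t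
    unfolding Y2_eq using abs_B(1)[OF t t t] intJ[OF t] intBJ[OF t] B(2)[OF t] J(2,3)[OF t] by auto
  have mu: "integrable M (u t)" "integrable M (\<lambda>\<omega>. (u t \<omega>)\<^sup>2)" "(\<integral>\<omega>. u t \<omega> \<partial>M) = w - k * t + ?EB t"
    "variance (u t) = ?BB t - (?EB t)\<^sup>2 + (2 * b * ?BJ t + b\<^sup>2 * ?JJ t)" if t: "0 \<le> t" for t
  proof -
    let ?a = "w - k * t"
    note [measurable] = u(1)[OF t] B(1)[OF t] J(1)[OF t]
    have AE: "AE \<omega> in M. u t \<omega> = ?a + ?Y t \<omega>" using u(2)[OF t] by (simp add: add.assoc)
    have "integrable M (\<lambda>\<omega>. ?a + ?Y t \<omega>)" using Y(1)[OF t] by simp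
    then show "integrable M (u t)"
      by (rule integrable_cong_AE_imp) (use AE in auto)
    have "integrable M (\<lambda>\<omega>. (?a + ?Y t \<omega>)\<^sup>2)"
      unfolding power2_sum[of ?a] using Y(1,2)[OF t] by simp
    then show "integrable M (\<lambda>\<omega>. (u t \<omega>)\<^sup>2)"
      by (rule integrable_cong_AE_imp) (use AE in auto)
    have "(\<integral>\<omega>. u t \<omega> \<partial>M) = (\<integral>\<omega>. ?a + ?Y t \<omega> \<partial>M)"
      by (rule integral_cong_AE) (use AE in auto)
    also have "\<dots> = ?a + ?EB t"
      using Y(1,3)[OF t] by (subst Bochner_Integration.integral_add) (auto simp: prob_space)
    finally show Eu: "(\<integral>\<omega>. u t \<omega> \<partial>M) = w - k * t + ?EB t" .
    \<comment> \<open>The deterministic part drops out of the centred variable.\<close>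
    have "variance (u t) = variance (?Y t)"
      unfolding Eu Y(3)[OF t] by (rule integral_cong_AE) (use AE in auto)
    also have "\<dots> = (\<integral>\<omega>. (?Y t \<omega>)\<^sup>2 \<partial>M) - (?EB t)\<^sup>2"
      using variance_eq[OF Y(1,2)[OF t]] Y(3)[OF t] by simp
    finally show "variance (u t) = ?BB t - (?EB t)\<^sup>2 + (2 * b * ?BJ t + b\<^sup>2 * ?JJ t)"
      using Y(4)[OF t] by simp
  qed
  have lim_mean: "((\<lambda>t. - k + (w + ?EB t) / t) \<longlongrightarrow> - k + 0) at_top"
  proof (intro tendsto_add tendsto_const tendsto_bounded_over_time)
    fix t :: real assume t: "0 \<le> t"
    show "\<bar>w + ?EB t\<bar> \<le> \<bar>w\<bar> + (1 + D)" using abs_B(2)[OF t t t] by linarith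
  qed
  have lim_var1: "((\<lambda>t. (?BB t - (?EB t)\<^sup>2) / t) \<longlongrightarrow> 0) at_top"
  proof (rule tendsto_bounded_over_time)
    fix t :: real assume t: "0 \<le> t"
    have "0 \<le> ?BB t - (?EB t)\<^sup>2"
      using variance_eq[OF abs_B(1)[OF t t t] B(2)[OF t]] variance_positive[of "B t"] by simp
    moreover have "0 \<le> (?EB t)\<^sup>2" by simp
    ultimately show "\<bar>?BB t - (?EB t)\<^sup>2\<bar> \<le> D" using B(3)[OF t] by linarith
  qed
  have lim_var2: "((\<lambda>t. ?BJ t / t) \<longlongrightarrow> 0) at_top"
  proof (rule Lim_null_comparison)
    show "\<forall>\<^sub>F t in at_top. norm (?BJ t / t) \<le> (D + ?JJ t / t) * (1 / (2 * sqrt t))"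
      using eventually_gt_at_top[of 0]
    proof eventually_elim
      case (elim t)
      then have t: "0 \<le> t" and r: "0 < sqrt t" by auto
      \<comment> \<open>With weight \<open>sqrt t\<close> both squares contribute order
        \<open>sqrt t\<close> to the mixed moment, which therefore vanishes after division by
        \<open>t\<close>.\<close>
      have pq: "\<bar>p * q\<bar> \<le> sqrt t / 2 * p\<^sup>2 + 1 / (2 * sqrt t) * q\<^sup>2" for p q
        using young[OF r, of "\<bar>p\<bar>" "\<bar>q\<bar>"] by (simp add: abs_mult add_divide_distrib mult.commute)
      have "\<bar>?BJ t\<bar> \<le> (\<integral>\<omega>. \<bar>B t \<omega> * J t \<omega>\<bar> \<partial>M)" by (rule integral_abs_bound)
      also have "\<dots> \<le> (\<integral>\<omega>. sqrt t / 2 * (B t \<omega>)\<^sup>2 + 1 / (2 * sqrt t) * (J t \<omega>)\<^sup>2 \<partial>M)"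
        using intBJ[OF t] B(2)[OF t] J(2)[OF t] pq by (intro Bochner_Integration.integral_mono) auto
      also have "\<dots> = sqrt t / 2 * ?BB t + 1 / (2 * sqrt t) * ?JJ t"
        using B(2)[OF t] J(2)[OF t] by simp
      also have "\<dots> \<le> sqrt t / 2 * D + 1 / (2 * sqrt t) * ?JJ t"
        using B(3)[OF t] r by (intro add_right_mono mult_left_mono) auto
      also have "\<dots> = ((D + ?JJ t / t) * (1 / (2 * sqrt t))) * t"
      proof -
        have "sqrt t = t / sqrt t" using elim by (simp add: real_div_sqrt)
        then have "sqrt t / 2 * D = t / sqrt t / 2 * D" by simp
        also have "\<dots> + 1 / (2 * sqrt t) * ?JJ t = ((D + ?JJ t / t) * (1 / (2 * sqrt t))) * t"
          using elim r by (simp add: field_simps)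
        finally show ?thesis .
      qed
      finally show ?case using elim by (simp add: pos_divide_le_eq)
    qed
    have "((\<lambda>t. 1 / (2 * sqrt t)) \<longlongrightarrow> 0) at_top" by real_asymp
    from tendsto_mult[OF tendsto_add[OF tendsto_const J(4)] this]
    show "((\<lambda>t. (D + ?JJ t / t) * (1 / (2 * sqrt t))) \<longlongrightarrow> 0) at_top" by simp
  qed
  have "((\<lambda>t. (?BB t - (?EB t)\<^sup>2) / t + (2 * b * (?BJ t / t) + b\<^sup>2 * (?JJ t / t)))
      \<longlongrightarrow> 0 + (2 * b * 0 + b\<^sup>2 * v)) at_top"
    by (intro tendsto_add tendsto_mult tendsto_const lim_var1 lim_var2 J(4))
  moreover have "\<forall>\<^sub>F t in at_top. (?BB t - (?EB t)\<^sup>2) / t + (2 * b * (?BJ t / t) + b\<^sup>2 * (?JJ t / t))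
      = variance (u t) / t"
    using eventually_gt_at_top[of 0]
    by eventually_elim (simp add: mu(4) add_divide_distrib)
  ultimately have "((\<lambda>t. variance (u t) / t) \<longlongrightarrow> b\<^sup>2 * v) at_top"
    by (simp add: tendsto_cong)
  moreover have "\<forall>\<^sub>F t in at_top. - k + (w + ?EB t) / t = expectation (u t) / t"
    using eventually_gt_at_top[of 0]
    by eventually_elim (simp add: mu(3) add_divide_distrib diff_divide_distrib)
  then have "((\<lambda>t. expectation (u t) / t) \<longlongrightarrow> - k) at_top"
    using lim_mean by (simp add: tendsto_cong)
  ultimately show ?thesis
    using mu(1,2) by (simp add: growth_rates_def)
qed

text \<open>Instantiates the preceding lemma: the Poisson equation replaces the fluctuating integral
  of \<open>f'\<close> by a martingale. The ergodic mean, now for the square of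
  \<open>\<psi>\<close>, evaluates the growth of its second moment.\<close>

lemma growth_rates_log_wealth:
  fixes f f' :: "real \<Rightarrow> real"
  assumes f: "\<And>y. (f has_real_derivative f' y) (at y)"
    and f': "continuous_on UNIV f'" and K: "\<And>y. \<bar>f' y\<bar> \<le> K"
    and \<psi>: "\<And>y. (\<psi> has_real_derivative (f' y - stat_mean stat_dev f' + y * \<psi> y) / stat_dev\<^sup>2) (at y)"
    "\<And>y. \<bar>\<psi> y\<bar> \<le> L" "\<And>y. \<bar>y * \<psi> y\<bar> \<le> L"
    and u: "log_wealth M F z \<alpha> \<sigma> x w f u"
  shows "growth_rates M u (- (\<sigma>\<^sup>2 / 2 * stat_mean stat_dev f'))
    ((\<sigma>\<^sup>2 / (2 * \<alpha>))\<^sup>2 * (\<sigma>\<^sup>2 * stat_mean stat_dev (\<lambda>y. (\<psi> y)\<^sup>2)))"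
proof -
  let ?c = "stat_mean stat_dev f'" and ?b = "\<sigma>\<^sup>2 / (2 * \<alpha>)"
  obtain C where C: "0 \<le> C" "\<And>t. 0 \<le> t \<Longrightarrow> fourth (x t) \<le> ennreal C"
    using fourth_moment_bounded by blast
  have fc: "continuous_on UNIV f" by (rule DERIV_imp_continuous_on[OF f])
  have \<psi>c: "continuous_on UNIV \<psi>" by (rule DERIV_imp_continuous_on[OF \<psi>(1)])
  obtain G where G: "\<And>y. (G has_real_derivative f y) (at y)" "G 0 = 0"
    using antiderivative_exists[OF fc] by blast
  obtain \<Psi> where \<Psi>: "\<And>y. (\<Psi> has_real_derivative \<psi> y) (at y)" "\<Psi> 0 = 0"
    using antiderivative_exists[OF \<psi>c] by blast
  have L: "0 \<le> L" using \<psi>(2)[of 0] by simp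
  have K0: "0 \<le> K" using K[of 0] by simp
  have b: "0 \<le> ?b" using \<alpha> by simp
  \<comment> \<open>The wealth contains the integral of \<open>f'\<close> with factor
    \<open>- \<sigma>\<^sup>2 / 2\<close>, the martingale \<open>?J\<close> contains it with factor
    \<open>- \<alpha>\<close>. The ratio \<open>?b\<close> lets \<open>?b * ?J\<close> absorb it;
    \<open>Q\<close> collects what remains at the two ends of the time interval.\<close>
  define Q where "Q y = G y - ?b * \<Psi> y" for y
  have Qm: "Q \<in> borel_measurable borel"
    unfolding Q_def[abs_def]
    by (intro borel_measurable_continuous_onI continuous_intros DERIV_imp_continuous_on[OF G(1)]
      DERIV_imp_continuous_on[OF \<Psi>(1)])
  define A where "A = (\<bar>f 0\<bar> + K) + ?b * L"
  have Qb: "\<bar>Q y\<bar> \<le> A * (1 + y\<^sup>2)" for y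
  proof -
    have "\<bar>G y\<bar> \<le> (\<bar>f 0\<bar> + K) * (1 + y\<^sup>2)"
      by (rule antiderivative_bound[OF G]) (use linear_growth(1)[OF f K] K0 in auto)
    moreover have "\<bar>\<Psi> y\<bar> \<le> L * (1 + y\<^sup>2)"
      using antiderivative_bound[OF \<Psi>, of L 0] \<psi>(2) L by simp
    then have "?b * \<bar>\<Psi> y\<bar> \<le> ?b * (L * (1 + y\<^sup>2))" using b by (rule mult_left_mono)
    moreover have "\<bar>Q y\<bar> \<le> \<bar>G y\<bar> + ?b * \<bar>\<Psi> y\<bar>"
      unfolding Q_def by (metis abs_mult abs_of_nonneg abs_triangle_ineq4 b)
    moreover have "A * (1 + y\<^sup>2) = (\<bar>f 0\<bar> + K) * (1 + y\<^sup>2) + ?b * (L * (1 + y\<^sup>2))"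
      unfolding A_def by (simp only: distrib_right mult.assoc)
    ultimately show ?thesis by linarith
  qed
  let ?B = "\<lambda>t \<omega>. Q (x t \<omega>) - Q (x 0 \<omega>)"
  let ?J = "\<lambda>t \<omega>. \<Psi> (x t \<omega>) - \<Psi> (x 0 \<omega>) - \<alpha> * (integral {0..t} (\<lambda>s. f' (x s \<omega>)) - ?c * t)"
  note J = poisson_ito[OF f' K \<psi> \<Psi>(1)]
  have Q2: "integrable M (\<lambda>\<omega>. (Q (x t \<omega>))\<^sup>2)" "(\<integral>\<omega>. (Q (x t \<omega>))\<^sup>2 \<partial>M) \<le> 2 * A\<^sup>2 * (1 + C)"
    if "0 \<le> t" for t
    by (rule moment_growth[OF C(1) _ Qm Qb that]; rule C(2); assumption)+
  have QxM: "(\<lambda>\<omega>. Q (x t \<omega>)) \<in> borel_measurable M" if "0 \<le> t" for t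
    by (rule measurable_compose[OF x_measurable[OF that] Qm])
  show ?thesis
  proof (rule growth_rates_perturbed_martingale[where w = w and B = ?B and J = ?J])
    fix t :: real assume t: "0 \<le> t"
    show "u t \<in> borel_measurable M"
      using u t by (auto simp: log_wealth_def has_ito_differential_def intro: F_measurable)
    show "AE \<omega> in M. u t \<omega> = w - \<sigma>\<^sup>2 / 2 * ?c * t + ?B t \<omega> + ?b * ?J t \<omega>"
      using log_wealth_unique[OF G(1) f f' K u t]
    proof eventually_elim
      case (elim \<omega>)
      have "?b * \<alpha> = \<sigma>\<^sup>2 / 2" using \<alpha> by simp
      then have "?b * ?J t \<omega> = ?b * \<Psi> (x t \<omega>) - ?b * \<Psi> (x 0 \<omega>)
          - \<sigma>\<^sup>2 / 2 * (integral {0..t} (\<lambda>s. f' (x s \<omega>)) - ?c * t)"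
        by (simp only: right_diff_distrib mult.assoc[symmetric])
      then show ?case
        unfolding elim wealth_path_def[OF G(1) f f' K] Q_def by (simp add: right_diff_distrib)
    qed
    show "?B t \<in> borel_measurable M" using QxM[OF t] QxM[of 0] by simp
    have B2: "(?B t \<omega>)\<^sup>2 \<le> 2 * (Q (x t \<omega>))\<^sup>2 + 2 * (Q (x 0 \<omega>))\<^sup>2" for \<omega>
      using power2_add_le[of 1 "Q (x t \<omega>)" "- Q (x 0 \<omega>)"] by simp
    have int: "integrable M (\<lambda>\<omega>. 2 * (Q (x t \<omega>))\<^sup>2 + 2 * (Q (x 0 \<omega>))\<^sup>2)"
      using Q2(1)[OF t] Q2(1)[of 0] by simp
    show intB: "integrable M (\<lambda>\<omega>. (?B t \<omega>)\<^sup>2)"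
      by (rule Bochner_Integration.integrable_bound[OF int]) (use B2 QxM[OF t] QxM[of 0] in auto)
    have "(\<integral>\<omega>. (?B t \<omega>)\<^sup>2 \<partial>M) \<le> (\<integral>\<omega>. 2 * (Q (x t \<omega>))\<^sup>2 + 2 * (Q (x 0 \<omega>))\<^sup>2 \<partial>M)"
      using intB int B2 by (intro Bochner_Integration.integral_mono) auto
    also have "\<dots> = 2 * (\<integral>\<omega>. (Q (x t \<omega>))\<^sup>2 \<partial>M) + 2 * (\<integral>\<omega>. (Q (x 0 \<omega>))\<^sup>2 \<partial>M)"
      using Q2(1)[OF t] Q2(1)[of 0] by simp
    also have "\<dots> \<le> 8 * A\<^sup>2 * (1 + C)" using Q2(2)[OF t] Q2(2)[of 0] by simp
    finally show "(\<integral>\<omega>. (?B t \<omega>)\<^sup>2 \<partial>M) \<le> 8 * A\<^sup>2 * (1 + C)" .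
    show "?J t \<in> borel_measurable M" using J[OF t] by (simp add: has_ito_integral_def)
    show "integrable M (\<lambda>\<omega>. (?J t \<omega>)\<^sup>2)" "(\<integral>\<omega>. ?J t \<omega> \<partial>M) = 0"
      by (rule expectation_ito_integral[OF J[OF t]])+
  next
    have \<psi>2: "continuous_on UNIV (\<lambda>y. (\<psi> y)\<^sup>2)" "\<bar>(\<psi> y)\<^sup>2\<bar> \<le> L\<^sup>2" for y
      using \<psi>c power_mono[OF \<psi>(2)[of y], of 2] by (auto intro!: continuous_intros)
    have "((\<lambda>t. \<sigma>\<^sup>2 * ((\<integral>\<omega>. integral {0..t} (\<lambda>s. (\<psi> (x s \<omega>))\<^sup>2) \<partial>M) / t))
        \<longlongrightarrow> \<sigma>\<^sup>2 * stat_mean stat_dev (\<lambda>y. (\<psi> y)\<^sup>2)) at_top"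
      by (intro tendsto_mult tendsto_const ergodic_mean[OF \<psi>2])
    moreover have "\<forall>\<^sub>F t in at_top. \<sigma>\<^sup>2 * ((\<integral>\<omega>. integral {0..t} (\<lambda>s. (\<psi> (x s \<omega>))\<^sup>2) \<partial>M) / t)
        = (\<integral>\<omega>. (?J t \<omega>)\<^sup>2 \<partial>M) / t"
      using eventually_ge_at_top[of 0]
    proof eventually_elim
      case (elim t)
      show ?case
        unfolding isometry_policy[OF \<psi>c \<psi>(2) elim J[OF elim]] by simp
    qed
    ultimately show "((\<lambda>t. (\<integral>\<omega>. (?J t \<omega>)\<^sup>2 \<partial>M) / t) \<longlongrightarrow> \<sigma>\<^sup>2 * stat_mean stat_dev (\<lambda>y. (\<psi> y)\<^sup>2)) at_top"
      by (rule Lim_transform_eventually)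
  qed
qed

lemma log_wealth_exists:
  fixes f f' :: "real \<Rightarrow> real"
  assumes f: "\<And>y. (f has_real_derivative f' y) (at y)"
    and f': "continuous_on UNIV f'" and K: "\<And>y. \<bar>f' y\<bar> \<le> K"
  shows "\<exists>u. log_wealth M F z \<alpha> \<sigma> x w f u"
proof -
  have "continuous_on UNIV f" by (rule DERIV_imp_continuous_on[OF f])
  then obtain G where "\<And>y. (G has_real_derivative f y) (at y)" "G 0 = 0"
    using antiderivative_exists by blast
  then show ?thesis using log_wealth_wealth_path[OF _ f f' K] by blast
qed

text \<open>The lower limit is a genuine limit here, which reduces the comparison of utilities to
  that of the two rates.\<close>

lemma asymptotic_utility_growth_rates:
  assumes "growth_rates M u m v"
  shows "asymptotic_utility M \<gamma> u = ereal (m - \<gamma> * v)"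
  unfolding asymptotic_utility_def
proof (rule lim_imp_Liminf)
  have "((\<lambda>t. expectation (u t) / t - \<gamma> * (variance (u t) / t)) \<longlongrightarrow> m - \<gamma> * v) at_top"
    using assms by (intro tendsto_intros) (auto simp: growth_rates_def)
  then show "((\<lambda>t. ereal (1 / t * (expectation (u t) - \<gamma> * variance (u t)))) \<longlongrightarrow> ereal (m - \<gamma> * v)) at_top"
    by (simp add: diff_divide_distrib)
qed simp

end

section \<open>Domination by the linear policy with slope \<open>- K\<close>\<close>

theorem theorem3p2:
  fixes M :: "'a measure" and F :: "real \<Rightarrow> 'a measure"
    and z x :: "real \<Rightarrow> 'a \<Rightarrow> real" and \<alpha> \<sigma> K w :: real and f :: "real \<Rightarrow> real"
  assumes "filtered_prob_space M F"
    and "wiener_process M F z"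
    and "\<alpha> > 0" and "\<sigma> > 0"
    and "ornstein_uhlenbeck M F z \<alpha> \<sigma> x"
    and "integrable M (\<lambda>\<omega>. (x 0 \<omega>) ^ 4)"
    and "D_policy K f"
  shows "(\<exists>u. log_wealth M F z \<alpha> \<sigma> x w f u) \<and>
    (\<exists>g. linear_policy g \<and> D_policy K g \<and>
       (\<exists>u'. log_wealth M F z \<alpha> \<sigma> x w g u') \<and>
       (\<forall>u u'. log_wealth M F z \<alpha> \<sigma> x w f u \<longrightarrow> log_wealth M F z \<alpha> \<sigma> x w g u' \<longrightarrow>
          weakly_dominated M u u' \<and>
          (\<forall>\<gamma>\<ge>0. asymptotic_utility M \<gamma> u \<le> asymptotic_utility M \<gamma> u') \<and>
          (\<not> linear_policy f \<longrightarrow>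
             dominated M u u' \<and>
             (\<forall>\<gamma>\<ge>0. asymptotic_utility M \<gamma> u < asymptotic_utility M \<gamma> u'))))"
proof -
  interpret ou_process M F z x \<alpha> \<sigma>
    using assms by unfold_locales
  obtain f' where f: "\<And>y. (f has_real_derivative f' y) (at y)" and f': "continuous_on UNIV f'"
    using assms(7) by (auto simp: D_policy_def C1_differentiable_on_def has_real_derivative_iff_has_vector_derivative)
  have K: "\<bar>f' y\<bar> \<le> K" for y
    using assms(7) DERIV_imp_deriv[OF f[of y]] unfolding D_policy_def by metis
  have K0: "0 \<le> K" using K[of 0] by simp
  define g where "g y = - K * y" for y :: real
  have g: "(g has_real_derivative - K) (at y)" for y
    unfolding g_def by (auto intro!: derivative_eq_intros)
  have "linear_policy g" unfolding linear_policy_def g_def by (intro exI[of _ "- K"] exI[of _ 0]) simp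
  moreover have "D_policy K g"
    using g K0 DERIV_imp_deriv[OF g]
    by (auto simp: D_policy_def C1_differentiable_on_def has_real_derivative_iff_has_vector_derivative
        intro!: exI[of _ "\<lambda>_. - K"])
  moreover have "\<exists>u. log_wealth M F z \<alpha> \<sigma> x w f u" by (rule log_wealth_exists[OF f f' K])
  moreover have "\<exists>u. log_wealth M F z \<alpha> \<sigma> x w g u"
    by (rule log_wealth_exists[OF g, of K]) (use K0 in auto)
  moreover
  let ?c = "stat_mean stat_dev f'"
  obtain \<psi> L where \<psi>: "\<And>y. (\<psi> has_real_derivative (f' y - ?c + y * \<psi> y) / stat_dev\<^sup>2) (at y)"
    "\<And>y. \<bar>\<psi> y\<bar> \<le> L" "\<And>y. \<bar>y * \<psi> y\<bar> \<le> L"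
    using stein_equation[OF stat_dev(1) f' K] by blast
  define v where "v = (\<sigma>\<^sup>2 / (2 * \<alpha>))\<^sup>2 * (\<sigma>\<^sup>2 * stat_mean stat_dev (\<lambda>y. (\<psi> y)\<^sup>2))"
  have c: "- K \<le> ?c"
    using stat_mean_abs_le[OF stat_dev(1) borel_measurable_continuous_onI[OF f'] K] by simp
  have v: "0 \<le> v" unfolding v_def by (intro mult_nonneg_nonneg stat_mean_nonneg stat_dev) auto
  have strict: "- K < ?c" "0 < v" if "\<not> linear_policy f"
  proof -
    \<comment> \<open>A linear policy may have a constant term, so a constant derivative already
      makes \<open>f\<close> linear.\<close>
    have nonconst: "\<exists>y. f' y \<noteq> a" for a
    proof (rule ccontr)
      assume "\<nexists>y. f' y \<noteq> a"
      then have "((\<lambda>y. f y - a * y) has_real_derivative 0) (at y)" for y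
        using f[of y] by (auto intro!: derivative_eq_intros)
      then have eq: "f y - a * y = f 0 - a * 0" for y
        by (rule DERIV_isconst_all[rule_format])
      have "f y = a * y + f 0" for y using eq[of y] by simp
      then have "linear_policy f" unfolding linear_policy_def by blast
      then show False using that by contradiction
    qed
    have "0 < stat_mean stat_dev (\<lambda>y. f' y - (- K))"
    proof -
      obtain y0 where y0: "f' y0 \<noteq> - K" using nonconst by blast
      show ?thesis
      proof (rule stat_mean_pos[OF stat_dev(1), of _ "2 * K" y0])
        show "\<bar>f' y - (- K)\<bar> \<le> 2 * K" "0 \<le> f' y - (- K)" for y using K[of y] by linarith+
      qed (use y0 in \<open>auto intro!: continuous_intros f'\<close>)
    qed
    then show "- K < ?c"
      using stat_mean_diff_const[OF stat_dev(1) borel_measurable_continuous_onI[OF f'] K, of "- K"] by simp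
    \<comment> \<open>If \<open>\<psi>\<close> vanished identically, Stein's equation would force
      \<open>f'\<close> to equal its stationary mean.\<close>
    have "\<exists>y. \<psi> y \<noteq> 0"
    proof (rule ccontr)
      assume "\<nexists>y. \<psi> y \<noteq> 0"
      then have 0: "\<psi> = (\<lambda>_. 0)" by auto
      have "(f' y - ?c + y * 0) / stat_dev\<^sup>2 = 0" for y
        using \<psi>(1)[of y] unfolding 0 by (rule DERIV_unique[OF _ DERIV_const])
      then have "f' y = ?c" for y using stat_dev(1) by simp
      then show False using nonconst by blast
    qed
    then obtain y0 where "\<psi> y0 \<noteq> 0" by blast
    moreover have "continuous_on UNIV \<psi>" by (rule DERIV_imp_continuous_on[OF \<psi>(1)])
    ultimately have "0 < stat_mean stat_dev (\<lambda>y. (\<psi> y)\<^sup>2)"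
      using power_mono[OF \<psi>(2), of _ 2]
      by (intro stat_mean_pos[OF stat_dev(1), of _ "L\<^sup>2" y0]) (auto intro!: continuous_intros)
    then show "0 < v" unfolding v_def using \<alpha> \<sigma> by simp
  qed
  have "weakly_dominated M u u' \<and>
      (\<forall>\<gamma>\<ge>0. asymptotic_utility M \<gamma> u \<le> asymptotic_utility M \<gamma> u') \<and>
      (\<not> linear_policy f \<longrightarrow> dominated M u u' \<and>
        (\<forall>\<gamma>\<ge>0. asymptotic_utility M \<gamma> u < asymptotic_utility M \<gamma> u'))"
    if u: "log_wealth M F z \<alpha> \<sigma> x w f u" and u': "log_wealth M F z \<alpha> \<sigma> x w g u'" for u u'
  proof -
    let ?m = "- (\<sigma>\<^sup>2 / 2 * ?c)" and ?m' = "\<sigma>\<^sup>2 / 2 * K"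
    have r: "growth_rates M u ?m v"
      unfolding v_def by (rule growth_rates_log_wealth[OF f f' K \<psi> u])
    \<comment> \<open>For a constant derivative the right-hand side of Stein's equation vanishes, so
      \<open>\<psi> = 0\<close> with bound 0 is a solution, and the variance rate is 0.\<close>
    have r': "growth_rates M u' ?m' 0"
      using growth_rates_log_wealth[OF g _ _ _ _ _ u', of K "\<lambda>_. 0" 0] K0 stat_dev(1)
      by (simp add: stat_mean_const)
    have \<sigma>2: "0 < \<sigma>\<^sup>2 / 2" using \<sigma> by simp
    have m: "?m \<le> ?m'" using mult_left_mono[OF c, of "\<sigma>\<^sup>2 / 2"] \<sigma>2 by simp
    have m_strict: "?m < ?m'" if "- K < ?c" using mult_strict_left_mono[OF that \<sigma>2] by simp
    note U = asymptotic_utility_growth_rates[OF r] asymptotic_utility_growth_rates[OF r']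
    show ?thesis
    proof (intro conjI impI allI)
      show "weakly_dominated M u u'" unfolding weakly_dominated_def using r r' m v by blast
      show "asymptotic_utility M \<gamma> u \<le> asymptotic_utility M \<gamma> u'" if "0 \<le> \<gamma>" for \<gamma>
        unfolding U using m mult_nonneg_nonneg[OF that v] by simp
    next
      assume nl: "\<not> linear_policy f"
      show "dominated M u u'"
        unfolding dominated_def using r r' m_strict strict[OF nl] by blast
      show "asymptotic_utility M \<gamma> u < asymptotic_utility M \<gamma> u'" if "0 \<le> \<gamma>" for \<gamma>
        unfolding U using m_strict[OF strict(1)[OF nl]] mult_nonneg_nonneg[OF that v] by simp
    qed
  qed
  ultimately show ?thesis by blast
qed

end
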